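(* Let $\omega\subset\mathbb{R}^2$ be a bounded Lipschitz domain, $L>0$, $\Omega=\omega\times(0,L)$, $p>1$ and $u\in W^{1,p}(\Omega;\mathbb{R}^3)$. Suppose there exists a sequence $(u_\varepsilon)_\varepsilon\subset W^{1,p}(\Omega;\mathbb{R}^3)$ such that $\nabla u_\varepsilon\in\mathrm{SO}(3)$ a.e. in $Y^{\mathrm{rig}}_\varepsilon\cap\Omega$ for all $\varepsilon$ (with $Y^{\mathrm{rig}}_\varepsilon$ the fiber set defined in the context), such that the weak second derivatives $\partial_i\partial_ju_\varepsilon$, $i,j\in\{1,2\}$, exist and satisfy $$\sup_\varepsilon\max_{i,j\in\{1,2\}}\|\partial_i\partial_ju_\varepsilon\|_{L^p(\Omega;\mathbb{R}^3)}^p<\infty,$$ and such that $u_\varepsilon\rightharpoonup u$ in $W^{1,p}(\Omega;\mathbb{R}^3)$ as $\varepsilon\to0$. Then $u$ is a rigid body motion, i.e., $$u(x)=Rx+b,\quad x\in\Omega,$$ with a rotation $R\in\mathrm{SO}(3)$ and a translation vector $b\in\mathbb{R}^3$.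
   Context: A domain is an open, connected, non-empty set. Points of $\mathbb{R}^3$ are written $x=(x',x_3)$ with $x'=(x_1,x_2)\in\mathbb{R}^2$. Fiber geometry: let $Y=[0,1)^2$, and fix $\alpha\in(0,\tfrac12)$ and $\delta>0$ with $\delta+2\alpha<1$. For every $\varepsilon>0$ and $k\in\mathbb{Z}^2$ a domain $\omega_\varepsilon^k\subset\mathbb{R}^2$ is given such that (i) $\omega_\varepsilon^k\subset\varepsilon(k+[\alpha,1-\alpha)^2)$, and (ii) there is $a_\varepsilon^k\in\varepsilon(k+Y)$ with $S_\varepsilon^k:=a_\varepsilon^k+\varepsilon(-\tfrac\delta2,\tfrac\delta2)^2\subset\omega_\varepsilon^k$. Set $$Y^{\mathrm{rig}}_\varepsilon=\bigcup_{k\in\mathbb{Z}^2}\omega_\varepsilon^k\times\mathbb{R}.$$ Families indexed by $\varepsilon>0$ refer to any sequence $(\varepsilon_j)_j$ of positive numbers with $\varepsilon_j\to0$ as $j\to\infty$. *)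

theory Defs
  imports "HOL-Analysis.Analysis"
begin

section \<open>Domains\<close>

definition domain_set :: "'a::topological_space set \<Rightarrow> bool" where
  "domain_set U \<longleftrightarrow> open U \<and> connected U \<and> U \<noteq> {}"

text \<open>Near every boundary point, in suitable orthonormal coordinates, the set lies strictly on
  one side of the graph of a Lipschitz function.\<close>

definition bounded_lipschitz_domain :: "(real^2) set \<Rightarrow> bool" where
  "bounded_lipschitz_domain U \<longleftrightarrow> domain_set U \<and> bounded U \<and>
     (\<forall>z \<in> frontier U. \<exists>r > 0. \<exists>(Q :: real^2 \<Rightarrow> real^2) (\<gamma> :: real \<Rightarrow> real) C.
        orthogonal_transformation Q \<and> C-lipschitz_on UNIV \<gamma> \<and>
        U \<inter> ball z r = {x \<in> ball z r. Q x $ 2 > \<gamma> (Q x $ 1)})"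

section \<open>Test functions\<close>

primrec C_k :: "nat \<Rightarrow> ('a::real_normed_vector \<Rightarrow> 'b::real_normed_vector) \<Rightarrow> bool" where
  "C_k 0 f \<longleftrightarrow> continuous_on UNIV f"
| "C_k (Suc n) f \<longleftrightarrow>
     (\<exists>f'. (\<forall>x. (f has_derivative f' x) (at x)) \<and> (\<forall>h. C_k n (\<lambda>x. f' x h)))"

definition test_function :: "'a::real_normed_vector set \<Rightarrow> ('a \<Rightarrow> real) \<Rightarrow> bool" where
  "test_function U \<phi> \<longleftrightarrow> (\<forall>n. C_k n \<phi>) \<and>
     compact (closure {x. \<phi> x \<noteq> 0}) \<and> closure {x. \<phi> x \<noteq> 0} \<subseteq> U"

section \<open>Weak derivatives and Sobolev spaces\<close>

text \<open>Elements of \<open>L\<^sup>p(U)\<close> and \<open>W\<^sup>1\<^sup>,\<^sup>p(U)\<close> are represented by functions on the whole space; only the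
  values on \<open>U\<close>, up to null sets, matter.\<close>

definition locally_integrable_on ::
  "'a::euclidean_space set \<Rightarrow> ('a \<Rightarrow> 'b::euclidean_space) \<Rightarrow> bool" where
  "locally_integrable_on U f \<longleftrightarrow> (\<forall>K. compact K \<and> K \<subseteq> U \<longrightarrow> integrable (lebesgue_on K) f)"

definition has_weak_partial ::
  "(real^'n) set \<Rightarrow> 'n \<Rightarrow> (real^'n \<Rightarrow> 'b::euclidean_space) \<Rightarrow> (real^'n \<Rightarrow> 'b) \<Rightarrow> bool" where
  "has_weak_partial U i u g \<longleftrightarrow> locally_integrable_on U u \<and> locally_integrable_on U g \<and>
     (\<forall>\<phi>. test_function U \<phi> \<longrightarrow>
        integral\<^sup>L (lebesgue_on U) (\<lambda>x. frechet_derivative \<phi> (at x) (axis i 1) *\<^sub>R u x) =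
        - integral\<^sup>L (lebesgue_on U) (\<lambda>x. \<phi> x *\<^sub>R g x))"

definition weakly_differentiable ::
  "(real^'n) set \<Rightarrow> 'n \<Rightarrow> (real^'n \<Rightarrow> 'b::euclidean_space) \<Rightarrow> bool" where
  "weakly_differentiable U i u \<longleftrightarrow> (\<exists>g. has_weak_partial U i u g)"

text \<open>A representative; for open \<open>U\<close> it is determined up to a null set of \<open>U\<close>, and it is
  unspecified if the weak derivative does not exist.\<close>

definition weak_partial ::
  "(real^'n) set \<Rightarrow> 'n \<Rightarrow> (real^'n \<Rightarrow> 'b::euclidean_space) \<Rightarrow> (real^'n \<Rightarrow> 'b)" where
  "weak_partial U i u = (SOME g. has_weak_partial U i u g)"

definition weak_grad ::
  "(real^'n) set \<Rightarrow> (real^'n \<Rightarrow> real^'m) \<Rightarrow> real^'n \<Rightarrow> real^'n^'m" where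
  "weak_grad U u x = (\<chi> i j. weak_partial U j u x $ i)"

definition in_Lp :: "real \<Rightarrow> 'a::euclidean_space set \<Rightarrow> ('a \<Rightarrow> 'b::euclidean_space) \<Rightarrow> bool" where
  "in_Lp p U f \<longleftrightarrow> f \<in> borel_measurable (lebesgue_on U) \<and>
     integrable (lebesgue_on U) (\<lambda>x. norm (f x) powr p)"

text \<open>The \<open>p\<close>-th power of the \<open>L\<^sup>p\<close> norm, infinite for measurable functions outside \<open>L\<^sup>p\<close>.\<close>

definition Lp_norm_pow ::
  "real \<Rightarrow> 'a::euclidean_space set \<Rightarrow> ('a \<Rightarrow> 'b::euclidean_space) \<Rightarrow> ennreal" where
  "Lp_norm_pow p U f = (\<integral>\<^sup>+x. ennreal (norm (f x) powr p) \<partial>lebesgue_on U)"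

definition sobolev_W1 ::
  "real \<Rightarrow> (real^'n) set \<Rightarrow> (real^'n \<Rightarrow> 'b::euclidean_space) set" where
  "sobolev_W1 p U = {u. in_Lp p U u \<and>
     (\<forall>i. weakly_differentiable U i u \<and> in_Lp p U (weak_partial U i u))}"

definition sobolev_norm ::
  "real \<Rightarrow> (real^'n) set \<Rightarrow> (real^'n \<Rightarrow> 'b::euclidean_space) \<Rightarrow> real" where
  "sobolev_norm p U u =
     (enn2real (Lp_norm_pow p U u) + (\<Sum>i\<in>UNIV. enn2real (Lp_norm_pow p U (weak_partial U i u))))
       powr (1 / p)"

text \<open>Bounded linear functionals on \<open>W\<^sup>1\<^sup>,\<^sup>p(U)\<close>. Linearity and the bound make them independent of
  the chosen representatives.\<close>

definition sobolev_dual ::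
  "real \<Rightarrow> (real^'n) set \<Rightarrow> ((real^'n \<Rightarrow> 'b::euclidean_space) \<Rightarrow> real) set" where
  "sobolev_dual p U = {F.
     (\<forall>v \<in> sobolev_W1 p U. \<forall>w \<in> sobolev_W1 p U. F (\<lambda>x. v x + w x) = F v + F w) \<and>
     (\<forall>c. \<forall>v \<in> sobolev_W1 p U. F (\<lambda>x. c *\<^sub>R v x) = c * F v) \<and>
     (\<exists>C. \<forall>v \<in> sobolev_W1 p U. \<bar>F v\<bar> \<le> C * sobolev_norm p U v)}"

definition sobolev_weakly_converges ::
  "real \<Rightarrow> (real^'n) set \<Rightarrow> (nat \<Rightarrow> real^'n \<Rightarrow> 'b::euclidean_space) \<Rightarrow> (real^'n \<Rightarrow> 'b) \<Rightarrow> bool" where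
  "sobolev_weakly_converges p U us u \<longleftrightarrow>
     u \<in> sobolev_W1 p U \<and> (\<forall>n. us n \<in> sobolev_W1 p U) \<and>
     (\<forall>F \<in> sobolev_dual p U. (\<lambda>n. F (us n)) \<longlonglongrightarrow> F u)"

section \<open>Fiber geometry\<close>

definition cross_proj :: "real^3 \<Rightarrow> real^2" where
  "cross_proj x = vector [x $ 1, x $ 2]"

definition cylinder :: "(real^2) set \<Rightarrow> real \<Rightarrow> (real^3) set" where
  "cylinder w L = {x. cross_proj x \<in> w \<and> 0 < x $ 3 \<and> x $ 3 < L}"

text \<open>The scaled and shifted set \<open>\<epsilon>(k + A)\<close>.\<close>

definition cell :: "real \<Rightarrow> int^2 \<Rightarrow> (real^2) set \<Rightarrow> (real^2) set" where
  "cell \<epsilon> k A = (\<lambda>y. \<epsilon> *\<^sub>R ((\<chi> i. of_int (k $ i)) + y)) ` A"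

definition fiber_family :: "real \<Rightarrow> real \<Rightarrow> (real \<Rightarrow> int^2 \<Rightarrow> (real^2) set) \<Rightarrow> bool" where
  "fiber_family \<alpha> \<delta> W \<longleftrightarrow>
     (\<forall>\<epsilon> > 0. \<forall>k.
        domain_set (W \<epsilon> k) \<and>
        W \<epsilon> k \<subseteq> cell \<epsilon> k {y. \<forall>i. y $ i \<in> {\<alpha>..<1 - \<alpha>}} \<and>
        (\<exists>a \<in> cell \<epsilon> k {y. \<forall>i. y $ i \<in> {0..<1}}.
           (\<lambda>y. a + \<epsilon> *\<^sub>R y) ` {y. \<forall>i. y $ i \<in> {- \<delta> / 2<..<\<delta> / 2}} \<subseteq> W \<epsilon> k))"

definition Y_rig :: "(real \<Rightarrow> int^2 \<Rightarrow> (real^2) set) \<Rightarrow> real \<Rightarrow> (real^3) set" where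
  "Y_rig W \<epsilon> = (\<Union>k. {x. cross_proj x \<in> W \<epsilon> k})"

end

theory Submission
  imports Defs
begin

text \<open>On the part of a fiber inside \<open>\<Omega>\<close> the map \<open>u\<^sub>\<epsilon>\<close> is a rigid motion. Indeed, a gradient that takes
  values in \<open>SO(3)\<close> is its own cofactor matrix, hence divergence free, so its mollifications \<open>V\<close> are
  harmonic, and \<open>\<integral> \<phi> \<bar>\<nabla>V\<bar>\<^sup>2 = 1/2 \<integral> \<bar>V\<bar>\<^sup>2 \<Delta>\<phi>\<close> tends to \<open>0\<close> because \<open>\<bar>V\<bar>\<^sup>2\<close> tends to a constant.

  Let \<open>V\<close> be the mollification of \<open>\<nabla>u\<^sub>\<epsilon>\<close> at a scale \<open>s \<ge> \<epsilon>\<close> at a point \<open>x\<close>, and \<open>R\<close> the rotation on the fiber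
  whose cell contains \<open>x\<close>. The difference of the two kernels that produce the first two columns of \<open>V\<close> and
  \<open>R\<close> is the horizontal divergence of a compactly supported field, so that \<open>V - R\<close> is bounded by an integral
  of the horizontal second derivatives; for the third column this works after moving the vertical derivative
  to the kernel. Integrated over \<open>x\<close>, the bound is of order \<open>s\<close>, uniformly in \<open>\<epsilon>\<close>. Letting first \<open>\<epsilon>\<close> and then
  \<open>s\<close> tend to \<open>0\<close> gives \<open>\<nabla>u \<in> SO(3)\<close> almost everywhere, and the first step applies to \<open>u\<close> itself.

  All test functions are products of functions of one variable, for which the required antiderivatives
  are explicit.\<close>

subsection \<open>Smooth functions\<close>

text \<open>Weak convergence of the gradients does not preserve the nonlinear constraint SO(3), and
  nothing controls how the gradient varies in direction 3. Mollifying at a fixed scale s removes the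
  first difficulty: the mollified gradient at a point is the map tested against one smooth kernel,
  hence converges pointwise, and Fatou's lemma carries over the integrated distance to SO(3). The
  second is met by rigidity: on a fiber the gradient is constant over the whole height of the
  kernel, so that two kernels with the same vertical factor need comparing in the horizontal
  variables only.

  The kernel is exchanged for one on the fiber one variable at a time. In each intermediate field at
  least one horizontal factor is an antiderivative, which is bounded, so that at most one factor of
  height 1/\<epsilon> survives. Its weight 1/(\<epsilon> s) on a slab with volume of order
  \<epsilon> s^2 and the weight 1/s^2 on a cube with volume of order s^3 both integrate to order s;
  an L^1 bound on the second derivatives is enough.\<close>

lemma C_k_Suc_imp: "C_k (Suc n) f \<Longrightarrow> C_k n f"
proof (induction n arbitrary: f)
  case 0
  then show ?case
    using has_derivative_continuous by (fastforce intro!: continuous_at_imp_continuous_on)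
next
  case (Suc n)
  then show ?case by (metis C_k.simps(2))
qed

lemma C_k_antimono: "C_k n f \<Longrightarrow> m \<le> n \<Longrightarrow> C_k m f"
  by (induction n) (use C_k_Suc_imp le_Suc_eq in \<open>blast+\<close>)

lemma C_k_continuous: "C_k n f \<Longrightarrow> continuous_on UNIV f"
  using C_k_antimono[of n f 0] by simp

lemma C_k_const: "C_k n (\<lambda>x. c)"
proof (induction n arbitrary: c)
  case (Suc n)
  then show ?case by (auto intro!: exI[of _ "\<lambda>x h. 0"])
qed simp

lemma C_k_add: "C_k n f \<Longrightarrow> C_k n g \<Longrightarrow> C_k n (\<lambda>x. f x + g x)"
proof (induction n arbitrary: f g)
  case 0
  then show ?case by (auto intro: continuous_intros)
next
  case (Suc n)
  then obtain f' g' where "\<And>x. (f has_derivative f' x) (at x)" "\<And>h. C_k n (\<lambda>x. f' x h)"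
    "\<And>x. (g has_derivative g' x) (at x)" "\<And>h. C_k n (\<lambda>x. g' x h)" by auto
  then show ?case using Suc.IH
    by (auto intro!: exI[of _ "\<lambda>x h. f' x h + g' x h"] derivative_eq_intros)
qed

lemma C_k_mult:
  fixes f g :: "'a::real_normed_vector \<Rightarrow> real"
  shows "C_k n f \<Longrightarrow> C_k n g \<Longrightarrow> C_k n (\<lambda>x. f x * g x)"
proof (induction n arbitrary: f g)
  case 0
  then show ?case by (auto intro: continuous_intros)
next
  case (Suc n)
  from Suc.prems obtain f' g' where *: "\<And>x. (f has_derivative f' x) (at x)" "\<And>h. C_k n (\<lambda>x. f' x h)"
    "\<And>x. (g has_derivative g' x) (at x)" "\<And>h. C_k n (\<lambda>x. g' x h)" by auto
  have "C_k n f" "C_k n g" using Suc.prems C_k_Suc_imp by blast+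
  then show ?case using Suc.IH *
    by (auto intro!: exI[of _ "\<lambda>x h. f x * g' x h + f' x h * g x"] has_derivative_mult C_k_add)
qed

lemma C_k_cmult:
  fixes f :: "'a::real_normed_vector \<Rightarrow> real"
  shows "C_k n f \<Longrightarrow> C_k n (\<lambda>x. c * f x)"
  by (intro C_k_mult C_k_const)

lemma C_k_diff:
  fixes f g :: "'a::real_normed_vector \<Rightarrow> real"
  assumes "C_k n f" "C_k n g" shows "C_k n (\<lambda>x. f x - g x)"
  using C_k_add[OF assms(1) C_k_cmult[OF assms(2), of "-1"]] by simp

lemma C_k_prod:
  fixes f :: "'i \<Rightarrow> 'a::real_normed_vector \<Rightarrow> real"
  shows "(\<And>i. i \<in> I \<Longrightarrow> C_k n (f i)) \<Longrightarrow> C_k n (\<lambda>x. \<Prod>i\<in>I. f i x)"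
  by (induction I rule: infinite_finite_induct) (auto simp: C_k_const intro!: C_k_mult)

lemma C_k_compose_affine:
  assumes l: "bounded_linear l"
  shows "C_k n f \<Longrightarrow> C_k n (\<lambda>x. f (c + l x))"
proof (induction n arbitrary: f)
  case 0
  have "continuous_on UNIV (\<lambda>x. c + l x)"
    using linear_continuous_on[OF l] by (intro continuous_intros) auto
  with 0 show ?case using continuous_on_compose2[of UNIV f UNIV] by auto
next
  case (Suc n)
  from Suc.prems obtain f' where *: "\<And>x. (f has_derivative f' x) (at x)" "\<And>h. C_k n (\<lambda>x. f' x h)"
    by auto
  have "((\<lambda>x. f (c + l x)) has_derivative (\<lambda>h. f' (c + l x) (l h))) (at x)" for x
    by (rule has_derivative_compose[of "\<lambda>x. c + l x" l x UNIV f, simplified])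
       (auto intro!: derivative_eq_intros *(1) bounded_linear.has_derivative[OF l])
  moreover have "C_k n (\<lambda>x. f' (c + l x) (l h))" for h
    using Suc.IH[OF *(2)[of "l h"]] .
  ultimately show ?case unfolding C_k.simps
    by (auto intro!: exI[of _ "\<lambda>x h. f' (c + l x) (l h)"])
qed

text \<open>On the line the derivative in direction h is h times the one in direction 1, so that
  \<open>C_k\<close> can be checked through ordinary derivatives.\<close>

lemma C_k_Suc_real:
  fixes f :: "real \<Rightarrow> real"
  shows "C_k (Suc n) f \<longleftrightarrow> (\<exists>g. (\<forall>x. (f has_real_derivative g x) (at x)) \<and> C_k n g)"
proof
  assume "C_k (Suc n) f"
  then obtain f' where f': "\<And>x. (f has_derivative f' x) (at x)" "\<And>h. C_k n (\<lambda>x. f' x h)" by auto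
  have "(f has_real_derivative f' x 1) (at x)" for x
  proof -
    have "linear (f' x)" using f'(1) has_derivative_linear by blast
    then have "f' x h = f' x 1 * h" for h
      using linear_cmul[of "f' x" h 1] by (simp add: mult.commute)
    then have "f' x = (*) (f' x 1)" by (rule ext)
    then show ?thesis using f'(1)[of x] unfolding has_field_derivative_def by metis
  qed
  note d1 = this
  show "\<exists>g. (\<forall>x. (f has_real_derivative g x) (at x)) \<and> C_k n g"
  proof (rule exI[where x="\<lambda>x. f' x 1"], rule conjI, rule allI)
    show "(f has_real_derivative f' x 1) (at x)" for x by (rule d1)
    show "C_k n (\<lambda>x. f' x 1)" by (rule f'(2))
  qed
next
  assume "\<exists>g. (\<forall>x. (f has_real_derivative g x) (at x)) \<and> C_k n g"
  then obtain g where g: "\<And>x. (f has_real_derivative g x) (at x)" "C_k n g" by blast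
  then show "C_k (Suc n) f"
    by (auto intro!: exI[of _ "\<lambda>x h. g x * h"] simp: has_field_derivative_def[symmetric]
        C_k_mult C_k_const)
qed

lemma C_k_Suc_deriv:
  fixes f :: "real \<Rightarrow> real"
  assumes "C_k (Suc n) f"
  shows "(f has_real_derivative deriv f x) (at x)" "C_k n (deriv f)"
proof -
  obtain g where g: "\<And>x. (f has_real_derivative g x) (at x)" "C_k n g"
    using assms C_k_Suc_real by blast
  then have "deriv f = g" by (auto intro: DERIV_imp_deriv)
  with g show "(f has_real_derivative deriv f x) (at x)" "C_k n (deriv f)" by auto
qed

section \<open>Smooth functions that are flat at 0\<close>

lemma tendsto_poly_exp_neg:
  "((\<lambda>x::real. poly p x * exp (- x)) \<longlongrightarrow> 0) at_top"
proof -
  have "((\<lambda>x::real. \<Sum>i\<le>degree p. coeff p i * (x ^ i / exp x)) \<longlongrightarrow> (\<Sum>i\<le>degree p. coeff p i * 0)) at_top"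
    by (intro tendsto_intros tendsto_power_div_exp_0)
  moreover have "(\<Sum>i\<le>degree p. coeff p i * (x ^ i / exp x)) = poly p x * exp (- x)" for x
    by (simp add: poly_altdef sum_distrib_right exp_minus divide_inverse mult.assoc)
  ultimately show ?thesis by simp
qed

text \<open>All derivatives of \<open>exp (- 1 / x)\<close> have the form \<open>p (1 / x) exp (- 1 / x)\<close> with a polynomial \<open>p\<close>.\<close>

definition flat :: "real poly \<Rightarrow> real \<Rightarrow> real" where
  "flat p x = (if x > 0 then poly p (1 / x) * exp (- (1 / x)) else 0)"

lemma flat_tendsto: "(flat p \<longlongrightarrow> 0) (at_right 0)"
proof -
  have "((\<lambda>x::real. poly p (inverse x) * exp (- inverse x)) \<longlongrightarrow> 0) (at_right 0)"
    using filterlim_compose[OF tendsto_poly_exp_neg filterlim_inverse_at_top_right] .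
  then show ?thesis
    by (rule Lim_transform_eventually)
       (auto simp: eventually_at_right_field flat_def field_simps intro!: exI[of _ 1])
qed

text \<open>The chain rule for p(1/x) exp(-1/x) gives (1/x^2) (p - p')(1/x) exp(-1/x), whence the
  factor X^2, written \<open>[:0, 0, 1:]\<close>. To the right of 0 the difference quotient at 0 is
  again a flat function, that of X p, and tends to 0.\<close>

lemma flat_deriv:
  "(flat p has_real_derivative flat ([:0, 0, 1:] * (p - pderiv p)) x) (at x)"
proof (cases "x = 0")
  case True
  have "((\<lambda>h. (flat p (0 + h) - flat p 0) / h) \<longlongrightarrow> 0) (at_right 0)"
    using flat_tendsto[of "[:0, 1:] * p"]
    by (rule Lim_transform_eventually)
       (auto simp: eventually_at_right_field flat_def field_simps intro!: exI[of _ 1])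
  moreover have "((\<lambda>h. (flat p (0 + h) - flat p 0) / h) \<longlongrightarrow> 0) (at_left 0)"
    by (rule tendsto_eventually)
       (auto simp: eventually_at_left_field flat_def intro!: exI[of _ "-1"])
  ultimately have "((\<lambda>h. (flat p (0 + h) - flat p 0) / h) \<longlongrightarrow> 0) (at 0)"
    using filterlim_split_at by blast
  then show ?thesis using True by (simp add: DERIV_def flat_def)
next
  case False
  consider "x > 0" | "x < 0" using False by linarith
  then show ?thesis
  proof cases
    case 1
    have inv: "((\<lambda>x. 1 / x) has_real_derivative - (1 / x)\<^sup>2) (at x)"
      using 1 by (auto intro!: derivative_eq_intros simp: power2_eq_square)
    have "((\<lambda>x. poly p (1 / x) * exp (- (1 / x))) has_real_derivative
       poly (pderiv p) (1 / x) * (- (1 / x)\<^sup>2) * exp (- (1 / x)) +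
       exp (- (1 / x)) * - (- (1 / x)\<^sup>2) * poly p (1 / x)) (at x)"
      by (intro DERIV_mult DERIV_chain2[OF poly_DERIV] DERIV_chain2[OF DERIV_exp] DERIV_minus inv)
    also have "poly (pderiv p) (1 / x) * (- (1 / x)\<^sup>2) * exp (- (1 / x)) +
       exp (- (1 / x)) * - (- (1 / x)\<^sup>2) * poly p (1 / x) = flat ([:0, 0, 1:] * (p - pderiv p)) x"
      using 1 unfolding flat_def by (simp add: power2_eq_square) (simp add: algebra_simps diff_divide_distrib)
    finally have "((\<lambda>x. poly p (1 / x) * exp (- (1 / x))) has_real_derivative
       flat ([:0, 0, 1:] * (p - pderiv p)) x) (at x)" .
    then show ?thesis
      by (rule has_field_derivative_transform_within_open[where S="{0<..}"])
         (use 1 in \<open>auto simp: flat_def\<close>)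
  next
    case 2
    have "((\<lambda>x. 0) has_real_derivative flat ([:0, 0, 1:] * (p - pderiv p)) x) (at x)"
      using 2 by (auto simp: flat_def)
    then show ?thesis
      by (rule has_field_derivative_transform_within_open[where S="{..<0}"])
         (use 2 in \<open>auto simp: flat_def\<close>)
  qed
qed

lemma C_k_flat: "C_k n (flat p)"
proof (induction n arbitrary: p)
  case 0
  show ?case using flat_deriv by (auto intro!: continuous_at_imp_continuous_on DERIV_isCont)
next
  case (Suc n)
  then show ?case unfolding C_k_Suc_real using flat_deriv by blast
qed

subsection \<open>Bump functions on the line\<close>

definition bump :: "real \<Rightarrow> real \<Rightarrow> (real \<Rightarrow> real) \<Rightarrow> bool" where
  "bump a b g \<longleftrightarrow> (\<forall>n. C_k n g) \<and> (\<forall>x. x \<notin> {a..b} \<longrightarrow> g x = 0)"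

lemma bump_mono: "bump a b g \<Longrightarrow> a' \<le> a \<Longrightarrow> b \<le> b' \<Longrightarrow> bump a' b' g"
  unfolding bump_def by (metis atLeastAtMost_iff order_trans)

lemma bump_continuous: "bump a b g \<Longrightarrow> continuous_on S g"
  unfolding bump_def using C_k_continuous continuous_on_subset by blast

lemma bump_measurable [measurable_dest]: "bump a b g \<Longrightarrow> g \<in> borel_measurable borel"
  using bump_continuous borel_measurable_continuous_onI by blast

lemma bump_has_deriv: "bump a b g \<Longrightarrow> (g has_real_derivative deriv g x) (at x)"
  unfolding bump_def using C_k_Suc_deriv(1) by blast

lemma bump_deriv: assumes "bump a b g" shows "bump a b (deriv g)"
proof -
  have "deriv g x = 0" if "x \<notin> {a..b}" for x
  proof -
    have "((\<lambda>x. 0) has_real_derivative 0) (at x)" by auto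
    then have "(g has_real_derivative 0) (at x)"
      by (rule has_field_derivative_transform_within_open[where S="- {a..b}"])
         (use assms that in \<open>auto simp: bump_def\<close>)
    then show ?thesis by (rule DERIV_imp_deriv)
  qed
  then show ?thesis using assms C_k_Suc_deriv(2) unfolding bump_def by blast
qed

lemma bump_diff: "bump a b f \<Longrightarrow> bump a b g \<Longrightarrow> bump a b (\<lambda>x. f x - g x)"
  unfolding bump_def by (auto intro: C_k_diff)

lemma bump_cmult: "bump a b f \<Longrightarrow> bump a b (\<lambda>x. c * f x)"
  unfolding bump_def by (auto intro: C_k_cmult)

lemma bump_mult: "bump a b f \<Longrightarrow> bump a b g \<Longrightarrow> bump a b (\<lambda>x. f x * g x)"
  unfolding bump_def by (auto intro: C_k_mult)

lemma bump_reflect: assumes "bump a b f" shows "bump (x - b) (x - a) (\<lambda>y. f (x - y))"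
proof -
  have "C_k n (\<lambda>y. f (x + - y))" for n
    using C_k_compose_affine[of uminus n f x] assms bounded_linear_minus[OF bounded_linear_ident]
    unfolding bump_def by auto
  then show ?thesis using assms unfolding bump_def by auto
qed

lemma deriv_reflect: assumes "bump a b f" shows "deriv (\<lambda>y. f (x - y)) y = - deriv f (x - y)"
proof (rule DERIV_imp_deriv)
  have "((\<lambda>y. f (x - y)) has_real_derivative deriv f (x - y) * (0 - 1)) (at y)"
    by (intro DERIV_chain2[OF bump_has_deriv[OF assms]] derivative_intros)
  then show "((\<lambda>y. f (x - y)) has_real_derivative - deriv f (x - y)) (at y)" by simp
qed

lemma bump_scale: assumes "bump a b f" "0 < s" shows "bump (s * a) (s * b) (\<lambda>y. f (y / s) / s)"
proof -
  have "C_k n (\<lambda>y. f (0 + (1 / s) * y))" for n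
    using C_k_compose_affine[of "\<lambda>y. (1/s) * y" n f 0] assms bounded_linear_mult_right[of "1/s"]
    unfolding bump_def by auto
  then have "C_k n (\<lambda>y. (1/s) * f (0 + (1 / s) * y))" for n by (rule C_k_cmult)
  moreover have "f (y / s) = 0" if "y \<notin> {s * a..s * b}" for y
    using assms that unfolding bump_def by (auto simp: field_simps)
  ultimately show ?thesis using assms unfolding bump_def by auto
qed

lemma bump_bounded: assumes "bump a b g" obtains C where "C > 0" "\<And>x. \<bar>g x\<bar> \<le> C"
proof -
  have "bounded (g ` {a..b})"
    using bump_continuous[OF assms] by (intro compact_imp_bounded compact_continuous_image) auto
  then obtain C where "C > 0" "\<forall>x\<in>{a..b}. \<bar>g x\<bar> \<le> C" unfolding bounded_pos by auto
  then have "\<bar>g x\<bar> \<le> C" for x using assms unfolding bump_def by (cases "x \<in> {a..b}") auto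
  then show thesis using that \<open>C > 0\<close> by blast
qed

lemma bump_integrable: assumes "bump a b g" shows "integrable lborel g"
proof -
  have "integrable lborel (\<lambda>x. indicator {a..b} x *\<^sub>R g x)"
    using bump_continuous[OF assms] by (intro borel_integrable_compact) auto
  moreover have "(\<lambda>x. indicator {a..b} x *\<^sub>R g x) = g"
    using assms by (auto simp: bump_def fun_eq_iff indicator_def)
  ultimately show ?thesis by simp
qed

lemma bump_integral: assumes "bump a b g"
  shows "integral\<^sup>L lborel g = integral {a..b} g"
proof -
  have "(\<lambda>x. indicator {a..b} x *\<^sub>R g x) = g"
    using assms by (auto simp: bump_def fun_eq_iff indicator_def)
  moreover have "set_integrable lborel {a..b} g"
    unfolding set_integrable_def using bump_continuous[OF assms] by (intro borel_integrable_compact) auto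
  ultimately show ?thesis
    using set_borel_integral_eq_integral(2)[of "{a..b}" g] unfolding set_lebesgue_integral_def by simp
qed

lemma bump_integral_deriv: assumes "bump a b g" shows "integral\<^sup>L lborel (deriv g) = 0"
proof -
  \<comment> \<open>The interval may be empty; the minimum keeps the enlarged one nonempty, and
    \<open>g\<close> vanishes at both of its endpoints.\<close>
  let ?a = "min a b - 1" and ?b = "b + 1"
  have b: "bump ?a ?b g" using bump_mono[OF assms, of ?a ?b] by auto
  have "(deriv g has_integral (g ?b - g ?a)) {?a..?b}"
    by (intro fundamental_theorem_of_calculus)
       (auto intro: DERIV_subset has_field_derivative_at_within bump_has_deriv[OF assms]
         simp: has_real_derivative_iff_has_vector_derivative[symmetric])
  moreover have "?b \<notin> {a..b}" "?a \<notin> {a..b}" by auto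
  then have "g ?b = 0" "g ?a = 0" using assms unfolding bump_def by blast+
  ultimately show ?thesis using bump_integral[OF bump_deriv[OF b]] by (simp add: integral_unique)
qed

text \<open>Mean zero makes the antiderivative vanish to the right of the support as well, which
  inverts the divergence in one variable. Its bound by the L^1 norm does not see how concentrated
  \<open>g\<close> is; this matters for kernels living on thin fibers.\<close>

lemma bump_antideriv:
  assumes g: "bump a b g" and 0: "integral\<^sup>L lborel g = 0"
  obtains P where "bump a b P" "deriv P = g" "\<And>x. \<bar>P x\<bar> \<le> (LBINT x. \<bar>g x\<bar>)"
proof -
  \<comment> \<open>The minimum makes the interval degenerate for x < a, so that \<open>P\<close>
    vanishes there.\<close>
  define P where "P x = integral {min a x..x} g" for x
  have cont: "continuous_on S g" for S using bump_continuous[OF g] .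
  \<comment> \<open>Near any point \<open>P\<close> may be computed from one fixed lower limit, as
    the fundamental theorem requires.\<close>
  have P_eq: "integral {c..x} g = P x" if "c \<le> a" "c \<le> x" for c x
  proof -
    have "integral {c..min a x} g = integral {c..min a x} (\<lambda>x. 0)"
      using that by (intro integral_spike[of "{a}"]) (use g in \<open>auto simp: bump_def\<close>)
    then have "integral {c..x} g = 0 + integral {min a x..x} g"
      using that Henstock_Kurzweil_Integration.integral_combine[of c "min a x" x g]
        integrable_continuous_interval[OF cont] by auto
    then show ?thesis by (simp add: P_def)
  qed
  have P': "(P has_real_derivative g x) (at x)" for x
  proof -
    let ?c = "min a x - 1" and ?d = "x + 1"
    have "((\<lambda>u. integral {?c..u} g) has_vector_derivative g x) (at x within {?c..?d})"
      using integral_has_vector_derivative[OF cont, of x ?c ?d] by auto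
    then have "((\<lambda>u. integral {?c..u} g) has_real_derivative g x) (at x)"
      using at_within_Icc_at[of ?c x ?d] by (simp add: has_real_derivative_iff_has_vector_derivative)
    then show ?thesis
      by (rule has_field_derivative_transform_within_open[where S="{?c<..}"]) (auto intro: P_eq)
  qed
  then have d: "deriv P = g" using DERIV_imp_deriv by blast
  have C: "C_k n P" for n
  proof -
    have "C_k (Suc n) P" using P' g C_k_Suc_real bump_def by metis
    then show ?thesis by (rule C_k_Suc_imp)
  qed
  have le: "\<bar>P x\<bar> \<le> (LBINT x. \<bar>g x\<bar>)" for x
  proof -
    have si: "set_integrable lborel {min a x..x} g"
      unfolding set_integrable_def using cont by (intro borel_integrable_compact) auto
    then have "P x = (LBINT y. indicator {min a x..x} y *\<^sub>R g y)"
      using set_borel_integral_eq_integral(2)[OF si] unfolding set_lebesgue_integral_def P_def by simp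
    also have "\<bar>\<dots>\<bar> \<le> (LBINT y. \<bar>indicator {min a x..x} y *\<^sub>R g y\<bar>)"
      using integral_norm_bound[of lborel "\<lambda>y. indicator {min a x..x} y *\<^sub>R g y"] by simp
    also have "\<dots> \<le> (LBINT x. \<bar>g x\<bar>)"
      using si bump_integrable[OF g] unfolding set_integrable_def
      by (intro integral_mono integrable_abs) (auto simp: indicator_def)
    finally show ?thesis .
  qed
  have z: "P x = 0" if "x \<notin> {a..b}" for x
  proof (cases "x < a")
    case True
    then show ?thesis by (simp add: P_def)
  next
    case False
    with that have x: "x > b" "x \<ge> a" by auto
    have "P x = integral {a..x} g" using x by (simp add: P_def)
    also have "\<dots> = integral\<^sup>L lborel g"
      using bump_integral[OF bump_mono[OF g, of a x]] x by simp
    finally show ?thesis using 0 by simp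
  qed
  show thesis using that[of P] C z d le unfolding bump_def by blast
qed

section \<open>The standard mollifier on the line\<close>

definition bump0 :: "real \<Rightarrow> real" where
  "bump0 x = flat 1 (1 + x) * flat 1 (1 - x)"

lemma bump0: "bump (-1) 1 bump0" "bump0 x \<ge> 0" "integral\<^sup>L lborel bump0 > 0"
proof -
  have "C_k n (\<lambda>x. flat 1 (1 + x))" "C_k n (\<lambda>x. flat 1 (1 + - x))" for n
    using C_k_compose_affine[of "\<lambda>x. x" n "flat 1" 1] C_k_compose_affine[of uminus n "flat 1" 1]
      C_k_flat bounded_linear_minus[OF bounded_linear_ident] by auto
  then have "C_k n bump0" for n unfolding bump0_def using C_k_mult[of n "\<lambda>x. flat 1 (1 + x)"] by simp
  then show b: "bump (-1) 1 bump0" unfolding bump_def by (auto simp: bump0_def flat_def)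
  show nn: "bump0 x \<ge> 0" for x by (simp add: bump0_def flat_def)
  have "integral\<^sup>L lborel bump0 \<noteq> 0"
  proof
    assume "integral\<^sup>L lborel bump0 = 0"
    then have "AE x in lborel. bump0 x = 0"
      using integral_nonneg_eq_0_iff_AE[OF bump_integrable[OF b]] nn by auto
    then have "AE x in lborel. x \<notin> {-1<..<1::real}"
      by eventually_elim (auto simp: bump0_def flat_def)
    then have "{-1<..<1::real} \<in> null_sets lborel"
      using AE_iff_null_sets[of "{-1<..<1::real}" lborel] by simp
    then have "emeasure lborel {-1<..<1::real} = 0" by blast
    moreover have "emeasure lborel {-1<..<1::real} = ennreal 2" by (subst emeasure_lborel_Ioo) auto
    ultimately show False by (metis ennreal_eq_0_iff not_numeral_le_zero)
  qed
  moreover have "integral\<^sup>L lborel bump0 \<ge> 0" using nn by simp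
  ultimately show "integral\<^sup>L lborel bump0 > 0" by simp
qed

definition moll :: "real \<Rightarrow> real \<Rightarrow> real" where
  "moll s x = bump0 (x / s) / s / integral\<^sup>L lborel bump0"

lemma moll_bump: "0 < s \<Longrightarrow> bump (- s) s (moll s)"
  using bump_cmult[OF bump_scale[OF bump0(1), of s], of "1 / integral\<^sup>L lborel bump0"]
  by (simp add: moll_def[abs_def] mult.commute)

lemma moll_nonneg: "0 < s \<Longrightarrow> moll s x \<ge> 0"
  using bump0 by (simp add: moll_def less_imp_le)

lemma moll_integral: assumes "0 < s" shows "integral\<^sup>L lborel (moll s) = 1"
proof -
  have "(LBINT x. bump0 (x / s)) = s * integral\<^sup>L lborel bump0"
    using lborel_integral_real_affine[of s "\<lambda>x. bump0 (x / s)" 0] assms by simp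
  then show ?thesis using assms bump0(3) by (simp add: moll_def[abs_def])
qed

text \<open>Scaling determines the powers of s. A single constant for all scales lets the same bound
  serve the mollifier at scale s and the kernel on a thin fiber.\<close>

lemma moll_le:
  obtains C where "C > 0" "\<And>s x. 0 < s \<Longrightarrow> moll s x \<le> C / s"
    "\<And>s x. 0 < s \<Longrightarrow> \<bar>deriv (moll s) x\<bar> \<le> C / s\<^sup>2"
proof -
  let ?I = "integral\<^sup>L lborel bump0"
  obtain C where C: "C > 0" "\<And>x. \<bar>bump0 x\<bar> \<le> C" using bump_bounded[OF bump0(1)] by blast
  obtain D where D: "D > 0" "\<And>x. \<bar>deriv bump0 x\<bar> \<le> D" using bump_bounded[OF bump_deriv[OF bump0(1)]] by blast
  have "moll s x \<le> ((C + D) / ?I) / s" if "0 < s" for s x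
    using C(2)[of "x / s"] D(1) bump0(3) that by (simp add: moll_def divide_simps)
  moreover have "\<bar>deriv (moll s) x\<bar> \<le> ((C + D) / ?I) / s\<^sup>2" if "0 < s" for s x
  proof -
    have "(moll s has_real_derivative deriv bump0 (x / s) * (1 / s) / s / ?I) (at x)"
      unfolding moll_def using that
      by (intro DERIV_cdivide DERIV_chain2[OF bump_has_deriv[OF bump0(1)]])
         (auto intro!: derivative_eq_intros)
    then have "deriv (moll s) x = deriv bump0 (x / s) / s\<^sup>2 / ?I"
      using DERIV_imp_deriv by (force simp: power2_eq_square)
    then have "\<bar>deriv (moll s) x\<bar> = \<bar>deriv bump0 (x / s)\<bar> / s\<^sup>2 / ?I"
      using bump0(3) by (simp add: abs_divide)
    also have "\<dots> \<le> (C + D) / s\<^sup>2 / ?I"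
      using D(2)[of "x / s"] C(1) bump0(3) by (intro divide_right_mono) auto
    finally show ?thesis by (simp add: mult.commute)
  qed
  ultimately show thesis using that[of "(C + D) / ?I"] C D bump0(3) by auto
qed

subsection \<open>Tensor product test functions\<close>

definition tens :: "('n::finite \<Rightarrow> real \<Rightarrow> real) \<Rightarrow> real^'n \<Rightarrow> real" where
  "tens g x = (\<Prod>i\<in>UNIV. g i (x $ i))"

definition tbump :: "real^'n \<Rightarrow> real^'n \<Rightarrow> ('n::finite \<Rightarrow> real \<Rightarrow> real) \<Rightarrow> bool" where
  "tbump a b g \<longleftrightarrow> (\<forall>i. bump (a $ i) (b $ i) (g i))"

text \<open>Partial differentiation at the level of factors: \<open>tens (dt i g)\<close> is the
  i-th partial derivative of \<open>tens g\<close>, so that derivatives of test functions remain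
  tensor products.\<close>

definition dt :: "'n \<Rightarrow> ('n \<Rightarrow> real \<Rightarrow> real) \<Rightarrow> ('n::finite \<Rightarrow> real \<Rightarrow> real)" where
  "dt i g = g(i := deriv (g i))"

lemma dt_commute: "dt i (dt j g) = dt j (dt i g)"
  by (auto simp: dt_def fun_eq_iff)

lemma tbump_dt: "tbump a b g \<Longrightarrow> tbump a b (dt i g)"
  by (auto simp: tbump_def dt_def bump_deriv)

lemma tens_zero: "tbump a b g \<Longrightarrow> x \<notin> cbox a b \<Longrightarrow> tens g x = 0"
  unfolding tbump_def bump_def tens_def mem_box_cart by (auto intro!: prod_zero)

lemma tens_split: "tens g x = g i (x $ i) * (\<Prod>j\<in>UNIV - {i}. g j (x $ j))"
  unfolding tens_def by (subst prod.remove[of _ i]) auto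

lemma tens_C_k: fixes g :: "'n::finite \<Rightarrow> real \<Rightarrow> real" assumes "tbump a b g" shows "C_k n (tens g)"
proof -
  have "C_k n (\<lambda>x::real^'n. g i (0 + x $ i))" for i
    using assms C_k_compose_affine[OF bounded_linear_vec_nth, of n "g i" 0]
    by (auto simp: tbump_def bump_def)
  then show ?thesis unfolding tens_def[abs_def] by (intro C_k_prod) simp
qed

lemma tens_continuous: "tbump a b g \<Longrightarrow> continuous_on S (tens g)"
  using tens_C_k C_k_continuous continuous_on_subset by blast

lemma tens_measurable [measurable_dest]: "tbump a b g \<Longrightarrow> tens g \<in> borel_measurable borel"
  using tens_continuous borel_measurable_continuous_onI by blast

lemma tens_support: "tbump a b g \<Longrightarrow> closure {x. tens g x \<noteq> 0} \<subseteq> cbox a b"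
  using tens_zero by (intro closure_minimal) (auto simp del: mem_box_cart)

lemma tens_test_function:
  assumes "tbump a b g" "cbox a b \<subseteq> U" shows "test_function U (tens g)"
proof -
  have "compact (closure {x. tens g x \<noteq> 0})"
    using compact_Int_closed[OF compact_cbox closed_closure, of a b "{x. tens g x \<noteq> 0}"]
      tens_support[OF assms(1)] by (metis inf.absorb_iff2)
  then show ?thesis
    using tens_support[OF assms(1)] tens_C_k[OF assms(1)] assms(2) unfolding test_function_def by blast
qed

lemma tens_has_line_derivative:
  assumes "tbump a b g"
  shows "((\<lambda>t. tens g (x + t *\<^sub>R axis i 1)) has_real_derivative tens (dt i g) (x + t *\<^sub>R axis i 1)) (at t)"
proof -
  have g: "bump (a $ i) (b $ i) (g i)" using assms by (simp add: tbump_def)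
  have eq: "tens h (x + t *\<^sub>R axis i 1) = h i (x $ i + t) * (\<Prod>j\<in>UNIV - {i}. h j (x $ j))" for t h
    unfolding tens_split[of h _ i] by (auto simp: axis_def intro!: prod.cong)
  have d: "((\<lambda>t. g i (x $ i + t)) has_real_derivative deriv (g i) (x $ i + t)) (at t)"
    using DERIV_chain2[OF bump_has_deriv[OF g] DERIV_add[OF DERIV_const DERIV_ident], of "x $ i" t] by simp
  have "(\<Prod>j\<in>UNIV - {i}. (dt i g) j (x $ j)) = (\<Prod>j\<in>UNIV - {i}. g j (x $ j))"
    by (intro prod.cong) (auto simp: dt_def)
  then show ?thesis unfolding eq using d by (auto intro!: derivative_eq_intros simp: dt_def)
qed

text \<open>Links factorwise differentiation with the Frechet derivative in terms of which weak
  derivatives are defined.\<close>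

lemma tens_frechet_derivative:
  assumes "tbump a b g"
  shows "frechet_derivative (tens g) (at x) (axis i 1) = tens (dt i g) x"
proof -
  obtain f' where "(tens g has_derivative f') (at x)"
    using tens_C_k[OF assms, of 1] by auto
  then have *: "(tens g has_derivative frechet_derivative (tens g) (at x)) (at x)"
    using frechet_derivative_works differentiableI by blast
  have lin: "linear (frechet_derivative (tens g) (at x))" using * has_derivative_linear by blast
  have "((\<lambda>t. tens g (x + t *\<^sub>R axis i 1)) has_derivative
      (\<lambda>t. frechet_derivative (tens g) (at x) (t *\<^sub>R axis i 1))) (at 0)"
    by (rule has_derivative_compose[of "\<lambda>t. x + t *\<^sub>R axis i 1" "\<lambda>t. t *\<^sub>R axis i 1" 0 UNIV "tens g", simplified])
       (auto intro!: derivative_eq_intros *)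
  then have "((\<lambda>t. tens g (x + t *\<^sub>R axis i 1)) has_real_derivative
      frechet_derivative (tens g) (at x) (axis i 1)) (at 0)"
    unfolding has_field_derivative_def linear_cmul[OF lin] by (simp add: mult_commute_abs)
  then show ?thesis
    using tens_has_line_derivative[OF assms, of x i 0] DERIV_unique by fastforce
qed

lemma tens_bounded: assumes "tbump a b g" obtains C where "C > 0" "\<And>x. \<bar>tens g x\<bar> \<le> C"
proof -
  have "bounded (tens g ` cbox a b)"
    using tens_continuous[OF assms] by (intro compact_imp_bounded compact_continuous_image) auto
  then obtain C where "C > 0" "\<forall>x\<in>cbox a b. \<bar>tens g x\<bar> \<le> C" unfolding bounded_pos by auto
  then have "\<bar>tens g x\<bar> \<le> C" for x using tens_zero[OF assms, of x] by (cases "x \<in> cbox a b") auto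
  then show thesis using that \<open>C > 0\<close> by blast
qed

lemma tens_integrable: assumes "tbump a b g" shows "integrable lborel (tens g)"
proof -
  have "integrable lborel (\<lambda>x. indicator (cbox a b) x *\<^sub>R tens g x)"
    using tens_continuous[OF assms] by (intro borel_integrable_compact) auto
  moreover have "(\<lambda>x. indicator (cbox a b) x *\<^sub>R tens g x) = tens g"
    using tens_zero[OF assms] by (auto simp: fun_eq_iff indicator_def simp del: mem_box_cart)
  ultimately show ?thesis by simp
qed

lemma tens_integral:
  fixes g :: "'n::finite \<Rightarrow> real \<Rightarrow> real"
  assumes "tbump a b g"
  shows "integral\<^sup>L lborel (tens g) = (\<Prod>i\<in>UNIV. integral\<^sup>L lborel (g i))"
proof -
  interpret product_sigma_finite "\<lambda>b::real^'n. lborel :: real measure"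
    by (simp add: product_sigma_finite_def sigma_finite_lborel)
  \<comment> \<open>The product measure behind \<open>lborel\<close> is indexed by basis vectors,
    the factors of \<open>g\<close> by coordinates; \<open>k\<close> translates between
    them.\<close>
  define k where "k b = (SOME i. b = axis i (1::real))" for b :: "real^'n"
  have k: "k (axis i 1) = i" for i unfolding k_def by (auto simp: axis_eq_axis)
  have B: "(Basis :: (real^'n) set) = (\<lambda>i. axis i 1) ` UNIV" by (auto simp: Basis_vec_def)
  have inj: "inj (\<lambda>i::'n. axis i (1::real))" by (auto simp: inj_def axis_eq_axis)
  have nth: "(\<Sum>b\<in>Basis. f b *\<^sub>R b) $ i = f (axis i 1)" for f :: "real^'n \<Rightarrow> real" and i
  proof -
    have "(\<Sum>b\<in>Basis. f b *\<^sub>R b) $ i = (\<Sum>j\<in>UNIV. f (axis j 1) * axis j 1 $ i)"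
      unfolding B by (subst sum.reindex[OF inj]) (simp add: sum_component)
    also have "\<dots> = f (axis i 1)"
      by (subst sum.remove[of _ i]) (auto simp: axis_def intro!: sum.neutral)
    finally show ?thesis .
  qed
  have PB: "(\<Prod>b\<in>(Basis :: (real^'n) set). h b) = (\<Prod>i\<in>UNIV. h (axis i 1))" for h :: "real^'n \<Rightarrow> real"
    unfolding B by (subst prod.reindex[OF inj]) simp
  have "integral\<^sup>L lborel (tens g) =
     (\<integral>f. tens g (\<Sum>b\<in>Basis. f b *\<^sub>R b) \<partial>(\<Pi>\<^sub>M b\<in>(Basis::(real^'n) set). lborel))"
    by (subst lborel_eq, subst integral_distr) (use tens_measurable[OF assms] in auto)
  also have "\<dots> = (\<integral>f. (\<Prod>b\<in>Basis. g (k b) (f b)) \<partial>(\<Pi>\<^sub>M b\<in>(Basis::(real^'n) set). lborel))"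
    unfolding tens_def nth PB k ..
  also have "\<dots> = (\<Prod>b\<in>(Basis::(real^'n) set). integral\<^sup>L lborel (g (k b)))"
    using assms by (intro product_integral_prod) (auto simp: tbump_def intro: bump_integrable)
  also have "\<dots> = (\<Prod>i\<in>UNIV. integral\<^sup>L lborel (g i))"
    unfolding PB k ..
  finally show ?thesis .
qed

subsection \<open>Directional derivatives\<close>

text \<open>Derivatives along the axes suffice for integration by parts, and for convolutions they
  follow from a Taylor estimate in one variable. Since the base point is arbitrary, prescribing the
  derivative at t = 0 prescribes it along whole lines.\<close>

definition line_deriv :: "'n::finite \<Rightarrow> (real^'n \<Rightarrow> 'b::real_normed_vector) \<Rightarrow> (real^'n \<Rightarrow> 'b) \<Rightarrow> bool" where
  "line_deriv i F F' \<longleftrightarrow> (\<forall>x. ((\<lambda>t. F (x + t *\<^sub>R axis i 1)) has_vector_derivative F' x) (at 0))"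

lemma line_derivD:
  assumes "line_deriv i F F'"
  shows "((\<lambda>t. F (x + t *\<^sub>R axis i 1)) has_vector_derivative F' (x + t *\<^sub>R axis i 1)) (at t)"
proof -
  have "((\<lambda>s. F ((x + t *\<^sub>R axis i 1) + s *\<^sub>R axis i 1)) has_vector_derivative F' (x + t *\<^sub>R axis i 1)) (at (- t + t))"
    using assms unfolding line_deriv_def by auto
  moreover have "((\<lambda>s. - t + s) has_vector_derivative 1) (at t)"
    by (auto intro!: derivative_eq_intros)
  ultimately have "((\<lambda>s. F ((x + t *\<^sub>R axis i 1) + s *\<^sub>R axis i 1)) \<circ> (\<lambda>s. - t + s)
      has_vector_derivative 1 *\<^sub>R F' (x + t *\<^sub>R axis i 1)) (at t)"
    by (intro vector_diff_chain_at)
  moreover have "(\<lambda>s. F ((x + t *\<^sub>R axis i 1) + s *\<^sub>R axis i 1)) \<circ> (\<lambda>s. - t + s) = (\<lambda>s. F (x + s *\<^sub>R axis i 1))"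
    by (simp add: o_def scaleR_left_diff_distrib)
  ultimately show ?thesis by simp
qed

lemma line_deriv_bilinear:
  assumes "bounded_bilinear h" "line_deriv i F F'" "line_deriv i G G'"
  shows "line_deriv i (\<lambda>x. h (F x) (G x)) (\<lambda>x. h (F x) (G' x) + h (F' x) (G x))"
  unfolding line_deriv_def
proof
  fix x
  show "((\<lambda>t. h (F (x + t *\<^sub>R axis i 1)) (G (x + t *\<^sub>R axis i 1))) has_vector_derivative
           h (F x) (G' x) + h (F' x) (G x)) (at 0)"
    using bounded_bilinear.has_vector_derivative[OF assms(1), of "\<lambda>t. F (x + t *\<^sub>R axis i 1)" "F' x" 0 UNIV
        "\<lambda>t. G (x + t *\<^sub>R axis i 1)" "G' x"] assms(2,3)
    unfolding line_deriv_def by simp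
qed

lemma line_deriv_sum: "(\<And>j. j \<in> J \<Longrightarrow> line_deriv i (F j) (F' j)) \<Longrightarrow>
   line_deriv i (\<lambda>x. \<Sum>j\<in>J. F j x) (\<lambda>x. \<Sum>j\<in>J. F' j x)"
  unfolding line_deriv_def by (auto intro!: has_vector_derivative_sum)

lemma line_deriv_scaleR_const: "line_deriv i F F' \<Longrightarrow> line_deriv i (\<lambda>x. c *\<^sub>R F x) (\<lambda>x. c *\<^sub>R F' x)"
  unfolding line_deriv_def by (auto intro: bounded_linear.has_vector_derivative[OF bounded_linear_scaleR_right])

lemma line_deriv_tens: "tbump a b g \<Longrightarrow> line_deriv i (tens g) (tens (dt i g))"
  unfolding line_deriv_def has_real_derivative_iff_has_vector_derivative[symmetric]
  using tens_has_line_derivative[of a b g _ i 0] by simp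

lemma line_deriv_linear: "bounded_linear l \<Longrightarrow> line_deriv i l (\<lambda>x. l (axis i 1))"
  unfolding line_deriv_def
  by (auto simp: linear_simps intro!: derivative_eq_intros)

lemma line_deriv_bound:
  assumes "line_deriv i F F'" "\<And>x. norm (F' x) \<le> C"
  shows "norm (F (x + t *\<^sub>R axis i 1) - F x) \<le> C * \<bar>t\<bar>"
proof -
  have "norm (F (x + t *\<^sub>R axis i 1) - F (x + 0 *\<^sub>R axis i 1)) \<le> C * norm (t - 0)"
    using line_derivD[OF assms(1)] assms(2)
    by (intro differentiable_bound[of UNIV "\<lambda>t. F (x + t *\<^sub>R axis i 1)" "\<lambda>t h. h *\<^sub>R F' (x + t *\<^sub>R axis i 1)"])
       (auto simp: has_vector_derivative_def mult.commute[of C] intro!: onorm_le mult_left_mono)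
  then show ?thesis by simp
qed

lemma lborel_integral_translation:
  fixes F :: "'a::euclidean_space \<Rightarrow> 'b::{banach, second_countable_topology}"
  assumes "F \<in> borel_measurable borel"
  shows "(LBINT x. F (x + c)) = integral\<^sup>L lborel F"
proof -
  have "integral\<^sup>L lborel F = integral\<^sup>L (distr lborel borel ((+) c)) F"
    by (simp add: lborel_distr_plus)
  also have "\<dots> = (LBINT x. F (c + x))" using assms by (subst integral_distr) auto
  finally show ?thesis by (simp add: add.commute)
qed

text \<open>By translation invariance every difference quotient of \<open>F\<close> has integral 0.
  The quotients are bounded by the supremum of the derivative, so that dominated convergence
  applies.\<close>

lemma integral_line_deriv_eq_0:
  fixes F F' :: "real^'n \<Rightarrow> 'b::euclidean_space"
  assumes d: "line_deriv i F F'" and c: "continuous_on UNIV F" "continuous_on UNIV F'"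
    and z: "\<And>x. x \<notin> cbox a b \<Longrightarrow> F x = 0" "\<And>x. x \<notin> cbox a b \<Longrightarrow> F' x = 0"
  shows "integral\<^sup>L lborel F' = 0"
proof -
  have "bounded (F' ` cbox a b)"
    using c by (intro compact_imp_bounded compact_continuous_image) (auto intro: continuous_on_subset)
  then obtain C where C0: "C > 0" "\<forall>x\<in>cbox a b. norm (F' x) \<le> C" unfolding bounded_pos by auto
  then have C: "norm (F' x) \<le> C" for x using z by (cases "x \<in> cbox a b") auto
  let ?h = "\<lambda>k. 1 / real (Suc k)"
  \<comment> \<open>The steps \<open>?h k\<close> are at most 1, so that this box contains the
    supports of all difference quotients.\<close>
  let ?B = "cbox (\<chi> j. a $ j - 1) (\<chi> j. b $ j + 1)"
  define s where "s k x = real (Suc k) *\<^sub>R (F (x + ?h k *\<^sub>R axis i 1) - F x)" for k x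
  have [measurable]: "F \<in> borel_measurable borel" "F' \<in> borel_measurable borel"
    using c by (auto intro: borel_measurable_continuous_onI)
  have intF: "integrable lborel F"
  proof -
    have "integrable lborel (\<lambda>x. indicator (cbox a b) x *\<^sub>R F x)"
      using c by (intro borel_integrable_compact) (auto intro: continuous_on_subset)
    moreover have "(\<lambda>x. indicator (cbox a b) x *\<^sub>R F x) = F"
      using z by (auto simp: fun_eq_iff indicator_def)
    ultimately show ?thesis by simp
  qed
  have intFt: "integrable lborel (\<lambda>x. F (x + v))" for v
  proof -
    have "integrable (distr lborel borel ((+) v)) F" using intF by (simp add: lborel_distr_plus)
    then show ?thesis by (subst (asm) integrable_distr_eq) (auto simp: add.commute)
  qed
  have s0: "integral\<^sup>L lborel (s k) = 0" for k
    unfolding s_def using intF intFt by (simp add: lborel_integral_translation)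
  have lim: "(\<lambda>k. s k x) \<longlonglongrightarrow> F' x" for x
  proof -
    have "((\<lambda>t. (F (x + t *\<^sub>R axis i 1) - F x) /\<^sub>R t) \<longlongrightarrow> F' x) (at 0)"
    proof (rule LIM_zero_cancel, rule tendsto_norm_zero_cancel, rule Lim_transform_eventually)
      show "(\<lambda>t. norm (F (x + t *\<^sub>R axis i 1) - F x - t *\<^sub>R F' x) / norm t) \<midarrow>0\<rightarrow> 0"
        using d[unfolded line_deriv_def has_vector_derivative_def has_derivative_at, rule_format, of x] by simp
      have "norm (F (x + t *\<^sub>R axis i 1) - F x - t *\<^sub>R F' x) / norm t =
          norm ((F (x + t *\<^sub>R axis i 1) - F x) /\<^sub>R t - F' x)" if "t \<noteq> 0" for t
      proof -
        have "(F (x + t *\<^sub>R axis i 1) - F x) /\<^sub>R t - F' x =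
            (F (x + t *\<^sub>R axis i 1) - F x - t *\<^sub>R F' x) /\<^sub>R t"
          using that by (simp add: scaleR_diff_right)
        then show ?thesis by (simp add: divide_inverse_commute)
      qed
      then show "\<forall>\<^sub>F t in at 0. norm (F (x + t *\<^sub>R axis i 1) - F x - t *\<^sub>R F' x) / norm t =
          norm ((F (x + t *\<^sub>R axis i 1) - F x) /\<^sub>R t - F' x)"
        by (auto simp: eventually_at intro!: exI[of _ 1])
    qed
    moreover have "filterlim ?h (at 0) sequentially"
      unfolding filterlim_at using LIMSEQ_inverse_real_of_nat by (auto simp: inverse_eq_divide)
    ultimately have "(\<lambda>k. (F (x + ?h k *\<^sub>R axis i 1) - F x) /\<^sub>R ?h k) \<longlonglongrightarrow> F' x"
      by (rule filterlim_compose)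
    then show ?thesis unfolding s_def by simp
  qed
  have le: "norm (s k x) \<le> C * indicator ?B x" for k x
  proof (cases "x \<in> ?B")
    case True
    have "norm (s k x) \<le> real (Suc k) * (C * \<bar>?h k\<bar>)"
      unfolding s_def norm_scaleR abs_of_nat
      by (intro mult_left_mono line_deriv_bound[OF d C]) auto
    also have "real (Suc k) * (C * \<bar>?h k\<bar>) = C" by simp
    finally show ?thesis using True by simp
  next
    case False
    then obtain j where j: "x $ j < a $ j - 1 \<or> x $ j > b $ j + 1" by (auto simp: mem_box_cart not_le)
    have "0 \<le> ?h k" "?h k \<le> 1" by auto
    then have "0 \<le> ?h k * axis i 1 $ j" "?h k * axis i 1 $ j \<le> 1" by (auto simp: axis_def)
    then have "(x + ?h k *\<^sub>R axis i 1) $ j < a $ j \<or> (x + ?h k *\<^sub>R axis i 1) $ j > b $ j" "x $ j < a $ j \<or> x $ j > b $ j"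
      using j unfolding vector_add_component vector_scaleR_component real_scaleR_def by linarith+
    then have "x + ?h k *\<^sub>R axis i 1 \<notin> cbox a b" "x \<notin> cbox a b" unfolding mem_box_cart by (meson not_le)+
    then show ?thesis using z False by (simp add: s_def)
  qed
  have "(\<lambda>k. integral\<^sup>L lborel (s k)) \<longlonglongrightarrow> integral\<^sup>L lborel F'"
  proof (rule integral_dominated_convergence)
    show "integrable lborel (\<lambda>x. C * indicator ?B x)"
      by (intro integrable_mult_right integrable_real_indicator emeasure_lborel_cbox_finite) auto
    show "s k \<in> borel_measurable lborel" for k unfolding s_def[abs_def] by measurable
  qed (use lim le in auto)
  then show ?thesis using s0 LIMSEQ_unique[of "\<lambda>k. 0::'b" 0] by auto
qed

subsection \<open>Convolution with tensor products\<close>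

definition tconv :: "('n::finite \<Rightarrow> real \<Rightarrow> real) \<Rightarrow> (real^'n \<Rightarrow> 'b::euclidean_space) \<Rightarrow> real^'n \<Rightarrow> 'b" where
  "tconv g f x = (LBINT y. tens g (x - y) *\<^sub>R f y)"

lemma bounded_scaleR_integrable:
  fixes f :: "'a::euclidean_space \<Rightarrow> 'b::euclidean_space"
  assumes "integrable lborel f" "h \<in> borel_measurable borel" "\<And>x. \<bar>h x\<bar> \<le> C"
  shows "integrable lborel (\<lambda>x. h x *\<^sub>R f x)"
proof (rule Bochner_Integration.integrable_bound)
  show "integrable lborel (\<lambda>x. C * norm (f x))" using assms by auto
  show "(\<lambda>x. h x *\<^sub>R f x) \<in> borel_measurable lborel" using assms by auto
  have "C \<ge> 0" using assms(3) abs_ge_zero order_trans by blast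
  then show "AE x in lborel. norm (h x *\<^sub>R f x) \<le> norm (C * norm (f x))"
    using assms(3) by (auto simp: abs_mult intro!: mult_right_mono)
qed

lemma tconv_integrand:
  fixes f :: "real^'n::finite \<Rightarrow> 'b::euclidean_space"
  assumes "tbump a b g" "integrable lborel f"
  shows "integrable lborel (\<lambda>y. tens g (x - y) *\<^sub>R f y)"
proof -
  obtain C where C: "\<And>x. \<bar>tens g x\<bar> \<le> C" using tens_bounded[OF assms(1)] by blast
  have [measurable]: "tens g \<in> borel_measurable borel" using tens_measurable[OF assms(1)] .
  show ?thesis by (rule bounded_scaleR_integrable[OF assms(2), where C=C]) (use C in auto)
qed

lemma norm_diff_le_add: "norm (a - c) \<le> norm (a - b) + norm (b - c)"
  using norm_triangle_ineq[of "a - b" "b - c"] by simp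

lemma has_vector_derivative_quadratic:
  fixes f :: "real \<Rightarrow> 'b::real_normed_vector"
  assumes "\<And>t. norm (f t - f 0 - t *\<^sub>R d) \<le> C * t\<^sup>2"
  shows "(f has_vector_derivative d) (at 0)"
  unfolding has_vector_derivative_def has_derivative_at
proof (intro conjI)
  show "bounded_linear (\<lambda>x. x *\<^sub>R d)" by (rule bounded_linear_scaleR_left)
  show "(\<lambda>h. norm (f (0 + h) - f 0 - h *\<^sub>R d) / norm h) \<midarrow>0\<rightarrow> 0"
  proof (rule Lim_null_comparison)
    show "(\<lambda>h. C * \<bar>h\<bar>) \<midarrow>0\<rightarrow> 0" by (auto intro!: tendsto_eq_intros)
    have "norm (norm (f (0 + h) - f 0 - h *\<^sub>R d) / norm h) \<le> C * \<bar>h\<bar>" if "h \<noteq> 0" for h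
      using assms[of h] that by (simp add: divide_le_eq power2_eq_square mult.assoc)
    then show "\<forall>\<^sub>F h in at 0. norm (norm (f (0 + h) - f 0 - h *\<^sub>R d) / norm h) \<le> C * \<bar>h\<bar>"
      by (auto simp: eventually_at intro!: exI[of _ 1])
  qed
qed

lemma line_deriv_taylor:
  fixes F :: "real^'n::finite \<Rightarrow> 'b::real_normed_vector"
  assumes F: "line_deriv i F F'" "line_deriv i F' F''" and C: "\<And>x. norm (F'' x) \<le> C"
  shows "norm (F (x + t *\<^sub>R axis i 1) - F x - t *\<^sub>R F' x) \<le> C * t\<^sup>2"
proof -
  let ?f = "\<lambda>t. F (x + t *\<^sub>R axis i 1) - t *\<^sub>R F' x"
  have "norm (?f t - ?f 0) \<le> (C * \<bar>t\<bar>) * norm (t - 0)"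
  proof (rule differentiable_bound[of "closed_segment 0 t" ?f "\<lambda>t h. h *\<^sub>R (F' (x + t *\<^sub>R axis i 1) - F' x)"])
    show "convex (closed_segment 0 t)" by simp
  next
    fix u assume u: "u \<in> closed_segment 0 t"
    have "(?f has_vector_derivative (F' (x + u *\<^sub>R axis i 1) - F' x)) (at u)"
      using line_derivD[OF F(1), of x u] by (auto intro!: derivative_eq_intros)
    then show "(?f has_derivative (\<lambda>h. h *\<^sub>R (F' (x + u *\<^sub>R axis i 1) - F' x))) (at u within closed_segment 0 t)"
      unfolding has_vector_derivative_def by (rule has_derivative_at_withinI)
    have "norm (F' (x + u *\<^sub>R axis i 1) - F' x) \<le> C * \<bar>u\<bar>" by (rule line_deriv_bound[OF F(2) C])
    also have "\<dots> \<le> C * \<bar>t\<bar>"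
    proof -
      have "C \<ge> 0" using C norm_ge_zero order_trans by blast
      moreover have "\<bar>u\<bar> \<le> \<bar>t\<bar>" using u by (auto simp: closed_segment_eq_real_ivl split: if_splits)
      ultimately show ?thesis by (rule mult_left_mono[rotated])
    qed
    finally have *: "norm (F' (x + u *\<^sub>R axis i 1) - F' x) \<le> C * \<bar>t\<bar>" .
    show "onorm (\<lambda>h. h *\<^sub>R (F' (x + u *\<^sub>R axis i 1) - F' x)) \<le> C * \<bar>t\<bar>"
      using mult_left_mono[OF *] by (intro onorm_le) (simp add: mult.commute)
  qed auto
  then show ?thesis by (simp add: power2_eq_square mult.assoc algebra_simps)
qed

text \<open>The Taylor remainder of the kernel is at most C t^2 uniformly in y; integrated against
  \<open>f\<close> it stays quadratic in t, which identifies the derivative.\<close>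

lemma line_deriv_tconv:
  fixes g :: "'n::finite \<Rightarrow> real \<Rightarrow> real"
  assumes g: "tbump a b g" and f: "integrable lborel f"
  shows "line_deriv i (tconv g f) (tconv (dt i g) f)"
  unfolding line_deriv_def
proof
  fix x :: "real^'n"
  have g': "tbump a b (dt i g)" "tbump a b (dt i (dt i g))" using tbump_dt g by blast+
  obtain C where C: "\<And>x. norm (tens (dt i (dt i g)) x) \<le> C" using tens_bounded[OF g'(2)] by auto
  note T = line_deriv_taylor[OF line_deriv_tens[OF g, of i] line_deriv_tens[OF g'(1), of i] C]
  show "((\<lambda>t. tconv g f (x + t *\<^sub>R axis i 1)) has_vector_derivative tconv (dt i g) f x) (at 0)"
  proof (rule has_vector_derivative_quadratic)
    fix t :: real
    have "tconv g f (x + t *\<^sub>R axis i 1) - tconv g f (x + 0 *\<^sub>R axis i 1) - t *\<^sub>R tconv (dt i g) f x =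
       (LBINT y. (tens g ((x - y) + t *\<^sub>R axis i 1) - tens g (x - y) - t * tens (dt i g) (x - y)) *\<^sub>R f y)"
      using tconv_integrand[OF g f] tconv_integrand[OF g'(1) f]
      by (simp add: tconv_def scaleR_diff_left diff_add_eq scaleR_scaleR[symmetric] del: scaleR_scaleR)
    also have "norm \<dots> \<le> (LBINT y. norm ((tens g ((x - y) + t *\<^sub>R axis i 1) - tens g (x - y) - t * tens (dt i g) (x - y)) *\<^sub>R f y))"
      by (rule integral_norm_bound)
    also have "\<dots> \<le> (LBINT y. C * t\<^sup>2 * norm (f y))"
    proof (rule integral_mono)
      show "integrable lborel (\<lambda>y. norm ((tens g ((x - y) + t *\<^sub>R axis i 1) - tens g (x - y) - t * tens (dt i g) (x - y)) *\<^sub>R f y))"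
        using tconv_integrand[OF g f, of "x + t *\<^sub>R axis i 1"] tconv_integrand[OF g f, of x]
          integrable_scaleR_right[of t, OF tconv_integrand[OF g'(1) f, of x]]
        by (intro integrable_norm) (simp add: scaleR_diff_left diff_add_eq)
    qed (use f T in \<open>auto intro!: mult_right_mono\<close>)
    finally show "norm (tconv g f (x + t *\<^sub>R axis i 1) - tconv g f (x + 0 *\<^sub>R axis i 1) - t *\<^sub>R tconv (dt i g) f x)
       \<le> (C * (LBINT y. norm (f y))) * t\<^sup>2"
      by (simp add: mult_ac)
  qed
qed

lemma tconv_continuous:
  assumes g: "tbump a b g" and f: "integrable lborel f"
  shows "continuous_on S (tconv g f)"
proof -
  obtain C where C: "\<And>x. \<bar>tens g x\<bar> \<le> C" using tens_bounded[OF g] by blast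
  have [measurable]: "f \<in> borel_measurable borel" "tens g \<in> borel_measurable borel"
    using f tens_measurable[OF g] by auto
  have "(\<lambda>n. tconv g f (xs n)) \<longlonglongrightarrow> tconv g f x" if "xs \<longlonglongrightarrow> x" for xs x
    unfolding tconv_def
  proof (rule integral_dominated_convergence)
    show "integrable lborel (\<lambda>y. C * norm (f y))" using f by auto
    have "isCont (tens g) z" for z
      using tens_continuous[OF g, of UNIV] by (simp add: continuous_on_eq_continuous_at)
    then show "AE y in lborel. (\<lambda>n. tens g (xs n - y) *\<^sub>R f y) \<longlonglongrightarrow> tens g (x - y) *\<^sub>R f y"
      using that by (auto intro!: tendsto_intros isCont_tendsto_compose[where g="tens g"])
  qed (use C in \<open>auto intro!: mult_right_mono\<close>)
  then show ?thesis
    by (auto simp: continuous_on_eq_continuous_within continuous_within_sequentially o_def)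
qed

text \<open>Tonelli and translation invariance: a kernel depending on x - y only contributes its
  total mass. This serves the mollifiers and, at the end, the comparison with fibers.\<close>

lemma nn_integral_convolution:
  fixes G h :: "'a::euclidean_space \<Rightarrow> ennreal"
  assumes [measurable]: "G \<in> borel_measurable borel" "h \<in> borel_measurable borel"
  shows "(\<integral>\<^sup>+x. \<integral>\<^sup>+y. G (x - y) * h y \<partial>lborel \<partial>lborel) = (\<integral>\<^sup>+x. G x \<partial>lborel) * (\<integral>\<^sup>+x. h x \<partial>lborel)"
proof -
  have "(\<integral>\<^sup>+x. \<integral>\<^sup>+y. G (x - y) * h y \<partial>lborel \<partial>lborel) = (\<integral>\<^sup>+y. \<integral>\<^sup>+x. G (x - y) * h y \<partial>lborel \<partial>lborel)"
    by (rule lborel_pair.Fubini'[symmetric]) measurable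
  also have "\<dots> = (\<integral>\<^sup>+y. (\<integral>\<^sup>+x. G x \<partial>lborel) * h y \<partial>lborel)"
  proof (rule nn_integral_cong)
    fix y
    have "(\<integral>\<^sup>+x. G (x - y) * h y \<partial>lborel) = (\<integral>\<^sup>+x. G (x - y) \<partial>lborel) * h y"
      by (rule nn_integral_multc) measurable
    also have "(\<integral>\<^sup>+x. G (x - y) \<partial>lborel) = (\<integral>\<^sup>+x. G (x - y) \<partial>distr lborel borel ((+) y))"
      by (simp add: lborel_distr_plus)
    also have "\<dots> = (\<integral>\<^sup>+x. G x \<partial>lborel)" by (subst nn_integral_distr) auto
    finally show "(\<integral>\<^sup>+x. G (x - y) * h y \<partial>lborel) = (\<integral>\<^sup>+x. G x \<partial>lborel) * h y" .
  qed
  also have "\<dots> = (\<integral>\<^sup>+x. G x \<partial>lborel) * (\<integral>\<^sup>+x. h x \<partial>lborel)"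
    by (rule nn_integral_cmult) measurable
  finally show ?thesis .
qed

lemma tconv_nn_bound:
  fixes f :: "real^'n::finite \<Rightarrow> 'b::euclidean_space"
  assumes g: "tbump a b g" and f: "integrable lborel f"
  shows "(\<integral>\<^sup>+x. norm (tconv g f x) \<partial>lborel) \<le> (\<integral>\<^sup>+x. \<bar>tens g x\<bar> \<partial>lborel) * (\<integral>\<^sup>+x. norm (f x) \<partial>lborel)"
proof -
  have [measurable]: "f \<in> borel_measurable borel" "tens g \<in> borel_measurable borel"
    using f tens_measurable[OF g] by auto
  have "(\<integral>\<^sup>+x. norm (tconv g f x) \<partial>lborel) \<le> (\<integral>\<^sup>+x. \<integral>\<^sup>+y. ennreal (\<bar>tens g (x - y)\<bar> * norm (f y)) \<partial>lborel \<partial>lborel)"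
  proof (rule nn_integral_mono)
    fix x
    show "ennreal (norm (tconv g f x)) \<le> (\<integral>\<^sup>+y. ennreal (\<bar>tens g (x - y)\<bar> * norm (f y)) \<partial>lborel)"
      unfolding tconv_def using integral_norm_bound_ennreal[OF tconv_integrand[OF g f, of x]] by simp
  qed
  also have "\<dots> = (\<integral>\<^sup>+x. \<bar>tens g x\<bar> \<partial>lborel) * (\<integral>\<^sup>+x. norm (f x) \<partial>lborel)"
    using nn_integral_convolution[of "\<lambda>x. ennreal \<bar>tens g x\<bar>" "\<lambda>x. ennreal (norm (f x))"]
    by (simp add: ennreal_mult)
  finally show ?thesis .
qed

lemma tconv_integrable:
  assumes g: "tbump a b g" and f: "integrable lborel f"
  shows "integrable lborel (tconv g f)"
proof (rule integrableI_bounded)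
  show "tconv g f \<in> borel_measurable lborel"
    using tconv_continuous[OF g f, of UNIV] borel_measurable_continuous_onI by auto
  have "(\<integral>\<^sup>+x. \<bar>tens g x\<bar> \<partial>lborel) < \<infinity>" "(\<integral>\<^sup>+x. norm (f x) \<partial>lborel) < \<infinity>"
    using tens_integrable[OF g] f unfolding integrable_iff_bounded by auto
  then show "(\<integral>\<^sup>+x. norm (tconv g f x) \<partial>lborel) < \<infinity>"
    using tconv_nn_bound[OF g f] by (metis ennreal_mult_less_top infinity_ennreal_def order_le_less_trans)
qed

lemma tconv_L1_bound:
  assumes g: "tbump a b g" and f: "integrable lborel f"
  shows "(LBINT x. norm (tconv g f x)) \<le> (LBINT x. \<bar>tens g x\<bar>) * (LBINT x. norm (f x))"
  using tconv_nn_bound[OF g f] tens_integrable[OF g] f tconv_integrable[OF g f]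
  by (simp add: nn_integral_eq_integral ennreal_mult[symmetric] integral_nonneg)

lemma tconv_diff:
  assumes "tbump a b g" "integrable lborel f" "integrable lborel h"
  shows "tconv g (\<lambda>x. f x - h x) x = tconv g f x - tconv g h x"
  unfolding tconv_def using assms by (simp add: scaleR_diff_right tconv_integrand)

subsection \<open>Convergence of mollifications\<close>

text \<open>For an indicator, a Urysohn function between an inner closed and an outer open set
  differs from it only on a set of small measure; sums and dominated limits follow by the induction
  over integrable functions.\<close>

lemma integrable_approx_continuous:
  fixes f :: "'a::euclidean_space \<Rightarrow> 'b::euclidean_space"
  assumes "integrable lborel f"
  shows "\<forall>e>0. \<exists>g. continuous_on UNIV g \<and> integrable lborel g \<and> (LBINT x. norm (f x - g x)) < e"
  using assms
proof (induction rule: integrable_induct)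
  case (base A c)
  show ?case
  proof (intro allI impI)
    fix e :: real assume "e > 0"
    \<comment> \<open>The two regularity errors add up to 2 d, weighted by the norm of c; the
      summand 1 covers c = 0.\<close>
    define d where "d = e / (2 * (norm c + 1))"
    have nc: "norm c + 1 > 0" by (smt (verit) norm_ge_zero)
    have "d > 0" using \<open>e > 0\<close> nc by (simp add: d_def)
    have A: "A \<in> sets borel" and A': "A \<in> sets lebesgue" using base by auto
    obtain U where U: "open U" "A \<subseteq> U" "emeasure lborel (U - A) < d"
      using outer_regular_lborel[OF A \<open>d > 0\<close>] by metis
    obtain T where T: "closed T" "T \<subseteq> A" "emeasure lebesgue (A - T) < d"
      using sets_lebesgue_inner_closed[OF A' \<open>d > 0\<close>] by metis
    have [measurable]: "A \<in> sets borel" "U \<in> sets borel" "T \<in> sets borel"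
      using base U T by auto
    have "emeasure lborel (U - T) \<le> emeasure lborel (U - A) + emeasure lborel (A - T)"
      using U T by (intro order_trans[OF emeasure_mono emeasure_subadditive]) auto
    also have "\<dots> < ennreal d + ennreal d"
      using U(3) T(3) by (intro add_strict_mono) auto
    also have "\<dots> = ennreal (2 * d)" using \<open>d > 0\<close> by (simp flip: ennreal_plus)
    finally have UT: "emeasure lborel (U - T) < ennreal (2 * d)" .
    obtain h where h: "continuous_on UNIV h" "\<And>x. h x \<in> closed_segment 1 (0::real)"
        "\<And>x. x \<in> T \<Longrightarrow> h x = 1" "\<And>x. x \<in> - U \<Longrightarrow> h x = 0"
      using Urysohn_local[of UNIV T "- U" 1 "0::real"] T U by (auto simp: closed_Compl)
    have h01: "0 \<le> h x" "h x \<le> 1" for x using h(2)[of x] by (auto simp: closed_segment_eq_real_ivl)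
    have hm: "h \<in> borel_measurable borel" using h(1) borel_measurable_continuous_onI by auto
    have le: "norm (indicator A x *\<^sub>R c - h x *\<^sub>R c) \<le> norm c * indicator (U - T) x" for x
    proof -
      have "\<bar>indicator A x - h x\<bar> \<le> indicator (U - T) x"
        using h01[of x] h(3,4)[of x] U T by (auto simp: indicator_def)
      then show ?thesis unfolding scaleR_diff_left[symmetric] norm_scaleR real_norm_def
        by (subst mult.commute) (rule mult_left_mono, auto)
    qed
    have iUT: "integrable lborel (\<lambda>x. norm c * indicator (U - T) x)"
      using UT by (intro integrable_mult_right integrable_real_indicator) (auto simp: order_less_le_trans)
    have d: "integrable lborel (\<lambda>x. indicator A x *\<^sub>R c - h x *\<^sub>R c)"
      by (rule Bochner_Integration.integrable_bound[OF iUT]) (use hm le in \<open>auto intro: order_trans\<close>)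
    moreover have iA: "integrable lborel (\<lambda>x. indicator A x *\<^sub>R c)" using base by auto
    ultimately have "integrable lborel (\<lambda>x. indicator A x *\<^sub>R c - (indicator A x *\<^sub>R c - h x *\<^sub>R c))"
      by (rule Bochner_Integration.integrable_diff[rotated])
    then have ih: "integrable lborel (\<lambda>x. h x *\<^sub>R c)"
      by (simp only: diff_diff_eq2 add_diff_cancel_left')
    have "(LBINT x. norm (indicator A x *\<^sub>R c - h x *\<^sub>R c)) \<le> (LBINT x. norm c * indicator (U - T) x)"
      using d iUT le by (intro integral_mono) auto
    also have "\<dots> = norm c * measure lborel (U - T)" by simp
    also have "\<dots> \<le> norm c * (2 * d)"
      using UT \<open>d > 0\<close> by (intro mult_left_mono) (auto simp: measure_def enn2real_leI less_imp_le)
    also have "\<dots> < (norm c + 1) * (2 * d)" using \<open>d > 0\<close> by (intro mult_strict_right_mono) auto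
    also have "\<dots> = e" using nc by (simp add: d_def field_simps)
    finally show "\<exists>g. continuous_on UNIV g \<and> integrable lborel g \<and> (LBINT x. norm (indicator A x *\<^sub>R c - g x)) < e"
      using ih h(1) by (intro exI[of _ "\<lambda>x. h x *\<^sub>R c"]) (auto intro!: continuous_intros)
  qed
next
  case (add f1 f2)
  show ?case
  proof (intro allI impI)
    fix e :: real assume "e > 0"
    then obtain g1 g2 where g: "continuous_on UNIV g1" "integrable lborel g1" "(LBINT x. norm (f1 x - g1 x)) < e / 2"
      "continuous_on UNIV g2" "integrable lborel g2" "(LBINT x. norm (f2 x - g2 x)) < e / 2"
      using add.IH by (meson half_gt_zero)
    have "(LBINT x. norm ((f1 x + f2 x) - (g1 x + g2 x))) \<le> (LBINT x. norm (f1 x - g1 x) + norm (f2 x - g2 x))"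
      using g add.hyps by (intro integral_mono) (auto simp: norm_diff_triangle_ineq)
    also have "\<dots> = (LBINT x. norm (f1 x - g1 x)) + (LBINT x. norm (f2 x - g2 x))"
      using g add.hyps by (intro Bochner_Integration.integral_add) auto
    finally have "(LBINT x. norm ((f1 x + f2 x) - (g1 x + g2 x))) < e" using g by linarith
    then show "\<exists>g. continuous_on UNIV g \<and> integrable lborel g \<and> (LBINT x. norm (f1 x + f2 x - g x)) < e"
      using g by (intro exI[of _ "\<lambda>x. g1 x + g2 x"]) (auto intro!: continuous_intros)
  qed
next
  case (lim f s)
  show ?case
  proof (intro allI impI)
    fix e :: real assume "e > 0"
    have fm: "integrable lborel f" "\<And>i. integrable lborel (s i)" using lim by auto
    have "(\<lambda>i. LBINT x. norm (f x - s i x)) \<longlonglongrightarrow> (\<integral>x. 0 \<partial>(lborel :: 'a measure))"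
    proof (rule integral_dominated_convergence)
      show "integrable lborel (\<lambda>x. 3 * norm (f x))" using lim by auto
      show "AE x in lborel. (\<lambda>i. norm (f x - s i x)) \<longlonglongrightarrow> 0"
      proof (rule AE_I2)
        fix x
        have "(\<lambda>i. norm (f x - s i x)) \<longlonglongrightarrow> norm (f x - f x)"
          by (intro tendsto_intros lim.hyps(2)) simp
        then show "(\<lambda>i. norm (f x - s i x)) \<longlonglongrightarrow> 0" by simp
      qed
      show "AE x in lborel. norm (norm (f x - s i x)) \<le> 3 * norm (f x)" for i
      proof (rule AE_I2)
        fix x
        have "norm (s i x) \<le> 2 * norm (f x)" using lim.hyps(3)[of x i] by simp
        then show "norm (norm (f x - s i x)) \<le> 3 * norm (f x)"
          using norm_triangle_ineq4[of "f x" "s i x"] by simp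
      qed
    qed (use fm in auto)
    then obtain i where i: "(LBINT x. norm (f x - s i x)) < e / 2"
      using order_tendstoD(2)[of _ 0 sequentially "e/2"] \<open>e > 0\<close> by (auto simp: eventually_sequentially)
    obtain g where g: "continuous_on UNIV g" "integrable lborel g" "(LBINT x. norm (s i x - g x)) < e / 2"
      using lim.IH \<open>e > 0\<close> by (meson half_gt_zero)
    have "(LBINT x. norm (f x - g x)) \<le> (LBINT x. norm (f x - s i x) + norm (s i x - g x))"
      using g fm by (intro integral_mono) (auto simp: norm_diff_le_add)
    also have "\<dots> = (LBINT x. norm (f x - s i x)) + (LBINT x. norm (s i x - g x))"
      using g fm by (intro Bochner_Integration.integral_add) auto
    finally show "\<exists>g. continuous_on UNIV g \<and> integrable lborel g \<and> (LBINT x. norm (f x - g x)) < e"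
      using g i by (intro exI[of _ g]) auto
  qed
qed


lemma integrable_approx_compact_support:
  fixes f :: "'a::euclidean_space \<Rightarrow> 'b::euclidean_space"
  assumes f: "integrable lborel f" and "e > 0"
  obtains g R where "continuous_on UNIV g" "integrable lborel g" "R > 0" "\<And>x. norm x > R \<Longrightarrow> g x = 0"
    "(LBINT x. norm (f x - g x)) < e"
proof -
  obtain g where g: "continuous_on UNIV g" "integrable lborel g" "(LBINT x. norm (f x - g x)) < e / 2"
    using integrable_approx_continuous[OF f] \<open>e > 0\<close> by (meson half_gt_zero)
  define c where "c n x = max 0 (min 1 (real n + 1 - norm x))" for n and x :: 'a
  have c: "0 \<le> c n x" "c n x \<le> 1" "real n + 1 < norm x \<Longrightarrow> c n x = 0" "norm x \<le> real n \<Longrightarrow> c n x = 1" for n x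
    by (auto simp: c_def)
  have cc: "continuous_on UNIV (c n)" for n unfolding c_def[abs_def] by (intro continuous_intros)
  have [measurable]: "g \<in> borel_measurable borel" "c n \<in> borel_measurable borel" for n
    using g(2) cc borel_measurable_continuous_onI by auto
  have ci: "integrable lborel (\<lambda>x. c n x *\<^sub>R g x)" for n
    by (rule bounded_scaleR_integrable[OF g(2), where C=1]) (use c in auto)
  have "(\<lambda>n. LBINT x. norm (g x - c n x *\<^sub>R g x)) \<longlonglongrightarrow> (\<integral>x. 0 \<partial>(lborel :: 'a measure))"
  proof (rule integral_dominated_convergence)
    show "integrable lborel (\<lambda>x. norm (g x))" using g by auto
    have "(\<lambda>n. norm (g x - c n x *\<^sub>R g x)) \<longlonglongrightarrow> 0" for x
    proof (rule tendsto_eventually)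
      have "norm (g x - c n x *\<^sub>R g x) = 0" if "n \<ge> nat \<lceil>norm x\<rceil>" for n
        using c(4)[of x n] that by (simp add: nat_ceiling_le_eq)
      then show "\<forall>\<^sub>F n in sequentially. norm (g x - c n x *\<^sub>R g x) = 0"
        unfolding eventually_sequentially by blast
    qed
    then show "AE x in lborel. (\<lambda>n. norm (g x - c n x *\<^sub>R g x)) \<longlonglongrightarrow> 0" by simp
    have "norm (g x - c n x *\<^sub>R g x) \<le> norm (g x)" for n x
    proof -
      have "g x - c n x *\<^sub>R g x = (1 - c n x) *\<^sub>R g x" by (simp add: scaleR_diff_left)
      then show ?thesis using c(1,2)[of n x] by (simp add: mult_left_le_one_le)
    qed
    then show "AE x in lborel. norm (norm (g x - c n x *\<^sub>R g x)) \<le> norm (g x)" for n by simp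
  qed auto
  then have "\<forall>\<^sub>F n in sequentially. (LBINT x. norm (g x - c n x *\<^sub>R g x)) < e / 2"
    using order_tendstoD(2)[of _ 0 sequentially "e/2"] \<open>e > 0\<close> by auto
  then obtain n where n: "(LBINT x. norm (g x - c n x *\<^sub>R g x)) < e / 2"
    by (auto simp: eventually_sequentially)
  have "(LBINT x. norm (f x - c n x *\<^sub>R g x)) \<le> (LBINT x. norm (f x - g x) + norm (g x - c n x *\<^sub>R g x))"
    using g f ci by (intro integral_mono) (auto simp: norm_diff_le_add)
  also have "\<dots> = (LBINT x. norm (f x - g x)) + (LBINT x. norm (g x - c n x *\<^sub>R g x))"
    using g f ci by (intro Bochner_Integration.integral_add) auto
  finally have "(LBINT x. norm (f x - c n x *\<^sub>R g x)) < e" using g n by linarith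
  then show thesis
    using that[of "\<lambda>x. c n x *\<^sub>R g x" "real n + 1"] ci g(1) cc c(3) by (auto intro!: continuous_intros)
qed

section \<open>Tensor product mollifiers\<close>

abbreviation mol :: "real \<Rightarrow> (real^'n::finite \<Rightarrow> 'b::euclidean_space) \<Rightarrow> real^'n \<Rightarrow> 'b" where
  "mol s \<equiv> tconv (\<lambda>_. moll s)"

lemma tbump_moll: "0 < s \<Longrightarrow> tbump (vec (- s)) (vec s) (\<lambda>_. moll s)"
  by (simp add: tbump_def moll_bump)

lemma tens_moll_nonneg: "0 < s \<Longrightarrow> tens (\<lambda>_. moll s) x \<ge> 0"
  unfolding tens_def by (intro prod_nonneg) (simp add: moll_nonneg)

lemma tens_moll_integral: "0 < s \<Longrightarrow> integral\<^sup>L lborel (tens (\<lambda>_::'n::finite. moll s)) = 1"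
  using tens_integral[OF tbump_moll, of s] by (simp add: moll_integral)

lemma tens_moll_support:
  fixes z :: "real^'n::finite"
  assumes "0 < s" "tens (\<lambda>_. moll s) z \<noteq> 0"
  shows "\<bar>z $ i\<bar> \<le> s" "norm z \<le> real CARD('n) * s"
proof -
  have *: "\<bar>z $ i\<bar> \<le> s" for i
  proof -
    have "z \<in> cbox (vec (- s)) (vec s)" using tens_zero[OF tbump_moll[OF assms(1)], of z] assms(2) by blast
    then have "- s \<le> z $ i \<and> z $ i \<le> s" unfolding mem_box_cart by simp
    then show ?thesis by linarith
  qed
  show "\<bar>z $ i\<bar> \<le> s" by (rule *)
  have "norm z \<le> (\<Sum>i\<in>UNIV. \<bar>z $ i\<bar>)" by (rule norm_le_l1_cart)
  also have "\<dots> \<le> (\<Sum>i\<in>(UNIV::'n set). s)" by (intro sum_mono *)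
  finally show "norm z \<le> real CARD('n) * s" by simp
qed

lemma mol_const_integral:
  fixes x :: "real^'n::finite"
  assumes "0 < s" shows "(LBINT y. tens (\<lambda>_. moll s) (x - y)) = 1"
    and "integrable lborel (\<lambda>y. tens (\<lambda>_. moll s) (x - y))"
proof -
  have [measurable]: "tens (\<lambda>_::'n. moll s) \<in> borel_measurable borel"
    using tens_measurable[OF tbump_moll[OF assms]] .
  have refl: "tens (\<lambda>_. moll s) (x - y) = tens (\<lambda>i t. moll s (x $ i - t)) y" for y
    by (simp add: tens_def)
  have b: "tbump (x - vec s) (x + vec s) (\<lambda>i t. moll s (x $ i - t))"
    using bump_reflect[OF moll_bump[OF assms]] by (simp add: tbump_def)
  have "(LBINT t. moll s (c - t)) = 1" for c
    using lborel_integral_real_affine[of "-1" "moll s" c] moll_integral[OF assms] by simp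
  then show "(LBINT y. tens (\<lambda>_. moll s) (x - y)) = 1" unfolding refl
    using tens_integral[OF b] by simp
  show "integrable lborel (\<lambda>y. tens (\<lambda>_. moll s) (x - y))"
    unfolding refl by (rule tens_integrable[OF b])
qed

lemma mol_L1_le:
  fixes f :: "real^'n::finite \<Rightarrow> 'b::euclidean_space"
  assumes "0 < s" "integrable lborel f"
  shows "(LBINT x. norm (mol s f x)) \<le> (LBINT x. norm (f x))"
proof -
  have "\<bar>tens (\<lambda>_. moll s) x\<bar> = tens (\<lambda>_. moll s) x" for x :: "real^'n"
    by (rule abs_of_nonneg[OF tens_moll_nonneg[OF assms(1)]])
  then show ?thesis
    using tconv_L1_bound[OF tbump_moll[OF assms(1)] assms(2)] by (simp add: tens_moll_integral[OF assms(1)])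
qed

text \<open>The mollification is an average, with total weight 1, over the cube of half-side s about
  x. With v = g x this gives local uniform approximation, with v = 0 a bound by the supremum over
  the cube.\<close>

lemma mol_approx:
  fixes f :: "real^'n::finite \<Rightarrow> 'b::euclidean_space"
  assumes s: "0 < s" and f: "integrable lborel f"
    and bd: "AE y in lborel. (\<forall>i. \<bar>x $ i - y $ i\<bar> \<le> s) \<longrightarrow> norm (f y - v) \<le> C"
  shows "norm (mol s f x - v) \<le> C"
proof -
  note i = mol_const_integral[OF s, of x] tconv_integrand[OF tbump_moll[OF s] f, of x]
  have i2: "integrable lborel (\<lambda>y. tens (\<lambda>_. moll s) (x - y) *\<^sub>R (f y - v))"
    unfolding scaleR_diff_right using i by auto
  have "mol s f x - v = (LBINT y. tens (\<lambda>_. moll s) (x - y) *\<^sub>R (f y - v))"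
    unfolding tconv_def scaleR_diff_right using i by simp
  also have "norm \<dots> \<le> (LBINT y. norm (tens (\<lambda>_. moll s) (x - y) *\<^sub>R (f y - v)))"
    by (rule integral_norm_bound)
  also have "\<dots> \<le> (LBINT y. tens (\<lambda>_. moll s) (x - y) * C)"
  proof (rule integral_mono_AE)
    show "AE y in lborel. norm (tens (\<lambda>_. moll s) (x - y) *\<^sub>R (f y - v)) \<le> tens (\<lambda>_. moll s) (x - y) * C"
      using bd
    proof eventually_elim
      case (elim y)
      show ?case
      proof (cases "tens (\<lambda>_. moll s) (x - y) = 0")
        case False
        then have "norm (f y - v) \<le> C" using elim tens_moll_support(1)[OF s False] by auto
        then show ?thesis using tens_moll_nonneg[OF s, of "x - y"] by (simp add: mult_left_mono)
      qed simp
    qed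
  qed (use i integrable_norm[OF i2] in auto)
  also have "\<dots> = C" using i by simp
  finally show ?thesis .
qed

text \<open>Mollification does not increase the L^1 norm, so that it is enough to treat a continuous
  compactly supported \<open>g\<close> close to \<open>f\<close>, for which the convergence is
  uniform.\<close>

lemma mol_L1_tendsto:
  fixes f :: "real^'n::finite \<Rightarrow> 'b::euclidean_space"
  assumes f: "integrable lborel f"
  shows "((\<lambda>s. LBINT x. norm (mol s f x - f x)) \<longlongrightarrow> 0) (at_right 0)"
proof (rule tendstoI)
  fix e :: real assume "e > 0"
  obtain g R where g: "continuous_on UNIV g" "integrable lborel g" "R > 0" "\<And>x. norm x > R \<Longrightarrow> g x = 0"
    and fg: "(LBINT x. norm (f x - g x)) < e / 3"
    using integrable_approx_compact_support[OF f, of "e/3"] \<open>e > 0\<close> by auto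
  define N where "N = real CARD('n)"
  have N: "N \<ge> 1" by (simp add: N_def Suc_leI)
  \<comment> \<open>For small s the points compared are less than 1/2 apart. Hence \<open>g\<close>
    and its mollification vanish outside this ball, and points near it stay in the ball of radius R
    + 2, where uniform continuity is available.\<close>
  let ?B = "cball (0::real^'n) (R + 1)"
  define m where "m = measure lborel ?B"
  have m: "m \<ge> 0" by (simp add: m_def)
  define d where "d = e / (3 * (m + 1))"
  have "d > 0" using m \<open>e > 0\<close> by (simp add: d_def)
  have "uniformly_continuous_on (cball (0::real^'n) (R + 2)) g"
    using g(1) by (intro compact_uniformly_continuous) (auto intro: continuous_on_subset)
  then obtain r where r: "r > 0" "\<And>x y. x \<in> cball 0 (R + 2) \<Longrightarrow> y \<in> cball 0 (R + 2) \<Longrightarrow> dist x y < r \<Longrightarrow> dist (g x) (g y) < d"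
    unfolding uniformly_continuous_on_def using \<open>d > 0\<close> by metis
  define s0 where "s0 = min 1 r / (2 * N)"
  have "s0 > 0" using r N by (simp add: s0_def)
  have "(LBINT x. norm (mol s f x - f x)) < e" if s: "0 < s" "s < s0" for s
  proof -
    have Ns: "N * s < min 1 r / 2" using s N by (simp add: s0_def field_simps)
    have near: "norm (x - y) \<le> N * s" if "\<forall>i. \<bar>x $ i - y $ i\<bar> \<le> s" for x y :: "real^'n"
    proof -
      have "norm (x - y) \<le> (\<Sum>i\<in>UNIV. \<bar>(x - y) $ i\<bar>)" by (rule norm_le_l1_cart)
      also have "\<dots> \<le> (\<Sum>i\<in>(UNIV::'n set). s)" using that by (intro sum_mono) auto
      finally show ?thesis by (simp add: N_def)
    qed
    have le: "norm (mol s g x - g x) \<le> d * indicator ?B x" for x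
    proof (cases "x \<in> ?B")
      case True
      have "norm (g y - g x) \<le> d" if "\<forall>i. \<bar>x $ i - y $ i\<bar> \<le> s" for y
      proof -
        have n: "norm (x - y) < min 1 r / 2" using near[OF that] Ns by simp
        moreover have "norm y \<le> norm x + norm (x - y)"
          using norm_triangle_ineq4[of x "x - y"] by simp
        ultimately have "dist (g y) (g x) < d"
          using True r by (intro r(2)) (auto simp: dist_norm norm_minus_commute)
        then show ?thesis by (simp add: dist_norm)
      qed
      then show ?thesis using True by (simp add: mol_approx[OF s(1) g(2)])
    next
      case False
      have z: "g y = 0" if "\<forall>i. \<bar>x $ i - y $ i\<bar> \<le> s" for y
      proof (rule g(4))
        have "norm x \<le> norm y + norm (x - y)" using norm_triangle_ineq[of y "x - y"] by simp
        then show "norm y > R" using near[OF that] Ns False by simp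
      qed
      have "g x = 0" using z[of x] s by simp
      then show ?thesis using mol_approx[OF s(1) g(2), of x 0 0] z False by simp
    qed
    have ib: "integrable lborel (\<lambda>x. d * indicator ?B x :: real)"
      by (intro integrable_mult_right integrable_real_indicator emeasure_lborel_cball_finite) auto
    have ints: "integrable lborel (mol s f)" "integrable lborel (mol s g)"
      "integrable lborel (mol s (\<lambda>x. f x - g x))"
      using tconv_integrable[OF tbump_moll[OF s(1)]] f g by auto
    have "(LBINT x. norm (mol s g x - g x)) \<le> (LBINT x. d * indicator ?B x)"
      using ints g ib le by (intro integral_mono) auto
    also have "\<dots> = d * m" by (simp add: m_def)
    also have "\<dots> < e / 3" using m \<open>e > 0\<close> by (simp add: d_def field_simps)
    finally have 1: "(LBINT x. norm (mol s g x - g x)) < e / 3" .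
    have 2: "(LBINT x. norm (mol s (\<lambda>x. f x - g x) x)) < e / 3"
      using mol_L1_le[OF s(1), of "\<lambda>x. f x - g x"] f g(2) fg by auto
    have "(LBINT x. norm (mol s f x - f x)) \<le>
      (LBINT x. norm (mol s (\<lambda>x. f x - g x) x) + norm (mol s g x - g x) + norm (f x - g x))"
    proof (rule integral_mono)
      fix x
      have "mol s f x - f x = mol s (\<lambda>x. f x - g x) x + (mol s g x - g x) - (f x - g x)"
        using tconv_diff[OF tbump_moll[OF s(1)] f g(2), of x] by simp
      then show "norm (mol s f x - f x) \<le> norm (mol s (\<lambda>x. f x - g x) x) + norm (mol s g x - g x) + norm (f x - g x)"
        using norm_triangle_ineq4[of "mol s (\<lambda>x. f x - g x) x + (mol s g x - g x)" "f x - g x"]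
          norm_triangle_ineq[of "mol s (\<lambda>x. f x - g x) x" "mol s g x - g x"] by simp
    qed (use ints f g in auto)
    also have "\<dots> = (LBINT x. norm (mol s (\<lambda>x. f x - g x) x)) + (LBINT x. norm (mol s g x - g x)) + (LBINT x. norm (f x - g x))"
      using ints f g by simp
    finally show ?thesis using 1 2 fg by linarith
  qed
  then show "\<forall>\<^sub>F s in at_right 0. dist (LBINT x. norm (mol s f x - f x)) 0 < e"
    using \<open>s0 > 0\<close> unfolding eventually_at_right_field by (auto simp: abs_of_nonneg)
qed

subsection \<open>Weak partial derivatives tested with tensor products\<close>

text \<open>A weak derivative tested with tensor products only, which is all that is used.
  Integrability on the whole space makes convolutions defined everywhere; values outside
  \<open>U\<close> are not seen by the tests.\<close>

definition wpart :: "(real^'n::finite) set \<Rightarrow> 'n \<Rightarrow> (real^'n \<Rightarrow> 'b::euclidean_space) \<Rightarrow> (real^'n \<Rightarrow> 'b) \<Rightarrow> bool" where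
  "wpart U i u v \<longleftrightarrow> integrable lborel u \<and> integrable lborel v \<and>
     (\<forall>a b g. cbox a b \<subseteq> U \<longrightarrow> tbump a b g \<longrightarrow>
        (LBINT y. tens (dt i g) y *\<^sub>R u y) = - (LBINT y. tens g y *\<^sub>R v y))"

lemma wpart_subset: "wpart U i u v \<Longrightarrow> V \<subseteq> U \<Longrightarrow> wpart V i u v"
  unfolding wpart_def by blast

lemma tens_integrand:
  fixes f :: "real^'n::finite \<Rightarrow> 'b::euclidean_space"
  assumes "tbump a b g" "integrable lborel f"
  shows "integrable lborel (\<lambda>y. tens g y *\<^sub>R f y)"
proof -
  obtain C where "\<And>x. \<bar>tens g x\<bar> \<le> C" using tens_bounded[OF assms(1)] by blast
  then show ?thesis using tens_measurable[OF assms(1)] bounded_scaleR_integrable[OF assms(2)] by blast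
qed

definition reflected :: "real^'n \<Rightarrow> ('n::finite \<Rightarrow> real \<Rightarrow> real) \<Rightarrow> ('n \<Rightarrow> real \<Rightarrow> real)" where
  "reflected x g = (\<lambda>j t. g j (x $ j - t))"

lemma tbump_reflected: "tbump a b g \<Longrightarrow> tbump (x - b) (x - a) (reflected x g)"
  unfolding tbump_def reflected_def by (auto intro: bump_reflect)

lemma tens_reflected: "tens (reflected x g) y = tens g (x - y)"
  by (simp add: tens_def reflected_def)

lemma tens_dt_reflected:
  assumes "tbump a b g" shows "tens (dt i (reflected x g)) y = - tens (dt i g) (x - y)"
proof -
  have "bump (a $ i) (b $ i) (g i)" using assms by (simp add: tbump_def)
  then have "deriv (\<lambda>t. g i (x $ i - t)) (y $ i) = - deriv (g i) (x $ i - y $ i)"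
    by (rule deriv_reflect)
  then show ?thesis unfolding tens_split[of _ _ i] by (simp add: dt_def reflected_def)
qed

text \<open>As a function of y the kernel \<open>tens g (x - y)\<close> is again a tensor product,
  hence admissible once its box lies in \<open>U\<close>. The sign from the reflection cancels the
  one from the weak derivative.\<close>

lemma wpart_tconv:
  assumes "wpart U i u v" and g: "tbump a b g" and "cbox (x - b) (x - a) \<subseteq> U"
  shows "tconv (dt i g) u x = tconv g v x"
proof -
  have "(LBINT y. tens (dt i (reflected x g)) y *\<^sub>R u y) = - (LBINT y. tens (reflected x g) y *\<^sub>R v y)"
    using assms tbump_reflected[OF g, of x] unfolding wpart_def by blast
  then show ?thesis unfolding tens_dt_reflected[OF g] tens_reflected tconv_def by simp
qed

lemma integrable_compact_support:
  fixes F :: "'a::euclidean_space \<Rightarrow> 'b::euclidean_space"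
  assumes "continuous_on UNIV F" "\<And>x. x \<notin> cbox a b \<Longrightarrow> F x = 0"
  shows "integrable lborel F"
proof -
  have "integrable lborel (\<lambda>x. indicator (cbox a b) x *\<^sub>R F x)"
    using assms by (intro borel_integrable_compact) (auto intro: continuous_on_subset)
  moreover have "(\<lambda>x. indicator (cbox a b) x *\<^sub>R F x) = F"
    using assms by (auto simp: fun_eq_iff indicator_def)
  ultimately show ?thesis by simp
qed

lemma tens_continuous_integrable:
  fixes F :: "real^'n::finite \<Rightarrow> 'b::euclidean_space"
  assumes "tbump a b g" "continuous_on UNIV F"
  shows "integrable lborel (\<lambda>x. tens g x *\<^sub>R F x)"
  using assms tens_zero[OF assms(1)] tens_continuous[OF assms(1)]
  by (intro integrable_compact_support[of _ a b] continuous_intros) auto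

lemma tens_integral_by_parts:
  fixes F F' :: "real^'n::finite \<Rightarrow> 'b::euclidean_space"
  assumes g: "tbump a b g" and F: "line_deriv i F F'" "continuous_on UNIV F" "continuous_on UNIV F'"
  shows "(LBINT x. tens (dt i g) x *\<^sub>R F x) = - (LBINT x. tens g x *\<^sub>R F' x)"
proof -
  note g' = tbump_dt[OF g, of i]
  have "(LBINT x. tens g x *\<^sub>R F' x + tens (dt i g) x *\<^sub>R F x) = 0"
    using g g' F tens_zero[OF g] tens_zero[OF g']
    by (intro integral_line_deriv_eq_0[of i "\<lambda>x. tens g x *\<^sub>R F x" _ a b]
       line_deriv_bilinear[OF bounded_bilinear_scaleR] continuous_intros)
       (auto intro: line_deriv_tens tens_continuous)
  moreover have "(LBINT x. tens g x *\<^sub>R F' x + tens (dt i g) x *\<^sub>R F x) =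
    (LBINT x. tens g x *\<^sub>R F' x) + (LBINT x. tens (dt i g) x *\<^sub>R F x)"
    by (intro Bochner_Integration.integral_add tens_continuous_integrable[OF g] tens_continuous_integrable[OF g'] F)
  ultimately show ?thesis by (simp add: eq_neg_iff_add_eq_0 add.commute)
qed

text \<open>A box is a product of intervals, so that x can be moved to y inside it by changing one
  coordinate at a time.\<close>

lemma line_deriv_zero_imp_const:
  fixes F :: "real^'n::finite \<Rightarrow> 'b::real_normed_vector"
  assumes d: "\<And>i. line_deriv i F (F' i)" and z: "\<And>i x. x \<in> cbox a b \<Longrightarrow> F' i x = 0"
    and xy: "x \<in> cbox a b" "y \<in> cbox a b"
  shows "F x = F y"
proof -
  have step: "F (w + t *\<^sub>R axis i 1) = F w" if "w \<in> cbox a b" "w + t *\<^sub>R axis i 1 \<in> cbox a b" for w t i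
  proof -
    have conv: "convex (cbox a b)" by (rule convex_box)
    have "norm (F (w + t *\<^sub>R axis i 1) - F (w + 0 *\<^sub>R axis i 1)) \<le> 0 * norm (t - 0)"
    proof (rule differentiable_bound[of "closed_segment 0 t" "\<lambda>t. F (w + t *\<^sub>R axis i 1)" "\<lambda>t h. h *\<^sub>R F' i (w + t *\<^sub>R axis i 1)"])
      fix u assume "u \<in> closed_segment 0 t"
      then obtain l where l: "0 \<le> l" "l \<le> 1" "u = l * t" by (auto simp: closed_segment_def)
      have "w + u *\<^sub>R axis i 1 = (1 - l) *\<^sub>R w + l *\<^sub>R (w + t *\<^sub>R axis i 1)"
        by (simp add: l algebra_simps)
      then have "w + u *\<^sub>R axis i 1 \<in> cbox a b"
        using convexD_alt[OF conv that l(1,2)] by simp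
      then show "onorm (\<lambda>h. h *\<^sub>R F' i (w + u *\<^sub>R axis i 1)) \<le> 0"
        using z by (simp add: onorm_zero)
      show "((\<lambda>t. F (w + t *\<^sub>R axis i 1)) has_derivative (\<lambda>h. h *\<^sub>R F' i (w + u *\<^sub>R axis i 1))) (at u within closed_segment 0 t)"
        using line_derivD[OF d] unfolding has_vector_derivative_def by (rule has_derivative_at_withinI)
    qed auto
    then show ?thesis by simp
  qed
  \<comment> \<open>The point whose coordinates in \<open>S\<close> have already been changed to
    those of y.\<close>
  define zS where "zS S = (\<chi> i. if i \<in> S then y $ i else x $ i)" for S
  have zS: "zS S \<in> cbox a b" for S using xy by (auto simp: zS_def mem_box_cart)
  have "F (zS S) = F x" if "finite S" for S
    using that
  proof (induction S rule: finite_induct)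
    case empty
    then show ?case by (simp add: zS_def)
  next
    case (insert i S)
    have "zS (insert i S) = zS S + (y $ i - x $ i) *\<^sub>R axis i 1"
      using insert by (auto simp: zS_def vec_eq_iff axis_def)
    then show ?case using step[OF zS, of S "y $ i - x $ i" i] zS[of "insert i S"] insert by simp
  qed
  from this[of UNIV] show ?thesis by (simp add: zS_def)
qed

lemma cbox_shift_subset:
  fixes x :: "real^'n"
  assumes "x \<in> cbox a b" "p \<le> q"
  shows "cbox (x - vec p) (x + vec p) \<subseteq> cbox (a - vec q) (b + vec q)"
proof
  fix y assume "y \<in> cbox (x - vec p) (x + vec p)"
  then have "x $ i - p \<le> y $ i" "y $ i \<le> x $ i + p" "a $ i \<le> x $ i" "x $ i \<le> b $ i" for i
    using assms by (auto simp: mem_box_cart)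
  then have "a $ i - q \<le> y $ i" "y $ i \<le> b $ i + q" for i using assms(2) by (smt (verit))+
  then show "y \<in> cbox (a - vec q) (b + vec q)" by (simp add: mem_box_cart)
qed

text \<open>On the smaller box the mollifications are constant.\<close>

lemma wpart_zero_imp_const:
  fixes f :: "real^'n::finite \<Rightarrow> 'b::euclidean_space"
  assumes w: "\<And>i. wpart U i f (\<lambda>_. 0)" and d: "0 < d" "cbox (a - vec d) (b + vec d) \<subseteq> U"
  shows "\<exists>c. AE x in lborel. x \<in> cbox a b \<longrightarrow> f x = c"
proof -
  have f: "integrable lborel f" using w unfolding wpart_def by blast
  let ?B = "cbox a b"
  let ?m = "measure lborel ?B"
  have iB: "integrable lborel (\<lambda>x. indicator ?B x *\<^sub>R c)" for c :: 'b
    by (intro integrable_scaleR_left integrable_real_indicator emeasure_lborel_cbox_finite) auto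
  have iBv: "(LBINT x. indicator ?B x *\<^sub>R c) = ?m *\<^sub>R c" for c :: 'b
    using integrable_real_indicator[of ?B lborel] emeasure_lborel_cbox_finite[of a b]
    by (subst integral_scaleR_left) auto
  have ifB: "integrable lborel (\<lambda>x. indicator ?B x *\<^sub>R f x)"
    by (rule bounded_scaleR_integrable[OF f, where C=1]) (auto simp: indicator_def)
  have ifc: "integrable lborel (\<lambda>x. indicator ?B x *\<^sub>R (f x - c))" for c
    unfolding scaleR_diff_right using iB ifB by auto
  \<comment> \<open>Close to \<open>f\<close> in L^1 there is a mollification, which is constant on
    the box, so that \<open>f\<close> is nearly constant there.\<close>
  have ex: "\<exists>c. (LBINT x. norm (indicator ?B x *\<^sub>R (f x - c))) < e" if e: "e > 0" for e
  proof -
    have "\<forall>\<^sub>F s in at_right 0. (LBINT x. norm (mol s f x - f x)) < e"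
      using order_tendstoD(2)[OF mol_L1_tendsto[OF f] e] .
    moreover have "\<forall>\<^sub>F s in at_right 0. 0 < s \<and> s < d"
      using d unfolding eventually_at_right_field by blast
    ultimately obtain s where s: "0 < s" "s < d" "(LBINT x. norm (mol s f x - f x)) < e"
      using eventually_happens'[OF _ eventually_conj] trivial_limit_at_right_real by blast
    define c where "c = mol s f a"
    have "mol s f x = c" if x: "x \<in> ?B" for x
      unfolding c_def
    proof (rule line_deriv_zero_imp_const)
      show "line_deriv i (mol s f) (tconv (dt i (\<lambda>_. moll s)) f)" for i
        by (rule line_deriv_tconv[OF tbump_moll[OF s(1)] f])
      show "tconv (dt i (\<lambda>_. moll s)) f y = 0" if y: "y \<in> ?B" for i y
      proof -
        have "cbox (y - vec s) (y - vec (- s)) \<subseteq> U"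
        proof -
          have "y - vec (- s) = y + vec s" by (simp add: vec_eq_iff)
          show ?thesis unfolding \<open>y - vec (- s) = y + vec s\<close>
            using cbox_shift_subset[OF y, of s d] s d(2) by auto
        qed
        from wpart_tconv[OF w tbump_moll[OF s(1)] this] show ?thesis by (simp add: tconv_def)
      qed
      show "x \<in> ?B" "a \<in> ?B" using x by (auto simp: mem_box_cart intro: order_trans)
    qed
    then have "norm (indicator ?B x *\<^sub>R (f x - c)) \<le> norm (mol s f x - f x)" for x
      by (cases "x \<in> ?B") (auto simp: norm_minus_commute)
    then have "(LBINT x. norm (indicator ?B x *\<^sub>R (f x - c))) \<le> (LBINT x. norm (mol s f x - f x))"
      using integrable_norm[OF ifc] tconv_integrable[OF tbump_moll[OF s(1)] f] f
      by (intro integral_mono) auto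
    then show ?thesis using s(3) by (intro exI[of _ c]) simp
  qed
  show ?thesis
  proof (cases "?m = 0")
    case True
    then have "?B \<in> null_sets lborel"
      using emeasure_eq_ennreal_measure[of lborel ?B] emeasure_lborel_cbox_finite[of a b]
      by (auto simp: null_sets_def)
    then have "AE x in lborel. x \<notin> ?B" by (rule AE_not_in)
    then show ?thesis by (auto elim: eventually_mono)
  next
    case False
    then have m: "?m > 0" by (simp add: zero_less_measure_iff)
    \<comment> \<open>The constants found so far depend on \<open>e\<close>. The mean of
      \<open>f\<close> over the box differs from each by at most e / \<open>?m\<close> and so serves
      for all \<open>e\<close>.\<close>
    define A where "A = (LBINT x. indicator ?B x *\<^sub>R f x) /\<^sub>R ?m"
    have le: "(LBINT x. norm (indicator ?B x *\<^sub>R (f x - A))) \<le> 2 * e" if e: "e > 0" for e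
    proof -
      obtain c where c: "(LBINT x. norm (indicator ?B x *\<^sub>R (f x - c))) < e" using ex[OF e] by blast
      have "(LBINT x. indicator ?B x *\<^sub>R (f x - c)) = ?m *\<^sub>R (A - c)"
        unfolding scaleR_diff_right using iB ifB m by (simp add: A_def iBv)
      then have "?m * norm (A - c) \<le> (LBINT x. norm (indicator ?B x *\<^sub>R (f x - c)))"
        using integral_norm_bound[of lborel "\<lambda>x. indicator ?B x *\<^sub>R (f x - c)"] m by simp
      then have 1: "?m * norm (A - c) < e" using c by simp
      have "(LBINT x. norm (indicator ?B x *\<^sub>R (f x - A))) \<le>
         (LBINT x. norm (indicator ?B x *\<^sub>R (f x - c)) + norm (indicator ?B x *\<^sub>R (A - c)))"
      proof (rule integral_mono)
        show "norm (indicator ?B x *\<^sub>R (f x - A)) \<le> norm (indicator ?B x *\<^sub>R (f x - c)) + norm (indicator ?B x *\<^sub>R (A - c))" for x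
          using norm_triangle_ineq4[of "f x - c" "A - c"] by (cases "x \<in> ?B") auto
      qed (use integrable_norm[OF ifc] integrable_norm[OF iB] in \<open>auto simp del: norm_scaleR\<close>)
      also have "\<dots> = (LBINT x. norm (indicator ?B x *\<^sub>R (f x - c))) + ?m * norm (A - c)"
        using integrable_norm[OF ifc] integrable_norm[OF iB]
        by (subst Bochner_Integration.integral_add) (auto simp: mult.commute)
      finally show ?thesis using 1 c by simp
    qed
    have "(LBINT x. norm (indicator ?B x *\<^sub>R (f x - A))) \<le> 0"
    proof (rule field_le_epsilon)
      fix e :: real assume "e > 0"
      then show "(LBINT x. norm (indicator ?B x *\<^sub>R (f x - A))) \<le> 0 + e" using le[of "e/2"] by simp
    qed
    then have "(LBINT x. norm (indicator ?B x *\<^sub>R (f x - A))) = 0"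
      by (intro antisym integral_nonneg) auto
    then have "AE x in lborel. norm (indicator ?B x *\<^sub>R (f x - A)) = 0"
      by (subst (asm) integral_nonneg_eq_0_iff_AE) (use integrable_norm[OF ifc] in auto)
    then show ?thesis by (intro exI[of _ A]) (auto elim!: eventually_mono)
  qed
qed

subsection \<open>Rigidity\<close>

lemma norm_cross3_le: "norm (cross3 x y) \<le> norm x * norm y"
proof -
  have "(norm (cross3 x y))\<^sup>2 \<le> (norm x * norm y)\<^sup>2"
    using norm_cross_dot[of x y] by (smt (verit) zero_le_power2)
  then show ?thesis by (rule power2_le_imp_le) simp
qed

lemma bounded_bilinear_cross3: "bounded_bilinear cross3"
  using bilinear_cross bilinear_conv_bounded_bilinear by blast

text \<open>Rotations commute with the cross product, so that the relations between the standard
  basis vectors carry over to the columns.\<close>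

lemma rotation_matrix_columns:
  fixes c :: "3 \<Rightarrow> real^3"
  assumes "rotation_matrix (\<chi> i j. c j $ i)"
  shows "cross3 (c 2) (c 3) = c 1" "cross3 (c 3) (c 1) = c 2" "cross3 (c 1) (c 2) = c 3" "norm (c j) = 1"
proof -
  let ?A = "(\<chi> i j. c j $ i) :: real^3^3"
  have col: "column j ?A = c j" for j by (simp add: column_def vec_eq_iff)
  have c: "c j = ?A *v axis j 1" for j using col[of j] matrix_vector_mult_basis[of ?A j] by simp
  note X = cross_rotation_matrix[OF assms]
  show "cross3 (c 2) (c 3) = c 1" "cross3 (c 3) (c 1) = c 2" "cross3 (c 1) (c 2) = c 3"
    unfolding c[of 1] c[of 2] c[of 3] X cross_basis by simp_all
  show "norm (c j) = 1"
    using assms orthogonal_matrix_orthonormal_columns[of ?A] col[of j] unfolding rotation_matrix_def by metis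
qed

text \<open>Exchanging \<open>f\<close> for \<open>h\<close> under a test integral costs the
  supremum of the kernel times an L^1 error. In this way \<open>err\<close> enters the estimates of
  the divergence and the energy.\<close>

lemma tens_integral_diff_le:
  fixes f h :: "real^'n::finite \<Rightarrow> 'b::euclidean_space"
  assumes g: "tbump a b g" and B: "\<And>x. \<bar>tens g x\<bar> \<le> B"
    and i: "integrable lborel (\<lambda>x. tens g x *\<^sub>R f x)" "integrable lborel (\<lambda>x. tens g x *\<^sub>R h x)"
    and e: "integrable lborel e" "\<And>x. e x \<ge> 0" "AE x in lborel. x \<in> cbox a b \<longrightarrow> norm (f x - h x) \<le> e x"
  shows "norm ((LBINT x. tens g x *\<^sub>R f x) - (LBINT x. tens g x *\<^sub>R h x)) \<le> B * (LBINT x. e x)"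
proof -
  have B0: "B \<ge> 0" using B abs_ge_zero order_trans by blast
  have i': "integrable lborel (\<lambda>x. tens g x *\<^sub>R (f x - h x))" unfolding scaleR_diff_right using i by auto
  have "(LBINT x. tens g x *\<^sub>R f x) - (LBINT x. tens g x *\<^sub>R h x) = (LBINT x. tens g x *\<^sub>R (f x - h x))"
    unfolding scaleR_diff_right using i by simp
  also have "norm \<dots> \<le> (LBINT x. norm (tens g x *\<^sub>R (f x - h x)))" by (rule integral_norm_bound)
  also have "\<dots> \<le> (LBINT x. B * e x)"
  proof (rule integral_mono_AE)
    show "AE x in lborel. norm (tens g x *\<^sub>R (f x - h x)) \<le> B * e x"
      using e(3)
    proof eventually_elim
      case (elim x)
      then show ?case using tens_zero[OF g, of x] B0 e(2)[of x] B[of x]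
        by (cases "x \<in> cbox a b") (auto intro!: mult_mono)
    qed
  qed (use integrable_norm[OF i'] e in auto)
  finally show ?thesis by simp
qed

text \<open>\<open>r j\<close> is the j-th column of the gradient. The set \<open>U\<close> is kept
  general since rigidity is used on pieces of fibers and again for the limit map.\<close>

locale rigid_gradient =
  fixes U :: "(real^3) set" and u :: "real^3 \<Rightarrow> real^3" and r :: "3 \<Rightarrow> real^3 \<Rightarrow> real^3"
  assumes w: "wpart U i u (r i)"
    and rot: "AE x in lborel. x \<in> U \<longrightarrow> rotation_matrix (\<chi> i j. r j x $ i)"
begin

lemma u_int: "integrable lborel u" and r_int: "integrable lborel (r i)"
  using w[of i] unfolding wpart_def by auto

text \<open>For \<open>x\<close> at distance more than \<open>s\<close> from the complement of \<open>U\<close>, \<open>V s j\<close> is the mollified gradient;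
  in this form it is a smooth gradient on the whole space.\<close>

definition V :: "real \<Rightarrow> 3 \<Rightarrow> real^3 \<Rightarrow> real^3" where
  "V s j = tconv (dt j (\<lambda>_. moll s)) u"

definition V2 :: "real \<Rightarrow> 3 \<Rightarrow> 3 \<Rightarrow> real^3 \<Rightarrow> real^3" where
  "V2 s i j = tconv (dt i (dt j (\<lambda>_. moll s))) u"

definition V3 :: "real \<Rightarrow> 3 \<Rightarrow> 3 \<Rightarrow> real^3 \<Rightarrow> real^3" where
  "V3 s i j = tconv (dt i (dt i (dt j (\<lambda>_. moll s)))) u"

definition err :: "real \<Rightarrow> real" where
  "err s = (\<Sum>j\<in>UNIV. LBINT x. norm (mol s (r j) x - r j x))"

lemma err_tendsto: "(err \<longlongrightarrow> 0) (at_right 0)"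
proof -
  have "((\<lambda>s. \<Sum>j\<in>(UNIV::3 set). LBINT x. norm (mol s (r j) x - r j x)) \<longlongrightarrow> (\<Sum>j\<in>(UNIV::3 set). 0)) (at_right 0)"
    by (intro tendsto_sum mol_L1_tendsto r_int)
  then show ?thesis by (simp add: err_def[abs_def])
qed

text \<open>Quantities independent of s are compared through mollified ones; letting s tend to 0
  removes the error.\<close>

lemma le_of_err_bound:
  assumes "0 < t" "\<And>s. 0 < s \<Longrightarrow> s < t \<Longrightarrow> X \<le> K * err s + Y" shows "X \<le> Y"
proof -
  have "((\<lambda>s. K * err s + Y) \<longlongrightarrow> K * 0 + Y) (at_right 0)"
    by (intro tendsto_intros err_tendsto)
  moreover have "\<forall>\<^sub>F s in at_right 0. X \<le> K * err s + Y"
    using assms unfolding eventually_at_right_field by blast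
  ultimately have "X \<le> K * 0 + Y" by (rule tendsto_lowerbound) simp
  then show ?thesis by simp
qed

context
  fixes s :: real assumes s: "0 < s"
begin

lemma V_line: "line_deriv i (V s j) (V2 s i j)" "line_deriv i (V2 s i j) (V3 s i j)"
  unfolding V_def V2_def V3_def
  by (rule line_deriv_tconv[OF tbump_dt[OF tbump_moll[OF s]] u_int]
      line_deriv_tconv[OF tbump_dt[OF tbump_dt[OF tbump_moll[OF s]]] u_int])+

lemma V_cont: "continuous_on S (V s j)" "continuous_on S (V2 s i j)" "continuous_on S (V3 s i j)"
  unfolding V_def V2_def V3_def
  by (rule tconv_continuous[OF tbump_dt[OF tbump_moll[OF s]] u_int]
      tconv_continuous[OF tbump_dt[OF tbump_dt[OF tbump_moll[OF s]]] u_int]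
      tconv_continuous[OF tbump_dt[OF tbump_dt[OF tbump_dt[OF tbump_moll[OF s]]]] u_int])+

lemma V2_commute: "V2 s i j = V2 s j i"
  unfolding V2_def by (subst dt_commute) simp

text \<open>The spelling \<open>x - vec (- s)\<close> is the one in which \<open>wpart_tconv\<close>
  produces the reflected box of the mollifier.\<close>

lemma cube_subset:
  assumes "x \<in> cbox a b" "cbox (a - vec t) (b + vec t) \<subseteq> U" "s \<le> t"
  shows "cbox (x - vec s) (x - vec (- s)) \<subseteq> U"
proof -
  have "x - vec (- s) = x + vec s" by (simp add: vec_eq_iff)
  show ?thesis unfolding \<open>x - vec (- s) = x + vec s\<close>
    using cbox_shift_subset[OF assms(1,3)] assms(2) by auto
qed

lemma V_eq_mol:
  assumes "x \<in> cbox a b" "cbox (a - vec t) (b + vec t) \<subseteq> U" "s \<le> t"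
  shows "V s j x = mol s (r j) x"
  unfolding V_def by (rule wpart_tconv[OF w tbump_moll[OF s] cube_subset[OF assms]])

lemma V_norm:
  assumes x: "x \<in> cbox a b" "cbox (a - vec t) (b + vec t) \<subseteq> U" "s \<le> t"
  shows "norm (V s j x) \<le> 1"
proof -
  have "AE y in lborel. (\<forall>i. \<bar>x $ i - y $ i\<bar> \<le> s) \<longrightarrow> norm (r j y - 0) \<le> 1"
    using rot
  proof eventually_elim
    case (elim y)
    show ?case
    proof
      assume y: "\<forall>i. \<bar>x $ i - y $ i\<bar> \<le> s"
      have "x $ i - s \<le> y $ i \<and> y $ i \<le> x $ i + s" for i using y[rule_format, of i] by linarith
      then have "y \<in> cbox (x - vec s) (x - vec (- s))" by (auto simp: mem_box_cart)
      then have "y \<in> U" using cube_subset[OF assms] by blast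
      then show "norm (r j y - 0) \<le> 1" using elim rotation_matrix_columns(4)[of "\<lambda>j. r j y" j] by simp
    qed
  qed
  from mol_approx[OF s r_int this] show ?thesis using V_eq_mol[OF x] by simp
qed

end

lemma mol_int: "0 < s \<Longrightarrow> integrable lborel (\<lambda>x. norm (mol s (r j) x - r j x))"
  using tconv_integrable[OF tbump_moll r_int, of s j] r_int by auto

lemma mol_int_sum: "0 < s \<Longrightarrow> integrable lborel (\<lambda>x. \<Sum>j\<in>UNIV. norm (mol s (r j) x - r j x))"
  by (intro Bochner_Integration.integrable_sum mol_int)

lemma err_eq: "0 < s \<Longrightarrow> err s = (LBINT x. (\<Sum>j\<in>UNIV. norm (mol s (r j) x - r j x)))"
  unfolding err_def by (rule Bochner_Integration.integral_sum[symmetric]) (rule mol_int)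

lemma err_single: "0 < s \<Longrightarrow> (LBINT x. norm (mol s (r j) x - r j x)) \<le> err s"
  unfolding err_def by (rule member_le_sum) (auto intro: integral_nonneg)

text \<open>The cross product is changed in one factor at a time, the other having norm at most 1.
  As i and j differ, both errors are summands of the total one.\<close>

lemma cross_err:
  assumes s: "0 < s" and x: "x \<in> cbox a b" "cbox (a - vec t) (b + vec t) \<subseteq> U" "s \<le> t"
    and "norm (r i x) = 1" "cross3 (r i x) (r j x) = r k x" "i \<noteq> j"
  shows "norm (cross3 (V s i x) (V s j x) - r k x) \<le> (\<Sum>j\<in>UNIV. norm (mol s (r j) x - r j x))"
proof -
  have "cross3 (V s i x) (V s j x) - r k x = cross3 (V s i x - r i x) (V s j x) + cross3 (r i x) (V s j x - r j x)"
    using assms(6) by (simp add: Cross3.left_diff_distrib Cross3.right_diff_distrib)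
  also have "norm \<dots> \<le> norm (V s i x - r i x) * norm (V s j x) + norm (r i x) * norm (V s j x - r j x)"
    by (rule order_trans[OF norm_triangle_ineq add_mono[OF norm_cross3_le norm_cross3_le]])
  also have "\<dots> \<le> norm (V s i x - r i x) * 1 + 1 * norm (V s j x - r j x)"
    using V_norm[OF s x, of j] assms(5) by (intro add_mono mult_left_mono) auto
  also have "\<dots> = (\<Sum>j\<in>{i,j}. norm (mol s (r j) x - r j x))"
    using V_eq_mol[OF s x] \<open>i \<noteq> j\<close> by simp
  also have "\<dots> \<le> (\<Sum>j\<in>UNIV. norm (mol s (r j) x - r j x))"
    by (rule sum_mono2) auto
  finally show ?thesis .
qed

text \<open>The Piola identity: the cofactor matrix of a gradient is divergence free, and a rotation is its
  own cofactor matrix.\<close>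

lemma divergence_free:
  assumes g: "tbump a b g" and t: "0 < t" "cbox (a - vec t) (b + vec t) \<subseteq> U"
  shows "(\<Sum>j\<in>UNIV. LBINT x. tens (dt j g) x *\<^sub>R r j x) = 0"
proof -
  obtain B where B: "\<And>j x. \<bar>tens (dt j g) x\<bar> \<le> B"
  proof -
    have "\<exists>C. \<forall>x. \<bar>tens (dt j g) x\<bar> \<le> C" for j using tens_bounded[OF tbump_dt[OF g, of j]] by metis
    then obtain C where C: "\<And>j x. \<bar>tens (dt j g) x\<bar> \<le> C j" by metis
    have "\<bar>tens (dt j g) x\<bar> \<le> Max (range C)" for j x
      using C[of j x] Max_ge[of "range C" "C j"] by (simp add: order_trans)
    then show thesis using that by blast
  qed
  have "norm (\<Sum>j\<in>UNIV. LBINT x. tens (dt j g) x *\<^sub>R r j x) \<le> 0"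
  proof (rule le_of_err_bound[OF t(1)])
    fix s :: real assume s: "0 < s" "s < t"
    define Cof where "Cof j = (if j = 1 then (\<lambda>x. cross3 (V s 2 x) (V s 3 x)) else if j = 2 then (\<lambda>x. cross3 (V s 3 x) (V s 1 x))
      else (\<lambda>x. cross3 (V s 1 x) (V s 2 x)))" for j :: 3
    define Cof' where "Cof' j = (if j = 1 then (\<lambda>x. cross3 (V s 2 x) (V2 s 1 3 x) + cross3 (V2 s 1 2 x) (V s 3 x))
      else if j = 2 then (\<lambda>x. cross3 (V s 3 x) (V2 s 2 1 x) + cross3 (V2 s 2 3 x) (V s 1 x))
      else (\<lambda>x. cross3 (V s 1 x) (V2 s 3 2 x) + cross3 (V2 s 3 1 x) (V s 2 x)))" for j :: 3
    have ld: "line_deriv j (Cof j) (Cof' j)" for j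
      unfolding Cof_def Cof'_def using exhaust_3[of j]
      by (auto intro!: line_deriv_bilinear[OF bounded_bilinear_cross3] V_line(1)[OF s(1)])
    have cont: "continuous_on UNIV (Cof j)" "continuous_on UNIV (Cof' j)" for j
      unfolding Cof_def Cof'_def using V_cont(1,2)[OF s(1)] by (auto intro!: continuous_on_add continuous_on_cross)
    have ibp: "(LBINT x. tens (dt j g) x *\<^sub>R Cof j x) = - (LBINT x. tens g x *\<^sub>R Cof' j x)" for j
      by (rule tens_integral_by_parts[OF g ld cont])
    \<comment> \<open>By the product rule there are six terms. Symmetry of mixed second derivatives
      and antisymmetry of the cross product cancel them in pairs.\<close>
    have div0: "(\<Sum>j\<in>UNIV. Cof' j x) = 0" for x
      unfolding sum_3 Cof'_def
      using V2_commute[OF s(1), of 1 2] V2_commute[OF s(1), of 1 3] V2_commute[OF s(1), of 2 3]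
      by (simp add: cross_skew[of "V s 2 x"] cross_skew[of "V s 3 x"] cross_skew[of "V s 1 x"])
    have "(\<Sum>j\<in>UNIV. LBINT x. tens (dt j g) x *\<^sub>R Cof j x) = - (LBINT x. (\<Sum>j\<in>UNIV. tens g x *\<^sub>R Cof' j x))"
      unfolding ibp sum_negf
      by (subst Bochner_Integration.integral_sum) (auto intro: tens_continuous_integrable[OF g cont(2)])
    also have "\<dots> = 0" unfolding scaleR_right.sum[symmetric] div0 by simp
    finally have cof0: "(\<Sum>j\<in>UNIV. LBINT x. tens (dt j g) x *\<^sub>R Cof j x) = 0" .
    \<comment> \<open>The cofactor columns of the mollified gradient are compared with
      \<open>r j\<close>, which is its own cofactor column.\<close>
    have est: "norm ((LBINT x. tens (dt j g) x *\<^sub>R Cof j x) - (LBINT x. tens (dt j g) x *\<^sub>R r j x)) \<le> B * err s" for j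
      unfolding err_eq[OF s(1)]
    proof (rule tens_integral_diff_le[OF tbump_dt[OF g] B])
      show "integrable lborel (\<lambda>x. tens (dt j g) x *\<^sub>R Cof j x)"
        by (rule tens_continuous_integrable[OF tbump_dt[OF g] cont(1)])
      show "integrable lborel (\<lambda>x. tens (dt j g) x *\<^sub>R r j x)"
        by (rule tens_integrand[OF tbump_dt[OF g] r_int])
      show "AE x in lborel. x \<in> cbox a b \<longrightarrow> norm (Cof j x - r j x) \<le> (\<Sum>j\<in>UNIV. norm (mol s (r j) x - r j x))"
        using rot
      proof (eventually_elim, intro impI)
        fix x assume x: "x \<in> U \<longrightarrow> rotation_matrix (\<chi> i j. r j x $ i)" "x \<in> cbox a b"
        have "x \<in> U" using cube_subset[OF s(1) x(2) t(2)] s by (auto simp: subset_iff mem_box_cart)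
        then have rm: "rotation_matrix (\<chi> i j. r j x $ i)" using x by blast
        note R = rotation_matrix_columns[of "\<lambda>j. r j x", OF rm]
        note ce = cross_err[OF s(1) x(2) t(2) less_imp_le[OF s(2)] R(4)]
        show "norm (Cof j x - r j x) \<le> (\<Sum>j\<in>UNIV. norm (mol s (r j) x - r j x))"
          unfolding Cof_def using exhaust_3[of j] ce[OF R(1)] ce[OF R(2)] ce[OF R(3)] by auto
      qed
    qed (auto intro!: mol_int_sum s sum_nonneg)
    have "norm (\<Sum>j\<in>UNIV. LBINT x. tens (dt j g) x *\<^sub>R r j x) =
       norm (\<Sum>j\<in>UNIV. (LBINT x. tens (dt j g) x *\<^sub>R Cof j x) - (LBINT x. tens (dt j g) x *\<^sub>R r j x))"
      unfolding sum_subtractf cof0 by simp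
    also have "\<dots> \<le> (\<Sum>j\<in>(UNIV::3 set). B * err s)" by (intro sum_norm_le est)
    finally show "norm (\<Sum>j\<in>UNIV. LBINT x. tens (dt j g) x *\<^sub>R r j x) \<le> (3 * B) * err s + 0" by simp
  qed
  then show ?thesis by simp
qed

lemma divergence_free_tconv:
  assumes g: "tbump a b g" and t: "0 < t" "cbox (x - b - vec t) (x - a + vec t) \<subseteq> U"
  shows "(\<Sum>j\<in>UNIV. tconv (dt j g) (r j) x) = 0"
  using divergence_free[OF tbump_reflected[OF g] t]
  by (simp add: tens_dt_reflected[OF g] tconv_def sum_negf)

text \<open>Of the two derivatives in direction i one is moved from the kernel back to
  \<open>u\<close>, which turns \<open>u\<close> into \<open>r i\<close>. The sum over i is then the
  divergence of the rotation field tested with a derivative of the mollifier, and t - s is the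
  margin left for \<open>divergence_free\<close>.\<close>

lemma V_harmonic:
  assumes s: "0 < s" and t: "s < t" and x: "x \<in> cbox a b" "cbox (a - vec t) (b + vec t) \<subseteq> U"
  shows "(\<Sum>i\<in>UNIV. V3 s i j x) = 0"
proof -
  have m: "tbump (vec (- s)) (vec s) (dt j (\<lambda>_. moll s))" by (rule tbump_dt[OF tbump_moll[OF s]])
  have "V3 s i j x = tconv (dt i (dt j (\<lambda>_. moll s))) (r i) x" for i
  proof -
    have "V3 s i j x = tconv (dt i (dt i (dt j (\<lambda>_. moll s)))) u x" by (simp add: V3_def)
    also have "\<dots> = tconv (dt i (dt j (\<lambda>_. moll s))) (r i) x"
      by (rule wpart_tconv[OF w tbump_dt[OF m] cube_subset[OF s x less_imp_le[OF t]]])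
    finally show ?thesis .
  qed
  moreover have "(\<Sum>i\<in>UNIV. tconv (dt i (dt j (\<lambda>_. moll s))) (r i) x) = 0"
  proof (rule divergence_free_tconv[OF m, of "t - s"])
    have e: "x - vec s - vec (t - s) = x - vec t" "x - vec (- s) + vec (t - s) = x + vec t"
      by (simp_all add: vec_eq_iff)
    show "cbox (x - vec s - vec (t - s)) (x - vec (- s) + vec (t - s)) \<subseteq> U"
      unfolding e using cbox_shift_subset[OF x(1), of t t] x(2) by auto
  qed (use t in simp)
  ultimately show ?thesis by simp
qed

text \<open>The energy identity \<open>\<integral> \<phi> \<bar>\<nabla>V\<bar>\<^sup>2 = 1/2 \<integral> \<bar>V\<bar>\<^sup>2 \<Delta>\<phi>\<close> for harmonic \<open>V\<close>; the right-hand side tends to \<open>0\<close>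
  because \<open>\<bar>V\<bar>\<^sup>2\<close> tends to the constant \<open>3\<close>.\<close>

lemma energy_bound:
  assumes g: "tbump a b g" and t: "0 < t" "cbox (a - vec t) (b + vec t) \<subseteq> U"
  shows "\<exists>K. \<forall>s. 0 < s \<longrightarrow> s < t \<longrightarrow>
    (LBINT x. tens g x *\<^sub>R (\<Sum>i\<in>UNIV. \<Sum>j\<in>UNIV. V2 s i j x \<bullet> V2 s i j x)) \<le> K * err s"
proof -
  obtain B where B: "\<And>i x. \<bar>tens (dt i (dt i g)) x\<bar> \<le> B"
  proof -
    have "\<exists>C. \<forall>x. \<bar>tens (dt j (dt j g)) x\<bar> \<le> C" for j using tens_bounded[OF tbump_dt[OF tbump_dt[OF g]], of j j] by metis
    then obtain C where C: "\<And>j x. \<bar>tens (dt j (dt j g)) x\<bar> \<le> C j" by metis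
    have "\<bar>tens (dt j (dt j g)) x\<bar> \<le> Max (range C)" for j x
      using C[of j x] Max_ge[of "range C" "C j"] by (simp add: order_trans)
    then show thesis using that by blast
  qed
  show ?thesis
  proof (intro exI[of _ "3 * B"] allI impI)
    fix s :: real assume s: "0 < s" "s < t"
    define Q where "Q x = (1/2) *\<^sub>R (\<Sum>j\<in>UNIV. V s j x \<bullet> V s j x)" for x
    define P where "P i x = (\<Sum>j\<in>UNIV. V s j x \<bullet> V2 s i j x)" for i x
    define P' where "P' i x = (\<Sum>j\<in>UNIV. V s j x \<bullet> V3 s i j x + V2 s i j x \<bullet> V2 s i j x)" for i x
    note VL = V_line[OF s(1)] and VC = V_cont[OF s(1)]
    have Q: "line_deriv i (\<lambda>x. (1/2) *\<^sub>R (\<Sum>j\<in>UNIV. V s j x \<bullet> V s j x))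
       (\<lambda>x. (1/2) *\<^sub>R (\<Sum>j\<in>UNIV. V s j x \<bullet> V2 s i j x + V2 s i j x \<bullet> V s j x))" for i
      by (intro line_deriv_scaleR_const line_deriv_sum line_deriv_bilinear[OF bounded_bilinear_inner] VL)
    have Q: "line_deriv i Q (P i)" for i
    proof -
      have "(\<Sum>j\<in>UNIV. V2 s i j x \<bullet> V s j x) = (\<Sum>j\<in>UNIV. V s j x \<bullet> V2 s i j x)" for x
        by (intro sum.cong refl inner_commute)
      then have "(\<lambda>x. (1/2) *\<^sub>R (\<Sum>j\<in>UNIV. V s j x \<bullet> V2 s i j x + V2 s i j x \<bullet> V s j x)) = P i"
        by (simp add: P_def[abs_def] sum.distrib)
      then show ?thesis using Q[of i] unfolding Q_def[abs_def] by metis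
    qed
    have P: "line_deriv i (P i) (P' i)" for i
      unfolding P_def[abs_def] P'_def[abs_def]
      by (intro line_deriv_sum line_deriv_bilinear[OF bounded_bilinear_inner] VL)
    have c: "continuous_on UNIV Q" "continuous_on UNIV (P i)" "continuous_on UNIV (P' i)" for i
      unfolding Q_def[abs_def] P_def[abs_def] P'_def[abs_def] by (intro continuous_intros VC)+
    have ibp: "(LBINT x. tens (dt i (dt i g)) x *\<^sub>R Q x) = (LBINT x. tens g x *\<^sub>R P' i x)" for i
      using tens_integral_by_parts[OF tbump_dt[OF g] Q c(1,2), of i i] tens_integral_by_parts[OF g P c(2,3), of i] by simp
    \<comment> \<open>On rotations \<open>Q\<close> would take the value 3/2. This constant may be
      subtracted because a second derivative of a test function has integral 0.\<close>
    have c0: "(LBINT x. tens (dt i (dt i g)) x *\<^sub>R (3/2::real)) = 0" for i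
      using tens_integral_by_parts[OF tbump_dt[OF g], of i "\<lambda>_. 3/2::real" "\<lambda>_. 0" i]
      by (simp add: line_deriv_def)
    have est: "norm ((LBINT x. tens (dt i (dt i g)) x *\<^sub>R Q x) - (LBINT x. tens (dt i (dt i g)) x *\<^sub>R (3/2::real))) \<le> B * err s" for i
      unfolding err_eq[OF s(1)]
    proof (rule tens_integral_diff_le[OF tbump_dt[OF tbump_dt[OF g]] B])
      show "integrable lborel (\<lambda>x. tens (dt i (dt i g)) x *\<^sub>R Q x)"
        by (rule tens_continuous_integrable[OF tbump_dt[OF tbump_dt[OF g]] c(1)])
      show "integrable lborel (\<lambda>x. tens (dt i (dt i g)) x *\<^sub>R (3/2::real))"
        by (rule tens_continuous_integrable[OF tbump_dt[OF tbump_dt[OF g]]]) simp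
      show "AE x in lborel. x \<in> cbox a b \<longrightarrow> norm (Q x - 3/2) \<le> (\<Sum>j\<in>UNIV. norm (mol s (r j) x - r j x))"
        using rot
      proof (eventually_elim, intro impI)
        fix x assume x: "x \<in> U \<longrightarrow> rotation_matrix (\<chi> i j. r j x $ i)" "x \<in> cbox a b"
        have "x \<in> U" using cube_subset[OF s(1) x(2) t(2)] s by (auto simp: subset_iff mem_box_cart)
        then have rm: "rotation_matrix (\<chi> i j. r j x $ i)" using x by blast
        have R: "norm (r j x) = 1" for j by (rule rotation_matrix_columns(4)[of "\<lambda>j. r j x", OF rm])
        have le: "\<bar>V s j x \<bullet> V s j x - 1\<bar> \<le> 2 * norm (mol s (r j) x - r j x)" for j
        proof -
          have n1: "norm (V s j x) \<le> 1" by (rule V_norm[OF s(1) x(2) t(2) less_imp_le[OF s(2)]])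
          have "V s j x \<bullet> V s j x - 1 = (norm (V s j x) - 1) * (norm (V s j x) + 1)"
            by (simp add: dot_square_norm power2_eq_square algebra_simps)
          then have "\<bar>V s j x \<bullet> V s j x - 1\<bar> = \<bar>norm (V s j x) - 1\<bar> * (norm (V s j x) + 1)"
            by (simp add: abs_mult)
          also have "\<dots> \<le> norm (V s j x - r j x) * 2"
            using norm_triangle_ineq3[of "V s j x" "r j x"] R n1 by (intro mult_mono) auto
          finally show ?thesis using V_eq_mol[OF s(1) x(2) t(2) less_imp_le[OF s(2)]] by simp
        qed
        have "Q x - 3/2 = (1/2) * (\<Sum>j\<in>UNIV. V s j x \<bullet> V s j x - 1)"
          by (simp add: Q_def sum_subtractf algebra_simps)
        also have "norm \<dots> \<le> (1/2) * (\<Sum>j\<in>UNIV. 2 * norm (mol s (r j) x - r j x))"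
          unfolding norm_mult using le by (intro mult_mono sum_norm_le) auto
        finally show "norm (Q x - 3/2) \<le> (\<Sum>j\<in>UNIV. norm (mol s (r j) x - r j x))"
          by (simp add: sum_distrib_left[symmetric])
      qed
    qed (auto intro!: mol_int_sum s sum_nonneg)
    \<comment> \<open>The terms with third derivatives of \<open>u\<close> in \<open>P'\<close> sum
      to V times its Laplacian, which is 0 on the box.\<close>
    have eq: "tens g x *\<^sub>R (\<Sum>i\<in>UNIV. \<Sum>j\<in>UNIV. V2 s i j x \<bullet> V2 s i j x) = (\<Sum>i\<in>UNIV. tens g x *\<^sub>R P' i x)" for x
    proof (cases "x \<in> cbox a b")
      case True
      have "(\<Sum>i\<in>UNIV. \<Sum>j\<in>UNIV. V s j x \<bullet> V3 s i j x) = (\<Sum>j\<in>UNIV. V s j x \<bullet> (\<Sum>i\<in>UNIV. V3 s i j x))"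
        by (subst sum.swap) (simp add: inner_sum_right)
      also have "\<dots> = 0" using V_harmonic[OF s True t(2)] by simp
      finally have "(\<Sum>i\<in>UNIV. P' i x) = (\<Sum>i\<in>UNIV. \<Sum>j\<in>UNIV. V2 s i j x \<bullet> V2 s i j x)"
        unfolding P'_def sum.distrib by simp
      then show ?thesis by (simp add: sum_distrib_left[symmetric])
    qed (use tens_zero[OF g] in simp)
    have "(LBINT x. tens g x *\<^sub>R (\<Sum>i\<in>UNIV. \<Sum>j\<in>UNIV. V2 s i j x \<bullet> V2 s i j x)) = (\<Sum>i\<in>UNIV. LBINT x. tens g x *\<^sub>R P' i x)"
      unfolding eq by (rule Bochner_Integration.integral_sum) (rule tens_continuous_integrable[OF g c(3)])
    also have "\<dots> \<le> (\<Sum>i\<in>(UNIV::3 set). B * err s)"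
    proof (rule sum_mono)
      fix i
      show "(LBINT x. tens g x *\<^sub>R P' i x) \<le> B * err s"
        using est[of i] unfolding c0 ibp by simp
    qed
    finally show "(LBINT x. tens g x *\<^sub>R (\<Sum>i\<in>UNIV. \<Sum>j\<in>UNIV. V2 s i j x \<bullet> V2 s i j x)) \<le> (3 * B) * err s"
      by simp
  qed
qed

text \<open>After one integration by parts the second derivatives of the mollified map are tested
  with \<open>g\<close>, and Young's inequality splits the product into k / 2 and the energy density
  over 2 k. For fixed k the energy vanishes with s; the remaining k / 2 times the volume is then
  made small by k.\<close>

lemma gradient_weak_deriv_zero:
  assumes g: "tbump a b g" and t: "0 < t" "cbox (a - vec t) (b + vec t) \<subseteq> U"
  shows "(LBINT x. tens (dt i g) x *\<^sub>R r j x) = 0"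
proof -
  \<comment> \<open>The energy is weighted with the square of \<open>tens g\<close>, which is itself
    a tensor product.\<close>
  define h where "h i x = g i x * g i x" for i x
  have h: "tbump a b h" using g bump_mult by (auto simp: tbump_def h_def[abs_def])
  have th: "tens h x = (tens g x)\<^sup>2" for x by (simp add: tens_def h_def prod.distrib power2_eq_square)
  obtain K where K: "\<And>s. 0 < s \<Longrightarrow> s < t \<Longrightarrow>
    (LBINT x. tens h x *\<^sub>R (\<Sum>i\<in>UNIV. \<Sum>j\<in>UNIV. V2 s i j x \<bullet> V2 s i j x)) \<le> K * err s"
    using energy_bound[OF h t] by blast
  obtain B where B: "\<And>x. \<bar>tens (dt i g) x\<bar> \<le> B" using tens_bounded[OF tbump_dt[OF g], of i] by blast
  let ?m = "measure lborel (cbox a b)"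
  let ?N = "norm (LBINT x. tens (dt i g) x *\<^sub>R r j x)"
  have N: "?N \<le> k / 2 * ?m" if k: "k > 0" for k
  proof (rule le_of_err_bound[OF t(1), where K="B + K / (2 * k)"])
    fix s :: real assume s: "0 < s" "s < t"
    let ?E = "\<lambda>x. tens h x *\<^sub>R (\<Sum>i\<in>UNIV. \<Sum>j\<in>UNIV. V2 s i j x \<bullet> V2 s i j x)"
    note VL = V_line[OF s(1)] and VC = V_cont[OF s(1)]
    have 1: "norm ((LBINT x. tens (dt i g) x *\<^sub>R V s j x) - (LBINT x. tens (dt i g) x *\<^sub>R r j x))
       \<le> B * (LBINT x. norm (mol s (r j) x - r j x))"
    proof (rule tens_integral_diff_le[OF tbump_dt[OF g] B])
      show "integrable lborel (\<lambda>x. tens (dt i g) x *\<^sub>R V s j x)"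
        by (rule tens_continuous_integrable[OF tbump_dt[OF g] VC(1)])
      show "integrable lborel (\<lambda>x. tens (dt i g) x *\<^sub>R r j x)"
        by (rule tens_integrand[OF tbump_dt[OF g] r_int])
      show "AE x in lborel. x \<in> cbox a b \<longrightarrow> norm (V s j x - r j x) \<le> norm (mol s (r j) x - r j x)"
        using V_eq_mol[OF s(1) _ t(2) less_imp_le[OF s(2)]] by simp
    qed (auto intro!: mol_int s)
    have Ei: "integrable lborel ?E" by (intro tens_continuous_integrable[OF h] continuous_intros VC)
    have Bi: "integrable lborel (\<lambda>x. indicator (cbox a b) x * k / 2)"
      by (intro integrable_divide integrable_mult_left integrable_real_indicator emeasure_lborel_cbox_finite) auto
    have "(LBINT x. tens (dt i g) x *\<^sub>R V s j x) = - (LBINT x. tens g x *\<^sub>R V2 s i j x)"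
      by (rule tens_integral_by_parts[OF g VL(1) VC(1) VC(2)])
    then have "norm (LBINT x. tens (dt i g) x *\<^sub>R V s j x) \<le> (LBINT x. norm (tens g x *\<^sub>R V2 s i j x))"
      using integral_norm_bound[of lborel "\<lambda>x. tens g x *\<^sub>R V2 s i j x"] by simp
    also have "\<dots> \<le> (LBINT x. indicator (cbox a b) x * k / 2 + ?E x / (2 * k))"
    proof (rule integral_mono)
      show "integrable lborel (\<lambda>x. norm (tens g x *\<^sub>R V2 s i j x))"
        by (intro integrable_norm tens_continuous_integrable[OF g] VC)
      show "integrable lborel (\<lambda>x. indicator (cbox a b) x * k / 2 + ?E x / (2 * k))"
        by (intro Bochner_Integration.integrable_add Bi integrable_divide Ei)
      fix x
      show "norm (tens g x *\<^sub>R V2 s i j x) \<le> indicator (cbox a b) x * k / 2 + ?E x / (2 * k)"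
      proof (cases "x \<in> cbox a b")
        case True
        let ?z = "norm (tens g x *\<^sub>R V2 s i j x)"
        have "V2 s i j x \<bullet> V2 s i j x \<le> (\<Sum>j\<in>UNIV. V2 s i j x \<bullet> V2 s i j x)"
          by (rule member_le_sum) auto
        also have "\<dots> \<le> (\<Sum>i\<in>UNIV. \<Sum>j\<in>UNIV. V2 s i j x \<bullet> V2 s i j x)"
          by (rule member_le_sum) (auto intro: sum_nonneg)
        finally have "(tens g x)\<^sup>2 * (V2 s i j x \<bullet> V2 s i j x) \<le> (tens g x)\<^sup>2 * (\<Sum>i\<in>UNIV. \<Sum>j\<in>UNIV. V2 s i j x \<bullet> V2 s i j x)"
          by (rule mult_left_mono) simp
        then have z: "?z\<^sup>2 \<le> ?E x" by (simp add: th power_mult_distrib dot_square_norm)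
        have "2 * k * ?z \<le> k\<^sup>2 + ?z\<^sup>2" using sum_squares_bound[of k ?z] by simp
        also have "\<dots> \<le> k\<^sup>2 + ?E x" using z by simp
        finally have "?z \<le> (k\<^sup>2 + ?E x) / (2 * k)" using k by (simp add: pos_le_divide_eq mult.commute)
        also have "\<dots> = k / 2 + ?E x / (2 * k)" using k by (simp add: add_divide_distrib power2_eq_square)
        finally show ?thesis using True by simp
      qed (use tens_zero[OF g] tens_zero[OF h] in simp)
    qed
    also have "\<dots> = k / 2 * ?m + (LBINT x. ?E x) / (2 * k)"
      using Bi integrable_divide[OF Ei, of "2 * k"] by (subst Bochner_Integration.integral_add) auto
    also have "\<dots> \<le> k / 2 * ?m + (K * err s) / (2 * k)"
      using K[OF s] k by (intro add_left_mono divide_right_mono) auto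
    finally have 2: "norm (LBINT x. tens (dt i g) x *\<^sub>R V s j x) \<le> k / 2 * ?m + (K * err s) / (2 * k)" .
    have B0: "B \<ge> 0" using B abs_ge_zero order_trans by blast
    have "?N \<le> B * (LBINT x. norm (mol s (r j) x - r j x)) + (k / 2 * ?m + (K * err s) / (2 * k))"
      using 1 2 norm_triangle_sub[of "LBINT x. tens (dt i g) x *\<^sub>R r j x" "LBINT x. tens (dt i g) x *\<^sub>R V s j x"]
      by (simp only: norm_minus_commute)
    also have "\<dots> \<le> B * err s + (k / 2 * ?m + (K * err s) / (2 * k))"
      using err_single[OF s(1)] B0 by (intro add_right_mono mult_left_mono)
    finally show "?N \<le> (B + K / (2 * k)) * err s + k / 2 * ?m" by (simp add: distrib_right)
  qed
  have "?N \<le> 0 + e" if "e > 0" for e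
  proof -
    have m0: "?m \<ge> 0" by simp
    have m1: "?m + 1 > 0" using m0 by linarith
    define q where "q = e / (?m + 1)"
    have q: "q > 0" "q * (?m + 1) = e" using that m1 by (auto simp: q_def)
    have "?N \<le> q / 2 * ?m" by (rule N[OF q(1)])
    also have "\<dots> \<le> q * (?m + 1)" using q(1) m0 by (intro mult_mono) auto
    also have "\<dots> = e" by (rule q(2))
    finally show ?thesis by simp
  qed
  then have "?N \<le> 0" by (rule field_le_epsilon)
  then show ?thesis by simp
qed

text \<open>A gradient with vanishing weak derivatives is constant; subtracting the linear map it
  defines leaves a function whose own weak derivatives vanish.\<close>

theorem rigid:
  assumes t: "0 < t" "cbox (a - vec t) (b + vec t) \<subseteq> U"
  shows "\<exists>R c. rotation_matrix R \<and>
    (AE x in lborel. x \<in> cbox a b \<longrightarrow> u x = R *v x + c \<and> (\<forall>j. r j x = R *v axis j 1))"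
proof (cases "cbox a b = {}")
  case True
  have "rotation_matrix (mat 1 :: real^3^3)" by (simp add: rotation_matrix_def orthogonal_matrix_id)
  then show ?thesis using True by auto
next
  case False
  then obtain x0 where "x0 \<in> cbox a b" by blast
  then have ab: "a $ i \<le> b $ i" for i unfolding mem_box_cart using order_trans by blast
  \<comment> \<open>The margin is used up in steps: test boxes inside \<open>?B 2\<close> keep a
    distance from the complement of \<open>U\<close>, the gradient is constant on
    \<open>?B 1\<close>, and \<open>u\<close> is affine on the original box.\<close>
  define h where "h = t / 4"
  have h: "h > 0" using t by (simp add: h_def)
  let ?B = "\<lambda>k. cbox (a - vec (k * h)) (b + vec (k * h))"
  have B4: "?B 4 \<subseteq> U" using t by (simp add: h_def)
  have mono: "?B k \<subseteq> ?B l" if "k \<le> l" for k l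
  proof -
    have "k * h \<le> l * h" using that h by (intro mult_right_mono) auto
    then have *: "y \<le> x + k * h \<Longrightarrow> y \<le> x + l * h" for x y :: real by auto
    show ?thesis by (auto simp: subset_iff mem_box_cart diff_le_eq intro: *)
  qed
  have w0: "wpart (?B 2) i (r j) (\<lambda>_. 0)" for i j
    unfolding wpart_def
  proof (intro conjI allI impI)
    fix p q g assume pq: "cbox p q \<subseteq> ?B 2" and g: "tbump p q g"
    have "(LBINT x. tens (dt i g) x *\<^sub>R r j x) = 0"
    proof (cases "cbox p q = {}")
      case True
      then show ?thesis using tens_zero[OF tbump_dt[OF g]] by simp
    next
      case False
      then obtain y0 where "y0 \<in> cbox p q" by blast
      then have "p $ i \<le> q $ i" for i unfolding mem_box_cart using order_trans by blast
      then have "p \<in> cbox p q" "q \<in> cbox p q" by (auto simp: mem_box_cart)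
      then have "p \<in> ?B 2" "q \<in> ?B 2" using pq by blast+
      then have p: "a $ i - 2 * h \<le> p $ i" "q $ i \<le> b $ i + 2 * h" for i by (auto simp: mem_box_cart)
      have "cbox (p - vec h) (q + vec h) \<subseteq> ?B 4"
      proof
        fix y assume "y \<in> cbox (p - vec h) (q + vec h)"
        then have y: "p $ i - h \<le> y $ i" "y $ i \<le> q $ i + h" for i by (auto simp: mem_box_cart)
        have "a $ i - 4 * h \<le> y $ i" "y $ i \<le> b $ i + 4 * h" for i using y[of i] p[of i] h by linarith+
        then show "y \<in> ?B 4" by (simp add: mem_box_cart)
      qed
      then show ?thesis using gradient_weak_deriv_zero[OF g h, of i j] B4 by blast
    qed
    then show "(LBINT x. tens (dt i g) x *\<^sub>R r j x) = - (LBINT x. tens g x *\<^sub>R 0)" by simp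
  qed (auto simp: r_int)
  have "cbox ((a - vec (1 * h)) - vec h) ((b + vec (1 * h)) + vec h) \<subseteq> ?B 2"
    by (auto simp: subset_iff mem_box_cart algebra_simps)
  then have "\<forall>j. \<exists>c. AE x in lborel. x \<in> ?B 1 \<longrightarrow> r j x = c"
    using wpart_zero_imp_const[OF w0 h] by blast
  from choice[OF this] obtain c where "\<forall>j. AE x in lborel. x \<in> ?B 1 \<longrightarrow> r j x = c j" by blast
  then have c: "AE x in lborel. \<forall>j. x \<in> ?B 1 \<longrightarrow> r j x = c j" by (subst AE_all_countable)
  define R where "R = ((\<chi> i j. c j $ i) :: real^3^3)"
  have Rc: "R *v axis j 1 = c j" for j
    unfolding matrix_vector_mult_basis by (simp add: R_def column_def vec_eq_iff)
  \<comment> \<open>The constant matrix agrees with a rotation almost everywhere on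
    \<open>?B 1\<close>, which has positive measure because h > 0, even when the original box is
    degenerate.\<close>
  have RR: "rotation_matrix R"
  proof (rule ccontr)
    assume nR: "\<not> rotation_matrix R"
    have "AE x in lborel. x \<notin> ?B 1"
      using c rot
    proof eventually_elim
      case (elim x)
      show ?case
      proof
        assume x: "x \<in> ?B 1"
        then have "x \<in> U" using mono[of 1 4] B4 by auto
        moreover have "r j x = c j" for j using elim x by blast
        ultimately have "rotation_matrix R" using elim(2) by (simp add: R_def)
        then show False using nR by simp
      qed
    qed
    then have "?B 1 \<in> null_sets lborel" by (subst AE_iff_null_sets) auto
    then have "negligible (?B 1)" by (simp add: negligible_iff_null_sets null_sets_completionI)
    then have "negligible (box (a - vec (1 * h)) (b + vec (1 * h)))"
      using box_subset_cbox negligible_subset by blast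
    then have "box (a - vec (1 * h)) (b + vec (1 * h)) = {}"
      using open_not_negligible open_box by blast
    moreover have "a $ i - 1 * h < b $ i + 1 * h" for i using ab[of i] h by linarith
    then have "box (a - vec (1 * h)) (b + vec (1 * h)) \<noteq> {}"
      by (auto simp: interval_eq_empty_cart not_le)
    ultimately show False by simp
  qed
  \<comment> \<open>The linear map is cut off to be integrable on the whole space; tests with boxes
    in \<open>?B 1\<close> do not see the cut.\<close>
  define f where "f x = u x - indicator (?B 1) x *\<^sub>R (R *v x)" for x
  have Rcont: "continuous_on UNIV (\<lambda>x. R *v x)" by (intro linear_continuous_on matrix_vector_mul_bounded_linear)
  have Rint: "integrable lborel (\<lambda>x. indicator (?B 1) x *\<^sub>R (R *v x))"
    by (intro borel_integrable_compact compact_cbox continuous_on_subset[OF Rcont]) auto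
  have wf: "wpart (?B 1) i f (\<lambda>_. 0)" for i
    unfolding wpart_def
  proof (intro conjI allI impI)
    show "integrable lborel f" unfolding f_def using u_int Rint by auto
    fix p q g assume pq: "cbox p q \<subseteq> ?B 1" and g: "tbump p q g"
    have "cbox p q \<subseteq> U" using pq mono[of 1 4] B4 by auto
    then have "(LBINT x. tens (dt i g) x *\<^sub>R u x) = - (LBINT x. tens g x *\<^sub>R r i x)"
      using w[of i] g unfolding wpart_def by blast
    also have "(LBINT x. tens g x *\<^sub>R r i x) = (LBINT x. tens g x *\<^sub>R (R *v axis i 1))"
    proof (rule integral_cong_AE)
      show "AE x in lborel. tens g x *\<^sub>R r i x = tens g x *\<^sub>R (R *v axis i 1)"
        using c
      proof eventually_elim
        case (elim x)
        then show ?case using pq tens_zero[OF g, of x] Rc by (cases "x \<in> cbox p q") auto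
      qed
    qed (use tens_measurable[OF g] r_int in auto)
    also have "- (LBINT x. tens g x *\<^sub>R (R *v axis i 1)) = (LBINT x. tens (dt i g) x *\<^sub>R (R *v x))"
      by (rule tens_integral_by_parts[OF g _ Rcont, symmetric])
         (auto intro: line_deriv_linear matrix_vector_mul_bounded_linear)
    also have "\<dots> = (LBINT x. tens (dt i g) x *\<^sub>R (indicator (?B 1) x *\<^sub>R (R *v x)))"
    proof (rule Bochner_Integration.integral_cong[OF refl])
      fix x
      show "tens (dt i g) x *\<^sub>R (R *v x) = tens (dt i g) x *\<^sub>R (indicator (?B 1) x *\<^sub>R (R *v x))"
        using pq tens_zero[OF tbump_dt[OF g], of x] by (cases "x \<in> cbox p q") (auto simp: subset_iff)
    qed
    finally show "(LBINT x. tens (dt i g) x *\<^sub>R f x) = - (LBINT x. tens g x *\<^sub>R 0)"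
      unfolding f_def scaleR_diff_right
      using tens_integrand[OF tbump_dt[OF g] u_int] tens_integrand[OF tbump_dt[OF g] Rint] by simp
  qed auto
  obtain v where v: "AE x in lborel. x \<in> cbox a b \<longrightarrow> f x = v"
    using wpart_zero_imp_const[OF wf h, of a b] by auto
  have "AE x in lborel. x \<in> cbox a b \<longrightarrow> u x = R *v x + v \<and> (\<forall>j. r j x = R *v axis j 1)"
    using v c
  proof eventually_elim
    case (elim x)
    show ?case
    proof
      assume x: "x \<in> cbox a b"
      have "a - vec (0 * h) = a" "b + vec (0 * h) = b" by (simp_all add: vec_eq_iff)
      then have "x \<in> ?B 1" using mono[of 0 1] x by auto
      then show "u x = R *v x + v \<and> (\<forall>j. r j x = R *v axis j 1)"
        using elim x Rc by (auto simp: f_def)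
    qed
  qed
  then show ?thesis using RR by blast
qed

end

subsection \<open>Comparison with a nearby fiber\<close>

definition tri :: "(real \<Rightarrow> real) \<Rightarrow> (real \<Rightarrow> real) \<Rightarrow> (real \<Rightarrow> real) \<Rightarrow> 3 \<Rightarrow> real \<Rightarrow> real" where
  "tri f1 f2 f3 = (\<lambda>i. if i = 1 then f1 else if i = 2 then f2 else f3)"

lemma tens_tri: "tens (tri f1 f2 f3) y = f1 (y $ 1) * f2 (y $ 2) * f3 (y $ 3)"
  unfolding tens_def UNIV_3 by (simp add: tri_def)

lemma tbump_tri:
  "bump (a $ 1) (b $ 1) f1 \<Longrightarrow> bump (a $ 2) (b $ 2) f2 \<Longrightarrow> bump (a $ 3) (b $ 3) f3 \<Longrightarrow> tbump a b (tri f1 f2 f3)"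
  unfolding tbump_def forall_3 by (simp add: tri_def)

lemma dt_tri: "dt 1 (tri f1 f2 f3) = tri (deriv f1) f2 f3" "dt 2 (tri f1 f2 f3) = tri f1 (deriv f2) f3"
  "dt 3 (tri f1 f2 f3) = tri f1 f2 (deriv f3)"
  by (simp_all add: dt_def tri_def fun_eq_iff forall_3)

definition tint :: "(real \<Rightarrow> real) \<Rightarrow> (real \<Rightarrow> real) \<Rightarrow> (real \<Rightarrow> real) \<Rightarrow> (real^3 \<Rightarrow> 'b::euclidean_space) \<Rightarrow> 'b" where
  "tint f1 f2 f3 f = (LBINT y. tens (tri f1 f2 f3) y *\<^sub>R f y)"

text \<open>Both \<open>B\<^sub>1 \<otimes> B\<^sub>2\<close> and its mass times \<open>\<sigma>\<^sub>1 \<otimes> \<sigma>\<^sub>2\<close> have the same integral, so that their difference is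
  the divergence of a compactly supported field, which is explicit for tensor products.\<close>

lemma tint_replace:
  fixes f g1 g2 :: "real^3 \<Rightarrow> 'b::euclidean_space"
  assumes w: "wpart U 1 f g1" "wpart U 2 f g2" and box: "cbox a b \<subseteq> U"
    and B: "bump (a $ 1) (b $ 1) B1" "bump (a $ 2) (b $ 2) B2"
    and S: "bump (a $ 1) (b $ 1) S1" "bump (a $ 2) (b $ 2) S2" "\<And>t. S1 t \<ge> 0" "\<And>t. S2 t \<ge> 0"
       "integral\<^sup>L lborel S1 = 1" "integral\<^sup>L lborel S2 = 1"
    and c: "bump (a $ 3) (b $ 3) c"
  shows "\<exists>Q1 Q2. bump (a $ 1) (b $ 1) Q1 \<and> bump (a $ 2) (b $ 2) Q2 \<and>
    (\<forall>t. \<bar>Q1 t\<bar> \<le> 2 * (LBINT t. \<bar>B1 t\<bar>)) \<and> (\<forall>t. \<bar>Q2 t\<bar> \<le> 2 * (LBINT t. \<bar>B2 t\<bar>)) \<and>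
    tint B1 B2 c f = (integral\<^sup>L lborel B1 * integral\<^sup>L lborel B2) *\<^sub>R tint S1 S2 c f
      - tint Q1 B2 c g1 - integral\<^sup>L lborel B1 *\<^sub>R tint S1 Q2 c g2"
proof -
  define m1 where "m1 = integral\<^sup>L lborel B1"
  define m2 where "m2 = integral\<^sup>L lborel B2"
  have f: "integrable lborel f" using w unfolding wpart_def by blast
  have ex: "\<exists>Q. bump p q Q \<and> deriv Q = (\<lambda>t. B t - integral\<^sup>L lborel B * S t) \<and> (\<forall>t. \<bar>Q t\<bar> \<le> 2 * (LBINT t. \<bar>B t\<bar>))"
    if B: "bump p q B" and S: "bump p q S" "\<And>t. S t \<ge> 0" "integral\<^sup>L lborel S = 1" for p q B S
  proof -
    let ?m = "integral\<^sup>L lborel B"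
    have b: "bump p q (\<lambda>t. B t - ?m * S t)" by (intro bump_diff bump_cmult B S)
    note iB = bump_integrable[OF B] and iS = bump_integrable[OF S(1)]
    have "(LBINT t. B t - ?m * S t) = 0"
      using iB iS S(3) by simp
    from bump_antideriv[OF b this] obtain Q where Q: "bump p q Q" "deriv Q = (\<lambda>t. B t - ?m * S t)"
       "\<And>t. \<bar>Q t\<bar> \<le> (LBINT t. \<bar>B t - ?m * S t\<bar>)" by metis
    have m: "\<bar>?m\<bar> \<le> (LBINT t. \<bar>B t\<bar>)" using integral_norm_bound[of lborel B] by simp
    have "(LBINT t. \<bar>B t - ?m * S t\<bar>) \<le> (LBINT t. \<bar>B t\<bar> + \<bar>?m\<bar> * S t)"
    proof (rule integral_mono)
      show "\<bar>B t - ?m * S t\<bar> \<le> \<bar>B t\<bar> + \<bar>?m\<bar> * S t" for t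
        using abs_triangle_ineq4[of "B t" "?m * S t"] S(2)[of t] by (simp add: abs_mult)
    qed (use iB iS bump_integrable[OF b] in auto)
    also have "\<dots> = (LBINT t. \<bar>B t\<bar>) + \<bar>?m\<bar>" using iB iS S(3) by simp
    also have "\<dots> \<le> 2 * (LBINT t. \<bar>B t\<bar>)" using m by simp
    finally show ?thesis using Q order_trans by blast
  qed
  \<comment> \<open>The variables are exchanged in turn, from \<open>B1\<close>, \<open>B2\<close>
    via \<open>S1\<close>, \<open>B2\<close> to \<open>S1\<close>, \<open>S2\<close>. The remainders
    carry \<open>Q1\<close>, \<open>B2\<close> and \<open>S1\<close>, \<open>Q2\<close>, so that
    \<open>S2\<close> occurs in neither of them.\<close>
  obtain Q1 where Q1: "bump (a $ 1) (b $ 1) Q1" "deriv Q1 = (\<lambda>t. B1 t - m1 * S1 t)" "\<And>t. \<bar>Q1 t\<bar> \<le> 2 * (LBINT t. \<bar>B1 t\<bar>)"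
    using ex[OF B(1) S(1,3,5)] unfolding m1_def by blast
  obtain Q2 where Q2: "bump (a $ 2) (b $ 2) Q2" "deriv Q2 = (\<lambda>t. B2 t - m2 * S2 t)" "\<And>t. \<bar>Q2 t\<bar> \<le> 2 * (LBINT t. \<bar>B2 t\<bar>)"
    using ex[OF B(2) S(2,4,6)] unfolding m2_def by blast
  have t: "tbump a b (tri Q1 B2 c)" "tbump a b (tri S1 Q2 c)" by (intro tbump_tri Q1 Q2 B S c)+
  have 1: "tint (deriv Q1) B2 c f = - tint Q1 B2 c g1" "tint S1 (deriv Q2) c f = - tint S1 Q2 c g2"
    using w box t unfolding wpart_def tint_def dt_tri[symmetric] by blast+
  have ti: "integrable lborel (\<lambda>y. tens (tri B1 B2 c) y *\<^sub>R f y)" "integrable lborel (\<lambda>y. tens (tri S1 B2 c) y *\<^sub>R f y)"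
     "integrable lborel (\<lambda>y. tens (tri S1 S2 c) y *\<^sub>R f y)"
    by (rule tens_integrand[OF tbump_tri f], (rule B S c)+)+
  have "tint (deriv Q1) B2 c f = tint B1 B2 c f - m1 *\<^sub>R tint S1 B2 c f"
  proof -
    have "tint (deriv Q1) B2 c f = (LBINT y. tens (tri B1 B2 c) y *\<^sub>R f y - m1 *\<^sub>R (tens (tri S1 B2 c) y *\<^sub>R f y))"
      unfolding tint_def Q1 tens_tri by (rule Bochner_Integration.integral_cong) (auto simp: algebra_simps)
    then show ?thesis unfolding tint_def using ti by (simp del: scaleR_scaleR)
  qed
  moreover have "tint S1 (deriv Q2) c f = tint S1 B2 c f - m2 *\<^sub>R tint S1 S2 c f"
  proof -
    have "tint S1 (deriv Q2) c f = (LBINT y. tens (tri S1 B2 c) y *\<^sub>R f y - m2 *\<^sub>R (tens (tri S1 S2 c) y *\<^sub>R f y))"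
      unfolding tint_def Q2 tens_tri by (rule Bochner_Integration.integral_cong) (auto simp: algebra_simps)
    then show ?thesis unfolding tint_def using ti by (simp del: scaleR_scaleR)
  qed
  ultimately have "tint B1 B2 c f = m1 *\<^sub>R (tint S1 (deriv Q2) c f + m2 *\<^sub>R tint S1 S2 c f) + tint (deriv Q1) B2 c f" by simp
  also have "\<dots> = (m1 * m2) *\<^sub>R tint S1 S2 c f - tint Q1 B2 c g1 - m1 *\<^sub>R tint S1 Q2 c g2"
    unfolding 1 by (simp add: algebra_simps)
  finally show ?thesis using Q1(1,3) Q2(1,3) unfolding m1_def m2_def by blast
qed

text \<open>One point x, mollified at scale s, and one fiber through c whose gradient is the
  constant R on a square of half-width d and over the height of the mollifier. The distance
  condition places that square inside the box in which kernels may be exchanged.\<close>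

locale near_fiber =
  fixes \<Omega> :: "(real^3) set" and u :: "real^3 \<Rightarrow> real^3" and r :: "3 \<Rightarrow> real^3 \<Rightarrow> real^3"
    and h :: "3 \<Rightarrow> 3 \<Rightarrow> real^3 \<Rightarrow> real^3" and x c :: "real^3" and s d C :: real and R :: "real^3^3"
  assumes w: "wpart \<Omega> j u (r j)"
    and hw: "i \<in> {1, 2} \<Longrightarrow> j \<in> {1, 2} \<Longrightarrow> wpart \<Omega> i (r j) (h i j)"
    and s: "0 < s" and d: "0 < d" and box: "cbox (x - vec (2 * s)) (x + vec (2 * s)) \<subseteq> \<Omega>"
    and c: "\<bar>c $ 1 - x $ 1\<bar> + d \<le> 2 * s" "\<bar>c $ 2 - x $ 2\<bar> + d \<le> 2 * s"
    and fib: "AE y in lborel. \<bar>y $ 1 - c $ 1\<bar> \<le> d \<longrightarrow> \<bar>y $ 2 - c $ 2\<bar> \<le> d \<longrightarrow> \<bar>y $ 3 - x $ 3\<bar> \<le> s \<longrightarrow>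
        (\<forall>j. r j y = R *v axis j 1)"
    and C: "0 < C" "\<And>s t. 0 < s \<Longrightarrow> moll s t \<le> C / s" "\<And>s t. 0 < s \<Longrightarrow> \<bar>deriv (moll s) t\<bar> \<le> C / s\<^sup>2"
begin

definition A :: "3 \<Rightarrow> real \<Rightarrow> real" where "A i t = moll s (x $ i - t)"
definition S :: "3 \<Rightarrow> real \<Rightarrow> real" where "S i t = moll d (c $ i - t)"
definition H :: "real^3 \<Rightarrow> real" where "H y = (\<Sum>i\<in>{1,2}. \<Sum>j\<in>{1,2}. norm (h i j y))"
text \<open>The common majorant of all remainders: 1/s^2 is the size of products without a
  concentrated factor, and \<open>S 1\<close> / s that of the products that retain
  \<open>S 1\<close>.\<close>

definition \<Phi> :: "real^3 \<Rightarrow> real" where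
  "\<Phi> y = indicator (cbox (x - vec (2 * s)) (x + vec (2 * s))) y * (1 / s\<^sup>2 + S 1 (y $ 1) / s) * H y"

abbreviation "lo \<equiv> x - vec (2 * s)"
abbreviation "hi \<equiv> x + vec (2 * s)"

lemma A_bump0: "bump (x $ i - s) (x $ i + s) (A i)"
  using bump_reflect[OF moll_bump[OF s], of "x $ i"] by (simp add: A_def[abs_def])

lemma A_bump: "bump (lo $ i) (hi $ i) (A i)"
  by (rule bump_mono[OF A_bump0]) (use s in auto)

lemma S_bump0: "bump (c $ i - d) (c $ i + d) (S i)"
  using bump_reflect[OF moll_bump[OF d], of "c $ i"] by (simp add: S_def[abs_def])

lemma S_bump: "bump (lo $ 1) (hi $ 1) (S 1)" "bump (lo $ 2) (hi $ 2) (S 2)"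
  by (rule bump_mono[OF S_bump0]; use c in \<open>auto simp: abs_if split: if_splits\<close>)+

lemma moll_reflect_integral: "0 < s' \<Longrightarrow> (LBINT t. moll s' (z - t)) = 1"
  using lborel_integral_real_affine[of "-1" "moll s'" z] moll_integral[of s'] by simp

lemma A_props: "A i t \<ge> 0" "integral\<^sup>L lborel (A i) = 1" "A i t \<le> C / s" "\<bar>deriv (A i) t\<bar> \<le> C / s\<^sup>2"
  using moll_nonneg[OF s] moll_reflect_integral[OF s] C(2,3)[OF s] deriv_reflect[OF moll_bump[OF s]]
  by (auto simp: A_def[abs_def])

lemma S_props: "S i t \<ge> 0" "integral\<^sup>L lborel (S i) = 1"
  using moll_nonneg[OF d] moll_reflect_integral[OF d] by (auto simp: S_def[abs_def])

lemma mol_eq_tint: "mol s f x = tint (A 1) (A 2) (A 3) f"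
  unfolding tconv_def tint_def tens_tri unfolding tens_def UNIV_3 by (simp add: A_def mult.assoc)

lemma H_int: "integrable lborel H"
  unfolding H_def[abs_def] using hw by (auto simp: wpart_def)

lemma H_ge: "i \<in> {1,2} \<Longrightarrow> j \<in> {1,2} \<Longrightarrow> norm (h i j y) \<le> H y"
  unfolding H_def by (auto simp: add_nonneg_nonneg)

lemma H_nonneg: "H y \<ge> 0" unfolding H_def by (intro sum_nonneg) auto

lemma \<Phi>_int: "integrable lborel \<Phi>"
proof -
  obtain K where K: "K > 0" "\<And>t. \<bar>S 1 t\<bar> \<le> K" using bump_bounded[OF S_bump(1)] by blast
  have [measurable]: "S 1 \<in> borel_measurable borel" by (rule bump_measurable[OF S_bump(1)])
  have "integrable lborel (\<lambda>y. (indicator (cbox lo hi) y * (1 / s\<^sup>2 + S 1 (y $ 1) / s)) *\<^sub>R H y)"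
  proof (rule bounded_scaleR_integrable[OF H_int])
    show "\<bar>indicator (cbox lo hi) y * (1 / s\<^sup>2 + S 1 (y $ 1) / s)\<bar> \<le> 1 / s\<^sup>2 + K / s" for y
    proof -
      have "1 / s\<^sup>2 + S 1 (y $ 1) / s \<le> 1 / s\<^sup>2 + K / s" "0 \<le> 1 / s\<^sup>2 + S 1 (y $ 1) / s"
        using K(2)[of "y $ 1"] S_props(1)[of 1 "y $ 1"] s by (auto intro!: divide_right_mono add_nonneg_nonneg)
      then show ?thesis using K s by (auto simp: indicator_def intro!: add_nonneg_nonneg)
    qed
  qed measurable
  then show ?thesis by (simp add: \<Phi>_def[abs_def])
qed

lemma \<Phi>_nonneg: "\<Phi> y \<ge> 0"
  unfolding \<Phi>_def using H_nonneg S_props(1) s by (intro mult_nonneg_nonneg add_nonneg_nonneg) auto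

lemma tint_le:
  assumes f: "bump (lo $ 1) (hi $ 1) f1" "bump (lo $ 2) (hi $ 2) f2" "bump (lo $ 3) (hi $ 3) f3"
    and ij: "i \<in> {1,2}" "j \<in> {1,2}" and K: "K \<ge> 0"
    and le: "\<And>t1 t2 t3. \<bar>f1 t1\<bar> * \<bar>f2 t2\<bar> * \<bar>f3 t3\<bar> \<le> K * (1 / s\<^sup>2 + S 1 t1 / s)"
  shows "norm (tint f1 f2 f3 (h i j)) \<le> K * integral\<^sup>L lborel \<Phi>"
proof -
  have t: "tbump lo hi (tri f1 f2 f3)" by (intro tbump_tri f)
  have hi: "integrable lborel (h i j)" using hw[OF ij] unfolding wpart_def by blast
  note ti = tens_integrand[OF t hi]
  have "norm (tint f1 f2 f3 (h i j)) \<le> (LBINT y. norm (tens (tri f1 f2 f3) y *\<^sub>R h i j y))"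
    unfolding tint_def by (rule integral_norm_bound)
  also have "\<dots> \<le> (LBINT y. K * \<Phi> y)"
  proof (rule integral_mono)
    fix y
    show "norm (tens (tri f1 f2 f3) y *\<^sub>R h i j y) \<le> K * \<Phi> y"
    proof (cases "y \<in> cbox lo hi")
      case True
      have "norm (tens (tri f1 f2 f3) y *\<^sub>R h i j y) = (\<bar>f1 (y $ 1)\<bar> * \<bar>f2 (y $ 2)\<bar> * \<bar>f3 (y $ 3)\<bar>) * norm (h i j y)"
        by (simp add: tens_tri abs_mult)
      also have "\<dots> \<le> (K * (1 / s\<^sup>2 + S 1 (y $ 1) / s)) * H y"
        using K S_props(1) s
        by (intro mult_mono[OF le H_ge[OF ij]] mult_nonneg_nonneg add_nonneg_nonneg) auto
      also have "\<dots> = K * \<Phi> y" using True by (simp add: \<Phi>_def)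
      finally show ?thesis .
    next
      case False
      then show ?thesis using tens_zero[OF t False] \<Phi>_nonneg K by simp
    qed
  qed (use integrable_norm[OF ti] \<Phi>_int in auto)
  finally show ?thesis by simp
qed

text \<open>The kernel lives where the gradient equals R, so that only its mass is left: 1 when
  \<open>f3\<close> is \<open>A 3\<close>, and 0 when it is the derivative of
  \<open>A 3\<close>.\<close>

lemma tint_fiber:
  assumes f3: "bump (x $ 3 - s) (x $ 3 + s) f3"
  shows "tint (S 1) (S 2) f3 (r j) = integral\<^sup>L lborel f3 *\<^sub>R (R *v axis j 1)"
proof -
  let ?a = "(\<chi> i. if i = 3 then x $ 3 - s else c $ i - d) :: real^3"
  let ?b = "(\<chi> i. if i = 3 then x $ 3 + s else c $ i + d) :: real^3"
  have t: "tbump ?a ?b (tri (S 1) (S 2) f3)"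
    using S_bump0[of 1] S_bump0[of 2] f3 by (intro tbump_tri) auto
  have ri: "integrable lborel (r j)" using w[of j] unfolding wpart_def by blast
  have "tint (S 1) (S 2) f3 (r j) = (LBINT y. tens (tri (S 1) (S 2) f3) y *\<^sub>R (R *v axis j 1))"
    unfolding tint_def
  proof (rule integral_cong_AE)
    show "AE y in lborel. tens (tri (S 1) (S 2) f3) y *\<^sub>R r j y = tens (tri (S 1) (S 2) f3) y *\<^sub>R (R *v axis j 1)"
      using fib
    proof eventually_elim
      case (elim y)
      show ?case
      proof (cases "y \<in> cbox ?a ?b")
        case True
        then have "\<bar>y $ 1 - c $ 1\<bar> \<le> d" "\<bar>y $ 2 - c $ 2\<bar> \<le> d" "\<bar>y $ 3 - x $ 3\<bar> \<le> s"
          by (auto simp: mem_box_cart forall_3 abs_le_iff)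
        then show ?thesis using elim by simp
      next
        case False
        then show ?thesis using tens_zero[OF t False] by simp
      qed
    qed
  qed (use tens_measurable[OF t] ri in auto)
  also have "\<dots> = (LBINT y. tens (tri (S 1) (S 2) f3) y) *\<^sub>R (R *v axis j 1)"
    using tens_integrable[OF t] by (intro integral_scaleR_left) auto
  also have "(LBINT y. tens (tri (S 1) (S 2) f3) y) = integral\<^sup>L lborel f3"
    using tens_integral[OF t] S_props(2) unfolding UNIV_3 by (simp add: tri_def)
  finally show ?thesis .
qed

text \<open>A convenient majorant of the multiples of C^2 + C that arise; the largest demand is 16
  C^2 + 16 C for one half of \<open>K0\<close>, in the estimate of the third column.\<close>

definition K0 :: real where "K0 = 64 * (C + 1)\<^sup>2"

lemma K0: "K0 \<ge> 64 * C\<^sup>2" "K0 \<ge> 64 * C" "K0 \<ge> 0"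
proof -
  have "(C + 1)\<^sup>2 = C\<^sup>2 + 2 * C + 1" by (simp add: power2_sum)
  then show "K0 \<ge> 64 * C\<^sup>2" "K0 \<ge> 64 * C" "K0 \<ge> 0" unfolding K0_def using C(1) by (auto simp: add_nonneg_nonneg)
qed

lemma kernel_flat:
  assumes "\<bar>f1\<bar> \<le> a1" "\<bar>f2\<bar> \<le> a2" "\<bar>f3\<bar> \<le> a3" "a1 * a2 * a3 \<le> K / s\<^sup>2" "K \<ge> 0"
  shows "\<bar>f1\<bar> * \<bar>f2\<bar> * \<bar>f3\<bar> \<le> K * (1 / s\<^sup>2 + S 1 t / s)"
proof -
  have "\<bar>f1\<bar> * \<bar>f2\<bar> * \<bar>f3\<bar> \<le> a1 * a2 * a3" using assms by (intro mult_mono mult_nonneg_nonneg) auto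
  also have "\<dots> \<le> K * (1 / s\<^sup>2)" using assms by simp
  also have "\<dots> \<le> K * (1 / s\<^sup>2 + S 1 t / s)" using S_props(1)[of 1 t] s assms(5) by (intro mult_left_mono) auto
  finally show ?thesis .
qed

lemma kernel_fiber:
  assumes "\<bar>f2\<bar> \<le> a2" "\<bar>f3\<bar> \<le> a3" "a2 * a3 \<le> K / s" "K \<ge> 0"
  shows "\<bar>S 1 t\<bar> * \<bar>f2\<bar> * \<bar>f3\<bar> \<le> K * (1 / s\<^sup>2 + S 1 t / s)"
proof -
  have "\<bar>S 1 t\<bar> * \<bar>f2\<bar> * \<bar>f3\<bar> = S 1 t * (\<bar>f2\<bar> * \<bar>f3\<bar>)" using S_props(1)[of 1 t] by simp
  also have "\<dots> \<le> S 1 t * (a2 * a3)" using assms S_props(1)[of 1 t] by (intro mult_left_mono mult_mono) auto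
  also have "\<dots> \<le> S 1 t * (K / s)" using assms S_props(1)[of 1 t] by (intro mult_left_mono)
  also have "\<dots> = K * (S 1 t / s)" by simp
  also have "\<dots> \<le> K * (1 / s\<^sup>2 + S 1 t / s)" using s assms(4) by (intro mult_left_mono) auto
  finally show ?thesis .
qed

lemma tint_flat:
  assumes f: "bump (lo $ 1) (hi $ 1) f1" "bump (lo $ 2) (hi $ 2) f2" "bump (lo $ 3) (hi $ 3) f3"
    and ij: "i \<in> {1,2}" "j \<in> {1,2}"
    and le: "\<And>t. \<bar>f1 t\<bar> \<le> a1" "\<And>t. \<bar>f2 t\<bar> \<le> a2" "\<And>t. \<bar>f3 t\<bar> \<le> a3" "a1 * a2 * a3 \<le> K / s\<^sup>2" "K \<ge> 0"
  shows "norm (tint f1 f2 f3 (h i j)) \<le> K * integral\<^sup>L lborel \<Phi>"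
  by (rule tint_le[OF f ij le(5)]) (rule kernel_flat[OF le])

lemma tint_on_fiber:
  assumes f: "bump (lo $ 2) (hi $ 2) f2" "bump (lo $ 3) (hi $ 3) f3"
    and ij: "i \<in> {1,2}" "j \<in> {1,2}"
    and le: "\<And>t. \<bar>f2 t\<bar> \<le> a2" "\<And>t. \<bar>f3 t\<bar> \<le> a3" "a2 * a3 \<le> K / s" "K \<ge> 0"
  shows "norm (tint (S 1) f2 f3 (h i j)) \<le> K * integral\<^sup>L lborel \<Phi>"
  by (rule tint_le[OF S_bump(1) f ij le(4)]) (rule kernel_fiber[OF le])

lemma A_abs: "\<bar>A i t\<bar> \<le> C / s" "(LBINT t. \<bar>A i t\<bar>) = 1"
  using A_props(1)[of i] A_props(2,3)[of i] by auto

lemma S_abs: "(LBINT t. \<bar>S i t\<bar>) = 1"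
  using S_props(1)[of i] S_props(2)[of i] by auto

lemma bump_abs_integral_le:
  assumes b: "bump p q f" "p \<le> q" "\<And>t. \<bar>f t\<bar> \<le> B" shows "(LBINT t. \<bar>f t\<bar>) \<le> B * (q - p)"
proof -
  have "(LBINT t. \<bar>f t\<bar>) \<le> (LBINT t. B * indicator {p..q} t)"
    using bump_integrable[OF b(1)] b
    by (intro integral_mono integrable_abs integrable_mult_right integrable_real_indicator) (auto simp: bump_def indicator_def)
  also have "\<dots> = B * (q - p)" using b(2) by simp
  finally show ?thesis .
qed

text \<open>All kernels have mass 1, so that the exchange turns the mollification into the value on
  the fiber. The remainders involve horizontal derivatives of a horizontal derivative, which are
  controlled, with kernels of size 2 (C/s)^2 and 2 (C/s) \<open>S 1\<close>.\<close>

lemma column12_estimate: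
  assumes j: "j \<in> {1,2}"
  shows "norm (mol s (r j) x - R *v axis j 1) \<le> K0 * integral\<^sup>L lborel \<Phi>"
proof -
  have "(1::3) \<in> {1,2}" "(2::3) \<in> {1,2}" by auto
  note w12 = hw[OF this(1) j] hw[OF this(2) j]
  obtain Q1 Q2 where Q: "bump (lo $ 1) (hi $ 1) Q1" "bump (lo $ 2) (hi $ 2) Q2"
    "\<And>t. \<bar>Q1 t\<bar> \<le> 2 * (LBINT t. \<bar>A 1 t\<bar>)" "\<And>t. \<bar>Q2 t\<bar> \<le> 2 * (LBINT t. \<bar>A 2 t\<bar>)"
    and eq: "tint (A 1) (A 2) (A 3) (r j) = (integral\<^sup>L lborel (A 1) * integral\<^sup>L lborel (A 2)) *\<^sub>R tint (S 1) (S 2) (A 3) (r j)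
      - tint Q1 (A 2) (A 3) (h 1 j) - integral\<^sup>L lborel (A 1) *\<^sub>R tint (S 1) Q2 (A 3) (h 2 j)"
    using tint_replace[OF w12 box A_bump A_bump S_bump S_props(1) S_props(1) S_props(2) S_props(2) A_bump] by blast
  have Q2: "\<bar>Q1 t\<bar> \<le> 2" "\<bar>Q2 t\<bar> \<le> 2" for t using Q(3,4)[of t] A_abs(2) by auto
  have e1: "norm (tint Q1 (A 2) (A 3) (h 1 j)) \<le> (2 * C\<^sup>2) * integral\<^sup>L lborel \<Phi>"
    by (rule tint_flat[OF Q(1) A_bump A_bump _ j Q2(1) A_abs(1) A_abs(1)]) (auto simp: power2_eq_square)
  have e2: "norm (tint (S 1) Q2 (A 3) (h 2 j)) \<le> (2 * C) * integral\<^sup>L lborel \<Phi>"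
    by (rule tint_on_fiber[OF Q(2) A_bump _ j Q2(2) A_abs(1)]) (use C(1) in auto)
  have "mol s (r j) x - R *v axis j 1 = - (tint Q1 (A 2) (A 3) (h 1 j) + tint (S 1) Q2 (A 3) (h 2 j))"
    unfolding mol_eq_tint eq tint_fiber[OF A_bump0] A_props(2) by simp
  also have "norm \<dots> \<le> (2 * C\<^sup>2) * integral\<^sup>L lborel \<Phi> + (2 * C) * integral\<^sup>L lborel \<Phi>"
    unfolding norm_minus_cancel by (rule order_trans[OF norm_triangle_ineq add_mono[OF e1 e2]])
  also have "\<dots> = (2 * C\<^sup>2 + 2 * C) * integral\<^sup>L lborel \<Phi>" by (simp add: distrib_right)
  also have "\<dots> \<le> K0 * integral\<^sup>L lborel \<Phi>"
    using K0 C(1) by (intro mult_right_mono Bochner_Integration.integral_nonneg[OF \<Phi>_nonneg]) auto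
  finally show ?thesis .
qed

text \<open>The derivative of \<open>u\<close> in direction \<open>3\<close> is not controlled by the second derivatives. Integration by
  parts moves it to the vertical factor \<open>A 3\<close>, and \<open>deriv (A 3)\<close> has mean zero, so that the constant
  gradient on the fiber does not contribute.\<close>

lemma column3_estimate: "norm (mol s (r 3) x - R *v axis 3 1) \<le> K0 * integral\<^sup>L lborel \<Phi>"
proof -
  let ?A' = "deriv (A 3)" and ?I = "integral\<^sup>L lborel \<Phi>"
  have A'b: "bump (lo $ 3) (hi $ 3) ?A'" "bump (x $ 3 - s) (x $ 3 + s) ?A'"
    by (rule bump_deriv A_bump A_bump0)+
  have I0: "?I \<ge> 0" by (rule Bochner_Integration.integral_nonneg[OF \<Phi>_nonneg])
  have by3: "tint f1 f2 (A 3) (r 3) = - tint f1 f2 ?A' u" if "bump (lo $ 1) (hi $ 1) f1" "bump (lo $ 2) (hi $ 2) f2" for f1 f2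
  proof -
    have "tbump lo hi (tri f1 f2 (A 3))" by (intro tbump_tri that A_bump)
    then show ?thesis using w[of 3] box unfolding wpart_def tint_def dt_tri(3)[symmetric] by fastforce
  qed
  \<comment> \<open>Applied to \<open>u\<close> itself, the exchange leaves the first derivatives
    \<open>r 1\<close> and \<open>r 2\<close>. Each undergoes a second exchange, whose remainders
    contain the controlled second derivatives.\<close>
  obtain Q1 Q2 where Q: "bump (lo $ 1) (hi $ 1) Q1" "bump (lo $ 2) (hi $ 2) Q2"
    "\<And>t. \<bar>Q1 t\<bar> \<le> 2 * (LBINT t. \<bar>A 1 t\<bar>)" "\<And>t. \<bar>Q2 t\<bar> \<le> 2 * (LBINT t. \<bar>A 2 t\<bar>)"
    and eq: "tint (A 1) (A 2) ?A' u = (integral\<^sup>L lborel (A 1) * integral\<^sup>L lborel (A 2)) *\<^sub>R tint (S 1) (S 2) ?A' u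
      - tint Q1 (A 2) ?A' (r 1) - integral\<^sup>L lborel (A 1) *\<^sub>R tint (S 1) Q2 ?A' (r 2)"
    using tint_replace[OF w w box A_bump A_bump S_bump S_props(1) S_props(1) S_props(2) S_props(2) A'b(1)] by blast
  have Qb: "\<bar>Q1 t\<bar> \<le> 2" "\<bar>Q2 t\<bar> \<le> 2" for t using Q(3,4)[of t] A_abs(2) by auto
  \<comment> \<open>The antiderivatives are at most 2 on an interval of length 4 s. This power of s
    compensates for the derivative of \<open>A 3\<close>, of size C / s^2 in place of C / s.\<close>
  have Qi: "(LBINT t. \<bar>Q1 t\<bar>) \<le> 8 * s" "(LBINT t. \<bar>Q2 t\<bar>) \<le> 8 * s"
    using bump_abs_integral_le[OF Q(1) _ Qb(1)] bump_abs_integral_le[OF Q(2) _ Qb(2)] s by auto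
  have m0: "integral\<^sup>L lborel ?A' = 0" by (rule bump_integral_deriv[OF A_bump])
  have A'le: "\<bar>?A' t\<bar> \<le> C / s\<^sup>2" for t by (rule A_props(4))
  have hww: "wpart \<Omega> 1 (r 1) (h 1 1)" "wpart \<Omega> 2 (r 1) (h 2 1)" "wpart \<Omega> 1 (r 2) (h 1 2)" "wpart \<Omega> 2 (r 2) (h 2 2)"
    by (rule hw; simp)+
  \<comment> \<open>The main term of the second exchange: a constant gradient against a vertical
    factor of mean zero.\<close>
  have fib0: "tint (S 1) (S 2) ?A' (r j) = 0" for j using tint_fiber[OF A'b(2)] m0 by simp
  have e1: "norm (tint Q1 (A 2) ?A' (r 1)) \<le> (K0 / 2) * ?I"
  proof -
    obtain P1 P2 where P: "bump (lo $ 1) (hi $ 1) P1" "bump (lo $ 2) (hi $ 2) P2"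
      "\<And>t. \<bar>P1 t\<bar> \<le> 2 * (LBINT t. \<bar>Q1 t\<bar>)" "\<And>t. \<bar>P2 t\<bar> \<le> 2 * (LBINT t. \<bar>A 2 t\<bar>)"
      and eqP: "tint Q1 (A 2) ?A' (r 1) = (integral\<^sup>L lborel Q1 * integral\<^sup>L lborel (A 2)) *\<^sub>R tint (S 1) (S 2) ?A' (r 1)
        - tint P1 (A 2) ?A' (h 1 1) - integral\<^sup>L lborel Q1 *\<^sub>R tint (S 1) P2 ?A' (h 2 1)"
      using tint_replace[OF hww(1) hww(2) box Q(1) A_bump S_bump S_props(1) S_props(1) S_props(2) S_props(2) A'b(1)] by blast
    have Pb: "\<bar>P1 t\<bar> \<le> 16 * s" "\<bar>P2 t\<bar> \<le> 2" for t using P(3,4)[of t] A_abs(2) Qi by auto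
    have m: "\<bar>integral\<^sup>L lborel Q1\<bar> \<le> 8 * s"
      using order_trans[OF integral_abs_bound Qi(1)] .
    have 1: "norm (tint P1 (A 2) ?A' (h 1 1)) \<le> (16 * C\<^sup>2) * ?I"
      by (rule tint_flat[OF P(1) A_bump A'b(1) _ _ Pb(1) A_abs(1) A'le]) (use s in \<open>auto simp: power2_eq_square\<close>)
    have 2: "norm (tint (S 1) P2 ?A' (h 2 1)) \<le> (2 * C / s) * ?I"
      by (rule tint_on_fiber[OF P(2) A'b(1) _ _ Pb(2) A'le]) (use s C(1) in \<open>auto simp: power2_eq_square\<close>)
    have "norm (tint Q1 (A 2) ?A' (r 1)) \<le> norm (tint P1 (A 2) ?A' (h 1 1)) + \<bar>integral\<^sup>L lborel Q1\<bar> * norm (tint (S 1) P2 ?A' (h 2 1))"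
      unfolding eqP fib0 using norm_triangle_ineq4[of "- tint P1 (A 2) ?A' (h 1 1)" "integral\<^sup>L lborel Q1 *\<^sub>R tint (S 1) P2 ?A' (h 2 1)"] by simp
    also have "\<dots> \<le> (16 * C\<^sup>2) * ?I + (8 * s) * ((2 * C / s) * ?I)"
      by (intro add_mono mult_mono 1 2 m) (use s in auto)
    also have "\<dots> = (16 * C\<^sup>2 + 16 * C) * ?I" using s by (simp add: field_simps)
    also have "\<dots> \<le> (K0 / 2) * ?I" using K0 C(1) I0 by (intro mult_right_mono) auto
    finally show ?thesis .
  qed
  have e2: "norm (tint (S 1) Q2 ?A' (r 2)) \<le> (K0 / 2) * ?I"
  proof -
    obtain P1 P2 where P: "bump (lo $ 1) (hi $ 1) P1" "bump (lo $ 2) (hi $ 2) P2"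
      "\<And>t. \<bar>P1 t\<bar> \<le> 2 * (LBINT t. \<bar>S 1 t\<bar>)" "\<And>t. \<bar>P2 t\<bar> \<le> 2 * (LBINT t. \<bar>Q2 t\<bar>)"
      and eqP: "tint (S 1) Q2 ?A' (r 2) = (integral\<^sup>L lborel (S 1) * integral\<^sup>L lborel Q2) *\<^sub>R tint (S 1) (S 2) ?A' (r 2)
        - tint P1 Q2 ?A' (h 1 2) - integral\<^sup>L lborel (S 1) *\<^sub>R tint (S 1) P2 ?A' (h 2 2)"
      using tint_replace[OF hww(3) hww(4) box S_bump(1) Q(2) S_bump S_props(1) S_props(1) S_props(2) S_props(2) A'b(1)] by blast
    have Pb: "\<bar>P1 t\<bar> \<le> 2" "\<bar>P2 t\<bar> \<le> 16 * s" for t using P(3,4)[of t] S_abs Qi by auto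
    have 1: "norm (tint P1 Q2 ?A' (h 1 2)) \<le> (4 * C) * ?I"
      by (rule tint_flat[OF P(1) Q(2) A'b(1) _ _ Pb(1) Qb(2) A'le]) (use C(1) in auto)
    have 2: "norm (tint (S 1) P2 ?A' (h 2 2)) \<le> (16 * C) * ?I"
      by (rule tint_on_fiber[OF P(2) A'b(1) _ _ Pb(2) A'le]) (use s C(1) in \<open>auto simp: power2_eq_square\<close>)
    have "norm (tint (S 1) Q2 ?A' (r 2)) \<le> norm (tint P1 Q2 ?A' (h 1 2)) + norm (tint (S 1) P2 ?A' (h 2 2))"
      unfolding eqP fib0 S_props(2) using norm_triangle_ineq4[of "- tint P1 Q2 ?A' (h 1 2)" "tint (S 1) P2 ?A' (h 2 2)"] by simp
    also have "\<dots> \<le> (4 * C) * ?I + (16 * C) * ?I" by (rule add_mono[OF 1 2])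
    also have "\<dots> \<le> (K0 / 2) * ?I" unfolding distrib_right[symmetric] using K0 C(1) I0 by (intro mult_right_mono) auto
    finally show ?thesis .
  qed
  have "R *v axis 3 1 = - tint (S 1) (S 2) ?A' u"
    using tint_fiber[OF A_bump0, of 3] by3[OF S_bump] A_props(2) by simp
  moreover have "mol s (r 3) x = - tint (A 1) (A 2) ?A' u"
    unfolding mol_eq_tint by (rule by3[OF A_bump A_bump])
  ultimately have "mol s (r 3) x - R *v axis 3 1 = tint Q1 (A 2) ?A' (r 1) + tint (S 1) Q2 ?A' (r 2)"
    unfolding eq A_props(2) by simp
  also have "norm \<dots> \<le> (K0 / 2) * ?I + (K0 / 2) * ?I"
    by (rule order_trans[OF norm_triangle_ineq add_mono[OF e1 e2]])
  finally show ?thesis by simp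
qed

theorem column_estimate: "norm (mol s (r j) x - R *v axis j 1) \<le> K0 * integral\<^sup>L lborel \<Phi>"
  using exhaust_3[of j] column12_estimate[of j] column3_estimate by auto

end

subsection \<open>The limit gradient is a rotation\<close>

abbreviation mat_of :: "(3 \<Rightarrow> real^3) \<Rightarrow> real^3^3" where
  "mat_of c \<equiv> (\<chi> i j. c j $ i)"

definition SO3 :: "(real^3^3) set" where "SO3 = {R. rotation_matrix R}"

lemma SO3_ne: "SO3 \<noteq> {}"
proof -
  have "rotation_matrix (mat 1 :: real^3^3)" by (simp add: rotation_matrix_def orthogonal_matrix_id)
  then show ?thesis by (auto simp: SO3_def)
qed

lemma closed_SO3: "closed SO3"
proof -
  have "continuous_on UNIV (\<lambda>A::real^3^3. transpose A ** A)"
    unfolding transpose_def matrix_matrix_mult_def by (intro continuous_intros)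
  moreover have "continuous_on UNIV (\<lambda>A::real^3^3. det A)"
    unfolding det_3 by (intro continuous_intros)
  ultimately have "closed ({A::real^3^3. transpose A ** A = mat 1} \<inter> {A. det A = 1})"
    by (intro closed_Int closed_Collect_eq continuous_on_const)
  moreover have "SO3 = {A. transpose A ** A = mat 1} \<inter> {A. det A = 1}"
    by (auto simp: SO3_def rotation_matrix_def orthogonal_matrix)
  ultimately show ?thesis by simp
qed

lemma mat_of_columns: "mat_of (\<lambda>j. R *v axis j 1) = R"
  by (simp add: matrix_vector_mult_basis column_def vec_eq_iff)

lemma dist_mat_of_le: "dist (mat_of c) (mat_of c') \<le> 3 * (\<Sum>j\<in>UNIV. norm (c j - c' j))"
proof -
  have "norm (mat_of c - mat_of c') \<le> (\<Sum>i\<in>UNIV. norm ((mat_of c - mat_of c') $ i))"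
    unfolding norm_vec_def by (rule L2_set_le_sum) auto
  also have "\<dots> \<le> (\<Sum>i\<in>UNIV. \<Sum>j\<in>UNIV. \<bar>(mat_of c - mat_of c') $ i $ j\<bar>)"
    by (intro sum_mono norm_le_l1_cart)
  also have "\<dots> \<le> (\<Sum>i\<in>(UNIV::3 set). \<Sum>j\<in>UNIV. norm (c j - c' j))"
    by (intro sum_mono) (use component_le_norm_cart[of "c _ - c' _"] in simp)
  finally show ?thesis by (simp add: dist_norm)
qed

lemma mat_of_measurable:
  assumes "\<And>j. f j \<in> borel_measurable borel"
  shows "(\<lambda>x::real^3. mat_of (\<lambda>j. f j x)) \<in> borel_measurable borel"
proof -
  have "(\<lambda>v::real^3. v $ i) \<in> borel_measurable borel" for i
    by (intro borel_measurable_continuous_onI continuous_intros)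
  from measurable_compose[OF assms this]
  have "(\<lambda>x. mat_of (\<lambda>j. f j x) \<bullet> axis i (axis k 1)) \<in> borel_measurable borel" for i k
    by (simp add: inner_axis)
  then show ?thesis
    by (subst borel_measurable_euclidean_space) (auto simp: Basis_vec_def)
qed

text \<open>The weight \<open>1 / (e s)\<close> near \<open>z\<^sub>1 = 0\<close> comes from the factor concentrated on the fiber. The integral is
  of order \<open>s\<close>, uniformly in \<open>e\<close>.\<close>

definition gker :: "real \<Rightarrow> real \<Rightarrow> real \<Rightarrow> real^3 \<Rightarrow> real" where
  "gker k s e z = 1 / s\<^sup>2 * indicator (cbox (vec (- (2 * s))) (vec (2 * s))) z
     + k / (e * s) * indicator (cbox (vector [- (2 * e), - (2 * s), - (2 * s)]) (vector [2 * e, 2 * s, 2 * s])) z"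

lemma content_cbox3:
  fixes a b :: "real^3"
  assumes "a $ 1 \<le> b $ 1" "a $ 2 \<le> b $ 2" "a $ 3 \<le> b $ 3"
  shows "emeasure lborel (cbox a b) = ennreal ((b $ 1 - a $ 1) * (b $ 2 - a $ 2) * (b $ 3 - a $ 3))"
proof -
  have "a \<bullet> i \<le> b \<bullet> i" if "i \<in> Basis" for i
    using that assms by (auto simp: Basis_vec_def inner_axis) (metis exhaust_3)
  then have "emeasure lborel (cbox a b) = (\<Prod>i\<in>Basis. (b - a) \<bullet> i)" by (rule emeasure_lborel_cbox)
  also have "(\<Prod>i\<in>Basis. (b - a) \<bullet> i) = (\<Prod>i\<in>UNIV. (b - a) $ i)"
  proof -
    have B: "(Basis :: (real^3) set) = (\<lambda>i. axis i 1) ` UNIV" by (auto simp: Basis_vec_def)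
    have inj: "inj (\<lambda>i::3. axis i (1::real))" by (auto simp: inj_def axis_eq_axis)
    show ?thesis unfolding B by (subst prod.reindex[OF inj]) (simp add: inner_axis)
  qed
  also have "\<dots> = (b $ 1 - a $ 1) * (b $ 2 - a $ 2) * (b $ 3 - a $ 3)" unfolding UNIV_3 by (simp add: mult.assoc)
  finally show ?thesis .
qed

lemma gker_measurable [measurable]: "gker k s e \<in> borel_measurable borel"
  unfolding gker_def by measurable

lemma gker_nonneg: "0 < s \<Longrightarrow> 0 < e \<Longrightarrow> 0 \<le> k \<Longrightarrow> gker k s e z \<ge> 0"
  unfolding gker_def by (intro add_nonneg_nonneg mult_nonneg_nonneg) auto

lemma gker_integral:
  assumes "0 < s" "0 < e" "0 \<le> k"
  shows "(\<integral>\<^sup>+z. gker k s e z \<partial>lborel) = ennreal (64 * (1 + k) * s)"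
proof -
  let ?A = "cbox (vec (- (2 * s))) (vec (2 * s)) :: (real^3) set"
  let ?B = "cbox (vector [- (2 * e), - (2 * s), - (2 * s)]) (vector [2 * e, 2 * s, 2 * s]) :: (real^3) set"
  have A: "emeasure lborel ?A = ennreal (64 * s^3)"
    by (subst content_cbox3) (use assms in \<open>auto simp: power3_eq_cube\<close>)
  have B: "emeasure lborel ?B = ennreal (64 * e * s^2)"
    by (subst content_cbox3) (use assms in \<open>auto simp: power2_eq_square\<close>)
  have "(\<integral>\<^sup>+z. gker k s e z \<partial>lborel) = (\<integral>\<^sup>+z. ennreal (1 / s\<^sup>2) * indicator ?A z + ennreal (k / (e * s)) * indicator ?B z \<partial>lborel)"
    unfolding gker_def using assms
    by (intro nn_integral_cong) (auto simp: indicator_def ennreal_plus[symmetric] simp del: ennreal_plus)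
  also have "\<dots> = ennreal (1 / s\<^sup>2) * emeasure lborel ?A + ennreal (k / (e * s)) * emeasure lborel ?B"
    by (subst nn_integral_add) (auto simp: nn_integral_cmult_indicator)
  also have "\<dots> = ennreal (1 / s\<^sup>2 * (64 * s^3) + k / (e * s) * (64 * e * s^2))"
    unfolding A B using assms by (simp add: ennreal_mult[symmetric] ennreal_plus[symmetric] del: ennreal_plus)
  also have "1 / s\<^sup>2 * (64 * s^3) + k / (e * s) * (64 * e * s^2) = 64 * (1 + k) * s"
    using assms by (simp add: field_simps power2_eq_square power3_eq_cube)
  finally show ?thesis .
qed

text \<open>What the passage to the limit uses, in terms of integrable functions on the whole space:
  an L^1 bound on horizontal second derivatives, convergence tested with tensor products, and a
  fiber within \<epsilon> of every point.\<close>

locale fiber_sequence =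
  fixes \<Omega> :: "(real^3) set" and un :: "nat \<Rightarrow> real^3 \<Rightarrow> real^3" and rn :: "nat \<Rightarrow> 3 \<Rightarrow> real^3 \<Rightarrow> real^3"
    and hn :: "nat \<Rightarrow> 3 \<Rightarrow> 3 \<Rightarrow> real^3 \<Rightarrow> real^3" and u :: "real^3 \<Rightarrow> real^3" and r :: "3 \<Rightarrow> real^3 \<Rightarrow> real^3"
    and \<epsilon> :: "nat \<Rightarrow> real" and \<delta> M :: real
  assumes wn: "\<And>n j. wpart \<Omega> j (un n) (rn n j)"
    and whn: "\<And>n i j. i \<in> {1, 2} \<Longrightarrow> j \<in> {1, 2} \<Longrightarrow> wpart \<Omega> i (rn n j) (hn n i j)"
    and w: "\<And>j. wpart \<Omega> j u (r j)"
    and M: "\<And>n. (LBINT y. (\<Sum>i\<in>{1,2}. \<Sum>j\<in>{1,2}. norm (hn n i j y))) \<le> M"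
    and conv: "\<And>a b g. cbox a b \<subseteq> \<Omega> \<Longrightarrow> tbump a b g \<Longrightarrow>
       (\<lambda>n. LBINT y. tens g y *\<^sub>R un n y) \<longlonglongrightarrow> (LBINT y. tens g y *\<^sub>R u y)"
    and eps: "\<And>n. 0 < \<epsilon> n" "\<epsilon> \<longlonglongrightarrow> 0" and \<delta>: "0 < \<delta>" "\<delta> < 1"
    and fiber: "\<And>n (x::real^3). \<exists>c::real^3. \<bar>c $ 1 - x $ 1\<bar> \<le> \<epsilon> n \<and> \<bar>c $ 2 - x $ 2\<bar> \<le> \<epsilon> n \<and>
       (AE y in lborel. y \<in> \<Omega> \<longrightarrow> \<bar>y $ 1 - c $ 1\<bar> < \<delta> * \<epsilon> n / 2 \<longrightarrow> \<bar>y $ 2 - c $ 2\<bar> < \<delta> * \<epsilon> n / 2 \<longrightarrow>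
          rotation_matrix (mat_of (\<lambda>j. rn n j y)))"
begin

definition Hn :: "nat \<Rightarrow> real^3 \<Rightarrow> real" where
  "Hn n y = (\<Sum>i\<in>{1,2}. \<Sum>j\<in>{1,2}. norm (hn n i j y))"

lemma Hn_int: "integrable lborel (Hn n)"
  unfolding Hn_def[abs_def] using whn by (auto simp: wpart_def)

lemma Hn_le: "integral\<^sup>L lborel (Hn n) \<le> M"
  unfolding Hn_def[abs_def] by (rule M)

lemma Hn_nonneg: "Hn n y \<ge> 0" unfolding Hn_def by (intro sum_nonneg) auto

lemma rn_int: "integrable lborel (rn n j)"
  and r_int: "integrable lborel (r j)"
  using wn w unfolding wpart_def by auto

text \<open>The majorant of \<open>near_fiber\<close> depends on the fiber chosen for x. That fiber
  lies horizontally within \<epsilon> of x, and \<open>S 1\<close> has height of order 1/\<epsilon>,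
  so that \<open>gker\<close>, a function of x - y alone, dominates it. Integration over x is then a
  convolution estimate.\<close>

lemma pointwise_estimate:
  obtains K where "K \<ge> 0" "\<And>n s x. 0 < s \<Longrightarrow> \<epsilon> n \<le> s \<Longrightarrow> cbox (x - vec (2 * s)) (x + vec (2 * s)) \<subseteq> \<Omega> \<Longrightarrow>
    ennreal (infdist (mat_of (\<lambda>j. mol s (rn n j) x)) SO3)
      \<le> (\<integral>\<^sup>+y. ennreal (gker K s (\<epsilon> n) (x - y)) * ennreal (K * Hn n y) \<partial>lborel)"
proof -
  obtain C where C: "0 < C" "\<And>s t. 0 < s \<Longrightarrow> moll s t \<le> C / s" "\<And>s t. 0 < s \<Longrightarrow> \<bar>deriv (moll s) t\<bar> \<le> C / s\<^sup>2"
    using moll_le by blast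
  \<comment> \<open>The 9 consists of three columns and the factor 3 of
    \<open>dist_mat_of_le\<close>. The second summand comes from the height C / d of
    \<open>S 1\<close>, which equals (4 C / \<delta>) / \<epsilon>.\<close>
  define K where "K = 9 * (64 * (C + 1)\<^sup>2) + 4 * C / \<delta>"
  have K: "K \<ge> 9 * (64 * (C + 1)\<^sup>2)" "K \<ge> 4 * C / \<delta>" "K \<ge> 0" using C(1) \<delta> by (auto simp: K_def)
  show thesis
  proof (rule that[OF K(3)])
    fix n s x assume s: "0 < s" "\<epsilon> n \<le> s" and box: "cbox (x - vec (2 * s)) (x + vec (2 * s)) \<subseteq> \<Omega>"
    define e where "e = \<epsilon> n"
    define d where "d = \<delta> * e / 4"
    have e: "0 < e" "e \<le> s" using eps(1)[of n] s by (auto simp: e_def)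
    have d: "0 < d" "4 * d \<le> e" using e \<delta> by (auto simp: d_def mult_le_cancel_right1)
    obtain c :: "real^3" where c: "\<bar>c $ 1 - x $ 1\<bar> \<le> e" "\<bar>c $ 2 - x $ 2\<bar> \<le> e" and
       rot: "AE y in lborel. y \<in> \<Omega> \<longrightarrow> \<bar>y $ 1 - c $ 1\<bar> < 2 * d \<longrightarrow> \<bar>y $ 2 - c $ 2\<bar> < 2 * d \<longrightarrow> rotation_matrix (mat_of (\<lambda>j. rn n j y))"
      using fiber[of x n] by (auto simp: d_def e_def)
    \<comment> \<open>Twice as wide and high as the box on which the constant gradient is needed,
      which leaves the margin that \<open>rigid\<close> requires.\<close>
    define U where "U = {y::real^3. \<bar>y $ 1 - c $ 1\<bar> < 2 * d \<and> \<bar>y $ 2 - c $ 2\<bar> < 2 * d \<and> \<bar>y $ 3 - x $ 3\<bar> < 2 * s}"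
    have U: "U \<subseteq> \<Omega>"
    proof
      fix y assume "y \<in> U"
      then have "y \<in> cbox (x - vec (2 * s)) (x + vec (2 * s))"
        using c e d unfolding U_def mem_box_cart forall_3 by (auto simp: abs_le_iff abs_less_iff)
      then show "y \<in> \<Omega>" using box by blast
    qed
    have rg: "rigid_gradient U (un n) (rn n)"
    proof
      show "wpart U i (un n) (rn n i)" for i using wpart_subset[OF wn U] .
      show "AE y in lborel. y \<in> U \<longrightarrow> rotation_matrix (mat_of (\<lambda>j. rn n j y))"
        using rot
      proof eventually_elim
        case (elim y)
        then show ?case using U by (auto simp: U_def)
      qed
    qed
    define p :: "real^3" where "p = vector [c $ 1 - d, c $ 2 - d, x $ 3 - s]"
    define q :: "real^3" where "q = vector [c $ 1 + d, c $ 2 + d, x $ 3 + s]"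
    define t where "t = min d s / 2"
    have t: "0 < t" "t < d" "t < s" using d s by (auto simp: t_def)
    have "cbox (p - vec t) (q + vec t) \<subseteq> U"
      using t unfolding U_def p_def q_def subset_iff mem_box_cart forall_3 by (auto simp: abs_less_iff)
    from rigid_gradient.rigid[OF rg t(1) this] obtain R v where R: "rotation_matrix R"
       "AE y in lborel. y \<in> cbox p q \<longrightarrow> un n y = R *v y + v \<and> (\<forall>j. rn n j y = R *v axis j 1)"
      by blast
    interpret nf: near_fiber \<Omega> "un n" "rn n" "hn n" x c s d C R
    proof
      show "wpart \<Omega> j (un n) (rn n j)" for j by (rule wn)
      show "i \<in> {1,2} \<Longrightarrow> j \<in> {1,2} \<Longrightarrow> wpart \<Omega> i (rn n j) (hn n i j)" for i j by (rule whn)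
      show "AE y in lborel. \<bar>y $ 1 - c $ 1\<bar> \<le> d \<longrightarrow> \<bar>y $ 2 - c $ 2\<bar> \<le> d \<longrightarrow> \<bar>y $ 3 - x $ 3\<bar> \<le> s \<longrightarrow> (\<forall>j. rn n j y = R *v axis j 1)"
        using R(2)
      proof eventually_elim
        case (elim y)
        then show ?case unfolding p_def q_def mem_box_cart forall_3 by (auto simp: abs_le_iff)
      qed
    qed (use s d e c C box in auto)
    have H: "nf.H = Hn n" by (simp add: fun_eq_iff nf.H_def Hn_def)
    have \<Phi>: "nf.\<Phi> y \<le> gker K s e (x - y) * Hn n y" for y
    proof -
      let ?A = "cbox (x - vec (2 * s)) (x + vec (2 * s))"
      have "indicator ?A y * (1 / s\<^sup>2 + nf.S 1 (y $ 1) / s) \<le> gker K s e (x - y)"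
      proof (cases "y \<in> ?A")
        case True
        note yA = True
        then have y: "\<bar>x $ i - y $ i\<bar> \<le> 2 * s" for i by (auto simp: mem_box_cart abs_le_iff) (smt (verit))+
        then have 1: "x - y \<in> cbox (vec (- (2 * s))) (vec (2 * s))" by (auto simp: mem_box_cart abs_le_iff) (smt (verit))+
        show ?thesis
        proof (cases "\<bar>x $ 1 - y $ 1\<bar> \<le> 2 * e")
          case True
          then have 2: "x - y \<in> cbox (vector [- (2 * e), - (2 * s), - (2 * s)]) (vector [2 * e, 2 * s, 2 * s])"
            using y[of 2] y[of 3] unfolding mem_box_cart forall_3 by (auto simp: abs_le_iff)
          have "nf.S 1 (y $ 1) \<le> C / d" unfolding nf.S_def by (rule C(2)[OF d(1)])
          also have "C / d = (4 * C / \<delta>) / e" by (simp add: d_def)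
          also have "\<dots> \<le> K / e" using K e by (intro divide_right_mono) auto
          finally have "nf.S 1 (y $ 1) / s \<le> K / e / s" using s by (intro divide_right_mono) auto
          then show ?thesis using 1 2 yA by (simp add: gker_def)
        next
          case False
          have "nf.S 1 (y $ 1) = 0"
          proof -
            have "y $ 1 \<notin> {c $ 1 - d..c $ 1 + d}" using False c(1) d e by auto
            then show ?thesis using nf.S_bump0[of 1] by (simp add: bump_def)
          qed
          then show ?thesis using 1 gker_nonneg s e K by (auto simp: gker_def indicator_def intro!: add_nonneg_nonneg)
        qed
      next
        case False
        then show ?thesis using gker_nonneg[OF s(1) e(1) K(3)] by simp
      qed
      then show ?thesis unfolding nf.\<Phi>_def H using Hn_nonneg by (intro mult_right_mono) auto
    qed
    have "infdist (mat_of (\<lambda>j. mol s (rn n j) x)) SO3 \<le> dist (mat_of (\<lambda>j. mol s (rn n j) x)) (mat_of (\<lambda>j. R *v axis j 1))"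
      unfolding mat_of_columns using R(1) by (intro infdist_le) (simp add: SO3_def)
    also have "\<dots> \<le> 3 * (\<Sum>j\<in>(UNIV::3 set). norm (mol s (rn n j) x - R *v axis j 1))"
      by (rule dist_mat_of_le)
    also have "\<dots> \<le> 3 * (\<Sum>j\<in>(UNIV::3 set). nf.K0 * integral\<^sup>L lborel nf.\<Phi>)"
      by (intro mult_left_mono sum_mono nf.column_estimate) auto
    also have "\<dots> = 9 * nf.K0 * integral\<^sup>L lborel nf.\<Phi>" by simp
    also have "\<dots> \<le> K * integral\<^sup>L lborel nf.\<Phi>"
      using K(1) by (intro mult_right_mono Bochner_Integration.integral_nonneg nf.\<Phi>_nonneg) (simp add: nf.K0_def)
    also have "\<dots> = (LBINT y. K * nf.\<Phi> y)" by simp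
    finally have "ennreal (infdist (mat_of (\<lambda>j. mol s (rn n j) x)) SO3) \<le> ennreal (LBINT y. K * nf.\<Phi> y)"
      by (rule ennreal_leI)
    also have "\<dots> = (\<integral>\<^sup>+y. ennreal (K * nf.\<Phi> y) \<partial>lborel)"
      using nf.\<Phi>_int nf.\<Phi>_nonneg K by (intro nn_integral_eq_integral[symmetric]) auto
    also have "\<dots> \<le> (\<integral>\<^sup>+y. ennreal (gker K s (\<epsilon> n) (x - y)) * ennreal (K * Hn n y) \<partial>lborel)"
    proof (rule nn_integral_mono)
      fix y
      have "K * nf.\<Phi> y \<le> gker K s e (x - y) * (K * Hn n y)"
        using mult_left_mono[OF \<Phi>[of y] K(3)] by (simp add: mult_ac)
      then show "ennreal (K * nf.\<Phi> y) \<le> ennreal (gker K s (\<epsilon> n) (x - y)) * ennreal (K * Hn n y)"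
        using gker_nonneg[OF s(1) e(1) K(3)] Hn_nonneg K(3) unfolding e_def
        by (subst ennreal_mult[symmetric]) (auto intro!: ennreal_leI)
    qed
    finally show "ennreal (infdist (mat_of (\<lambda>j. mol s (rn n j) x)) SO3)
      \<le> (\<integral>\<^sup>+y. ennreal (gker K s (\<epsilon> n) (x - y)) * ennreal (K * Hn n y) \<partial>lborel)" .
  qed
qed

text \<open>With the derivative moved to the kernel, the mollified gradient at x is one test
  integral of the map. So weak convergence yields pointwise convergence, to which the distance from
  SO(3) can be applied.\<close>

lemma mol_tendsto:
  assumes s: "0 < s" and box: "cbox (x - vec s) (x + vec s) \<subseteq> \<Omega>"
  shows "(\<lambda>n. mol s (rn n j) x) \<longlonglongrightarrow> mol s (r j) x"
proof -
  have e: "x - vec (- s) = x + vec s" by (simp add: vec_eq_iff)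
  note m = tbump_moll[OF s]
  have box': "cbox (x - vec s) (x - vec (- s)) \<subseteq> \<Omega>" unfolding e by (rule box)
  have "(\<lambda>n. LBINT y. tens (reflected x (dt j (\<lambda>_. moll s))) y *\<^sub>R un n y) \<longlonglongrightarrow>
    (LBINT y. tens (reflected x (dt j (\<lambda>_. moll s))) y *\<^sub>R u y)"
    by (rule conv[OF box' tbump_reflected[OF tbump_dt[OF m]]])
  then have "(\<lambda>n. tconv (dt j (\<lambda>_. moll s)) (un n) x) \<longlonglongrightarrow> tconv (dt j (\<lambda>_. moll s)) u x"
    unfolding tens_reflected tconv_def .
  then show ?thesis
    unfolding wpart_tconv[OF wn m box'] wpart_tconv[OF w m box'] .
qed

lemma mol_mat_measurable:
  fixes f :: "3 \<Rightarrow> real^3 \<Rightarrow> real^3"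
  assumes s: "0 < s" and f: "\<And>j. integrable lborel (f j)"
  shows "(\<lambda>x. infdist (mat_of (\<lambda>j. mol s (f j) x)) SO3) \<in> borel_measurable borel"
proof -
  have "mol s (f j) \<in> borel_measurable borel" for j
    by (rule borel_measurable_continuous_onI[OF tconv_continuous[OF tbump_moll[OF s] f]])
  then have "(\<lambda>x. mat_of (\<lambda>j. mol s (f j) x)) \<in> borel_measurable borel"
    by (rule mat_of_measurable[of "\<lambda>j. mol s (f j)"])
  moreover have "(\<lambda>A. infdist A SO3) \<in> borel_measurable borel"
    by (intro borel_measurable_continuous_onI continuous_on_infdist continuous_on_id)
  ultimately show ?thesis by (rule measurable_compose)
qed

text \<open>For fixed s the mean distance of the mollified gradients from SO(3) is at most a
  constant times s, uniformly in n, and this survives n to infinity. Since the mollifications of the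
  limit gradient converge in L^1, s to 0 leaves distance 0. The factor 3 in the hypothesis is the
  box itself plus the reach 2 s of the kernels.\<close>

theorem limit_rotation:
  assumes s0: "0 < s0" and box: "cbox (x0 - vec (3 * s0)) (x0 + vec (3 * s0)) \<subseteq> \<Omega>"
  shows "AE x in lborel. x \<in> cbox (x0 - vec s0) (x0 + vec s0) \<longrightarrow> rotation_matrix (mat_of (\<lambda>j. r j x))"
proof -
  let ?B = "cbox (x0 - vec s0) (x0 + vec s0)"
  obtain K where K: "K \<ge> 0" and pw: "\<And>n s x. 0 < s \<Longrightarrow> \<epsilon> n \<le> s \<Longrightarrow> cbox (x - vec (2 * s)) (x + vec (2 * s)) \<subseteq> \<Omega> \<Longrightarrow>
    ennreal (infdist (mat_of (\<lambda>j. mol s (rn n j) x)) SO3)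
      \<le> (\<integral>\<^sup>+y. ennreal (gker K s (\<epsilon> n) (x - y)) * ennreal (K * Hn n y) \<partial>lborel)"
    using pointwise_estimate by blast
  have "0 \<le> integral\<^sup>L lborel (Hn 0)" by (intro Bochner_Integration.integral_nonneg Hn_nonneg)
  then have M0: "M \<ge> 0" using Hn_le[of 0] by linarith
  define K1 where "K1 = 64 * (1 + K) * (K * M)"
  have K1: "K1 \<ge> 0" using K M0 by (simp add: K1_def)
  define D where "D s x = infdist (mat_of (\<lambda>j. mol s (r j) x)) SO3" for s x
  define Dn where "Dn n s x = infdist (mat_of (\<lambda>j. mol s (rn n j) x)) SO3" for n s x
  define D0 where "D0 x = infdist (mat_of (\<lambda>j. r j x)) SO3" for x
  have meas[measurable]: "D0 \<in> borel_measurable borel"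
  proof -
    have "r j \<in> borel_measurable borel" for j using r_int[of j] by auto
    note m = mat_of_measurable[of r, OF this]
    have "(\<lambda>A. infdist A SO3) \<in> borel_measurable borel"
      by (intro borel_measurable_continuous_onI continuous_on_infdist continuous_on_id)
    from measurable_compose[OF m this] show ?thesis unfolding D0_def[abs_def] .
  qed
  have measm: "0 < s \<Longrightarrow> D s \<in> borel_measurable borel" "0 < s \<Longrightarrow> Dn n s \<in> borel_measurable borel" for n s
    unfolding D_def[abs_def] Dn_def[abs_def] by (rule mol_mat_measurable, assumption, rule r_int rn_int)+
  have bs: "cbox (x - vec (2 * s)) (x + vec (2 * s)) \<subseteq> \<Omega>" "cbox (x - vec s) (x + vec s) \<subseteq> \<Omega>" if "x \<in> ?B" "0 < s" "s \<le> s0" for x s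
  proof -
    have y: "x0 $ i - s0 \<le> x $ i" "x $ i \<le> x0 $ i + s0" for i using that(1) by (auto simp: mem_box_cart)
    have "cbox (x - vec (2 * s)) (x + vec (2 * s)) \<subseteq> cbox (x0 - vec (3 * s0)) (x0 + vec (3 * s0))"
    proof
      fix z assume "z \<in> cbox (x - vec (2 * s)) (x + vec (2 * s))"
      then have z: "x $ i - 2 * s \<le> z $ i" "z $ i \<le> x $ i + 2 * s" for i by (auto simp: mem_box_cart)
      have "x0 $ i - 3 * s0 \<le> z $ i \<and> z $ i \<le> x0 $ i + 3 * s0" for i using y[of i] z[of i] that by linarith
      then show "z \<in> cbox (x0 - vec (3 * s0)) (x0 + vec (3 * s0))" by (simp add: mem_box_cart)
    qed
    then show 1: "cbox (x - vec (2 * s)) (x + vec (2 * s)) \<subseteq> \<Omega>" using box by blast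
    have "cbox (x - vec s) (x + vec s) \<subseteq> cbox (x - vec (2 * s)) (x + vec (2 * s))"
    proof
      fix z assume "z \<in> cbox (x - vec s) (x + vec s)"
      then have z: "x $ i - s \<le> z $ i" "z $ i \<le> x $ i + s" for i by (auto simp: mem_box_cart)
      have "x $ i - 2 * s \<le> z $ i \<and> z $ i \<le> x $ i + 2 * s" for i using z[of i] that by linarith
      then show "z \<in> cbox (x - vec (2 * s)) (x + vec (2 * s))" by (simp add: mem_box_cart)
    qed
    then show "cbox (x - vec s) (x + vec s) \<subseteq> \<Omega>" using 1 by blast
  qed
  have est_n: "(\<integral>\<^sup>+x. ennreal (indicator ?B x * Dn n s x) \<partial>lborel) \<le> ennreal (K1 * s)" if s: "0 < s" "s \<le> s0" "\<epsilon> n \<le> s" for n s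
  proof -
    have "(\<integral>\<^sup>+x. ennreal (indicator ?B x * Dn n s x) \<partial>lborel)
      \<le> (\<integral>\<^sup>+x. \<integral>\<^sup>+y. ennreal (gker K s (\<epsilon> n) (x - y)) * ennreal (K * Hn n y) \<partial>lborel \<partial>lborel)"
    proof (rule nn_integral_mono)
      fix x
      show "ennreal (indicator ?B x * Dn n s x) \<le> (\<integral>\<^sup>+y. ennreal (gker K s (\<epsilon> n) (x - y)) * ennreal (K * Hn n y) \<partial>lborel)"
        using pw[OF s(1,3) bs(1)[of x s]] s by (cases "x \<in> ?B") (auto simp: Dn_def)
    qed
    also have "\<dots> = (\<integral>\<^sup>+z. ennreal (gker K s (\<epsilon> n) z) \<partial>lborel) * (\<integral>\<^sup>+y. ennreal (K * Hn n y) \<partial>lborel)"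
      using Hn_int[of n] by (intro nn_integral_convolution) auto
    also have "(\<integral>\<^sup>+z. ennreal (gker K s (\<epsilon> n) z) \<partial>lborel) = ennreal (64 * (1 + K) * s)"
      by (rule gker_integral[OF s(1) eps(1) K])
    also have "(\<integral>\<^sup>+y. ennreal (K * Hn n y) \<partial>lborel) = ennreal (K * integral\<^sup>L lborel (Hn n))"
      using Hn_int[of n] Hn_nonneg K by (subst nn_integral_eq_integral) auto
    also have "ennreal (64 * (1 + K) * s) * ennreal (K * integral\<^sup>L lborel (Hn n)) \<le> ennreal (64 * (1 + K) * s) * ennreal (K * M)"
      using Hn_le[of n] K by (intro mult_left_mono ennreal_leI) auto
    also have "\<dots> = ennreal (K1 * s)"
      using K M0 s by (subst ennreal_mult[symmetric]) (auto simp: K1_def mult_ac)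
    finally show ?thesis .
  qed
  have est: "(\<integral>\<^sup>+x. ennreal (indicator ?B x * D s x) \<partial>lborel) \<le> ennreal (K1 * s)" if s: "0 < s" "s \<le> s0" for s
  proof -
    \<comment> \<open>Pointwise convergence for fixed s, on which Fatou's lemma acts.\<close>
    have L: "(\<lambda>n. ennreal (indicator ?B x * Dn n s x)) \<longlonglongrightarrow> ennreal (indicator ?B x * D s x)" for x
    proof (cases "x \<in> ?B")
      case True
      have "(\<lambda>n. mat_of (\<lambda>j. mol s (rn n j) x)) \<longlonglongrightarrow> mat_of (\<lambda>j. mol s (r j) x)"
      proof (rule vec_tendstoI, rule vec_tendstoI)
        fix i j
        show "(\<lambda>n. mat_of (\<lambda>j. mol s (rn n j) x) $ i $ j) \<longlonglongrightarrow> mat_of (\<lambda>j. mol s (r j) x) $ i $ j"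
          using tendsto_vec_nth[OF mol_tendsto[OF s(1) bs(2)[OF True s], of j], of i] by simp
      qed
      then have "(\<lambda>n. Dn n s x) \<longlonglongrightarrow> D s x" unfolding Dn_def D_def by (intro tendsto_infdist)
      then show ?thesis by (intro tendsto_ennrealI tendsto_mult tendsto_const)
    qed simp
    have "(\<integral>\<^sup>+x. ennreal (indicator ?B x * D s x) \<partial>lborel) = (\<integral>\<^sup>+x. liminf (\<lambda>n. ennreal (indicator ?B x * Dn n s x)) \<partial>lborel)"
      by (intro nn_integral_cong lim_imp_Liminf[symmetric] L) simp
    also have "\<dots> \<le> liminf (\<lambda>n. \<integral>\<^sup>+x. ennreal (indicator ?B x * Dn n s x) \<partial>lborel)"
      using measm(2)[OF s(1)] by (intro nn_integral_liminf) auto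
    also have "\<dots> \<le> limsup (\<lambda>n. \<integral>\<^sup>+x. ennreal (indicator ?B x * Dn n s x) \<partial>lborel)"
      by (rule Liminf_le_Limsup) simp
    also have "\<dots> \<le> ennreal (K1 * s)"
    proof (rule Limsup_bounded)
      have "\<forall>\<^sub>F n in sequentially. \<epsilon> n < s" using order_tendstoD(2)[OF eps(2) s(1)] .
      then show "\<forall>\<^sub>F n in sequentially. (\<integral>\<^sup>+x. ennreal (indicator ?B x * Dn n s x) \<partial>lborel) \<le> ennreal (K1 * s)"
        by eventually_elim (rule est_n[OF s less_imp_le])
    qed
    finally show ?thesis .
  qed
  have lim: "((\<lambda>s. K1 * s + 3 * (\<Sum>j\<in>UNIV. LBINT x. norm (mol s (r j) x - r j x))) \<longlongrightarrow> K1 * 0 + 3 * (\<Sum>j\<in>(UNIV::3 set). 0)) (at_right 0)"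
    by (intro tendsto_intros mol_L1_tendsto r_int)
  have "(\<integral>\<^sup>+x. ennreal (indicator ?B x * D0 x) \<partial>lborel) \<le> ennreal (K1 * s + 3 * (\<Sum>j\<in>UNIV. LBINT x. norm (mol s (r j) x - r j x)))"
    if s: "0 < s" "s \<le> s0" for s
  proof -
    have im: "integrable lborel (\<lambda>x. norm (mol s (r j) x - r j x))" for j
      using tconv_integrable[OF tbump_moll[OF s(1)] r_int[of j]] r_int[of j] by auto
    let ?E = "\<lambda>x. 3 * (\<Sum>j\<in>(UNIV::3 set). norm (mol s (r j) x - r j x))"
    have Ei: "integrable lborel ?E" by (intro integrable_mult_right Bochner_Integration.integrable_sum im)
    have E0: "?E x \<ge> 0" for x by (intro mult_nonneg_nonneg sum_nonneg) auto
    have "(\<integral>\<^sup>+x. ennreal (indicator ?B x * D0 x) \<partial>lborel) \<le> (\<integral>\<^sup>+x. ennreal (indicator ?B x * D s x) + ennreal (?E x) \<partial>lborel)"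
    proof (rule nn_integral_mono)
      fix x
      have "D0 x \<le> D s x + dist (mat_of (\<lambda>j. r j x)) (mat_of (\<lambda>j. mol s (r j) x))"
        unfolding D0_def D_def using infdist_triangle[of "mat_of (\<lambda>j. r j x)" SO3 "mat_of (\<lambda>j. mol s (r j) x)"] .
      also have "\<dots> \<le> D s x + ?E x"
        using dist_mat_of_le[of "\<lambda>j. mol s (r j) x" "\<lambda>j. r j x"] by (simp add: dist_commute)
      finally have "indicator ?B x * D0 x \<le> indicator ?B x * D s x + ?E x"
        using E0[of x] by (cases "x \<in> ?B") auto
      then have "ennreal (indicator ?B x * D0 x) \<le> ennreal (indicator ?B x * D s x + ?E x)"
        by (rule ennreal_leI)
      moreover have "indicator ?B x * D s x \<ge> 0" by (simp add: D_def infdist_nonneg)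
      ultimately show "ennreal (indicator ?B x * D0 x) \<le> ennreal (indicator ?B x * D s x) + ennreal (?E x)"
        by (subst (asm) ennreal_plus[OF _ E0[of x]])
    qed
    also have "\<dots> = (\<integral>\<^sup>+x. ennreal (indicator ?B x * D s x) \<partial>lborel) + (\<integral>\<^sup>+x. ennreal (?E x) \<partial>lborel)"
      using measm(1)[OF s(1)] Ei by (intro nn_integral_add) auto
    also have "(\<integral>\<^sup>+x. ennreal (?E x) \<partial>lborel) = ennreal (integral\<^sup>L lborel ?E)"
      using Ei E0 by (intro nn_integral_eq_integral) auto
    also have "integral\<^sup>L lborel ?E = 3 * (\<Sum>j\<in>(UNIV::3 set). LBINT x. norm (mol s (r j) x - r j x))"
      using im by (simp add: Bochner_Integration.integral_sum)
    also have "(\<integral>\<^sup>+x. ennreal (indicator ?B x * D s x) \<partial>lborel) + ennreal (3 * (\<Sum>j\<in>(UNIV::3 set). LBINT x. norm (mol s (r j) x - r j x)))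
       \<le> ennreal (K1 * s) + ennreal (3 * (\<Sum>j\<in>(UNIV::3 set). LBINT x. norm (mol s (r j) x - r j x)))"
      by (intro add_right_mono est s)
    also have "\<dots> = ennreal (K1 * s + 3 * (\<Sum>j\<in>UNIV. LBINT x. norm (mol s (r j) x - r j x)))"
      using K1 s by (intro ennreal_plus[symmetric] mult_nonneg_nonneg sum_nonneg Bochner_Integration.integral_nonneg) auto
    finally show ?thesis .
  qed
  then have "\<forall>\<^sub>F s in at_right 0. (\<integral>\<^sup>+x. ennreal (indicator ?B x * D0 x) \<partial>lborel) \<le> ennreal (K1 * s + 3 * (\<Sum>j\<in>UNIV. LBINT x. norm (mol s (r j) x - r j x)))"
    using s0 unfolding eventually_at_right_field by (auto intro!: exI[of _ s0])
  from tendsto_lowerbound[OF tendsto_ennrealI[OF lim] this]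
  have "(\<integral>\<^sup>+x. ennreal (indicator ?B x * D0 x) \<partial>lborel) = 0" by simp
  then have "AE x in lborel. ennreal (indicator ?B x * D0 x) = 0"
    by (subst (asm) nn_integral_0_iff_AE) auto
  then show ?thesis
  proof eventually_elim
    case (elim x)
    show ?case
    proof
      assume "x \<in> ?B"
      then have "D0 x = 0" using elim infdist_nonneg[of "mat_of (\<lambda>j. r j x)" SO3] by (auto simp: D0_def)
      then have "mat_of (\<lambda>j. r j x) \<in> SO3"
        using in_closed_iff_infdist_zero[OF closed_SO3 SO3_ne] by (simp add: D0_def)
      then show "rotation_matrix (mat_of (\<lambda>j. r j x))" by (simp add: SO3_def)
    qed
  qed
qed

theorem locally_rigid:
  assumes s0: "0 < s0" and box: "cbox (x0 - vec (3 * s0)) (x0 + vec (3 * s0)) \<subseteq> \<Omega>"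
  shows "\<exists>R c. rotation_matrix R \<and> (AE x in lborel. x \<in> cbox (x0 - vec (s0 / 2)) (x0 + vec (s0 / 2)) \<longrightarrow> u x = R *v x + c)"
proof -
  let ?B = "cbox (x0 - vec s0) (x0 + vec s0)"
  have "?B \<subseteq> cbox (x0 - vec (3 * s0)) (x0 + vec (3 * s0))"
    using cbox_shift_subset[of x0 x0 x0 s0 "3 * s0"] s0 by (auto simp: mem_box_cart)
  then have B: "?B \<subseteq> \<Omega>" using box by blast
  interpret rigid_gradient ?B u r
    by unfold_locales (use wpart_subset[OF w B] limit_rotation[OF s0 box] in auto)
  have e: "x0 - vec (s0 / 2) - vec (s0 / 2) = x0 - vec s0" "x0 + vec (s0 / 2) + vec (s0 / 2) = x0 + vec s0"
    by (simp_all add: vec_eq_iff)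
  have "\<exists>R c. rotation_matrix R \<and> (AE x in lborel. x \<in> cbox (x0 - vec (s0 / 2)) (x0 + vec (s0 / 2)) \<longrightarrow>
     u x = R *v x + c \<and> (\<forall>j. r j x = R *v axis j 1))"
  proof (rule rigid[of "s0 / 2"])
    show "0 < s0 / 2" using s0 by simp
    show "cbox (x0 - vec (s0 / 2) - vec (s0 / 2)) (x0 + vec (s0 / 2) + vec (s0 / 2)) \<subseteq> ?B"
      unfolding e by (rule subset_refl)
  qed
  then show ?thesis by (auto elim!: eventually_mono)
qed

end

subsection \<open>Borel representatives\<close>

text \<open>The hypotheses concern Lebesgue measurable functions on a subset, arbitrary elsewhere;
  the estimates concern Borel functions integrable on the whole space. Equality of the L^1 norms
  carries the uniform bounds over.\<close>

definition is_rep :: "'a::euclidean_space set \<Rightarrow> ('a \<Rightarrow> 'b::euclidean_space) \<Rightarrow> ('a \<Rightarrow> 'b) \<Rightarrow> bool" where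
  "is_rep S f f' \<longleftrightarrow> integrable lborel f' \<and> (AE x in lborel. x \<in> S \<longrightarrow> f' x = f x) \<and>
     (LBINT x. norm (f' x)) = (\<integral>x. norm (f x) \<partial>lebesgue_on S)"

lemma borel_representative:
  fixes F :: "'a::euclidean_space \<Rightarrow> 'b::euclidean_space"
  assumes "F \<in> borel_measurable lebesgue"
  obtains f' where "f' \<in> borel_measurable borel" "AE x in lborel. F x = f' x"
proof -
  have "\<exists>g. g \<in> borel_measurable borel \<and> (AE x in lborel. F x \<bullet> b = g x)" for b
    using completion_ex_borel_measurable_real[of "\<lambda>x. F x \<bullet> b" lborel] assms by auto
  then obtain g where g: "\<And>b. g b \<in> borel_measurable borel" "\<And>b. AE x in lborel. F x \<bullet> b = g b x" by metis
  have "AE x in lborel. \<forall>b\<in>Basis. F x \<bullet> b = g b x"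
    using g(2) by (intro AE_finite_allI) auto
  then have "AE x in lborel. F x = (\<Sum>b\<in>Basis. g b x *\<^sub>R b)"
  proof eventually_elim
    case (elim x)
    then show ?case using euclidean_representation[of "F x"] by simp
  qed
  moreover have "(\<lambda>x. \<Sum>b\<in>Basis. g b x *\<^sub>R b) \<in> borel_measurable borel" using g(1) by measurable
  ultimately show thesis using that by blast
qed

lemma integrable_representative:
  fixes f :: "'a::euclidean_space \<Rightarrow> 'b::euclidean_space"
  assumes S: "S \<in> sets lebesgue" and f: "integrable (lebesgue_on S) f"
  shows "\<exists>f'. is_rep S f f'"
proof -
  let ?F = "\<lambda>x. indicator S x *\<^sub>R f x"
  have F: "integrable lebesgue ?F" using f S by (subst (asm) integrable_restrict_space) auto
  obtain f' where f': "f' \<in> borel_measurable borel" "AE x in lborel. ?F x = f' x"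
    using borel_representative[OF borel_measurable_integrable[OF F]] by blast
  have ae: "AE x in lebesgue. ?F x = f' x" by (rule AE_completion[OF f'(2)])
  have m: "f' \<in> borel_measurable lebesgue" using f'(1) by (simp add: measurable_completion)
  have "integrable lebesgue f'"
    using integrable_cong_AE[OF borel_measurable_integrable[OF F] m ae] F by simp
  then have i: "integrable lborel f'" using f'(1) by (simp add: integrable_completion)
  have "AE x in lborel. x \<in> S \<longrightarrow> f' x = f x" using f'(2) by eventually_elim auto
  moreover have "(LBINT x. norm (f' x)) = (\<integral>x. norm (f x) \<partial>lebesgue_on S)"
  proof -
    have "(\<integral>x. norm (f x) \<partial>lebesgue_on S) = (\<integral>x. norm (?F x) \<partial>lebesgue)"
      using S by (subst integral_restrict_space) auto
    also have "\<dots> = (\<integral>x. norm (f' x) \<partial>lebesgue)"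
    proof (rule integral_cong_AE)
      show "AE x in lebesgue. norm (?F x) = norm (f' x)" using ae by eventually_elim (simp only:)
      show "(\<lambda>x. norm (?F x)) \<in> borel_measurable lebesgue"
        by (rule measurable_compose[OF borel_measurable_integrable[OF F] borel_measurable_norm])
      show "(\<lambda>x. norm (f' x)) \<in> borel_measurable lebesgue" by (rule measurable_compose[OF m borel_measurable_norm])
    qed
    also have "\<dots> = (LBINT x. norm (f' x))" using f'(1) by (intro integral_completion) auto
    finally show ?thesis by simp
  qed
  ultimately show ?thesis using i unfolding is_rep_def by blast
qed

lemma rep_integral:
  fixes f :: "'a::euclidean_space \<Rightarrow> 'b::euclidean_space"
  assumes S: "S \<in> sets lebesgue" and f: "f \<in> borel_measurable (lebesgue_on S)" and r: "is_rep S f f'"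
    and h: "h \<in> borel_measurable borel" "\<And>x. x \<notin> S \<Longrightarrow> h x = 0"
  shows "(\<integral>x. h x *\<^sub>R f x \<partial>lebesgue_on S) = (LBINT x. h x *\<^sub>R f' x)"
proof -
  have f': "f' \<in> borel_measurable borel" "AE x in lborel. x \<in> S \<longrightarrow> f' x = f x"
    using r unfolding is_rep_def by auto
  have fm: "(\<lambda>x. if x \<in> S then f x else 0) \<in> borel_measurable lebesgue"
    using borel_measurable_if_I[OF f S] .
  have hm: "h \<in> borel_measurable lebesgue" using h(1) by (simp add: measurable_completion)
  have "(\<integral>x. h x *\<^sub>R f x \<partial>lebesgue_on S) = (\<integral>x. indicator S x *\<^sub>R (h x *\<^sub>R f x) \<partial>lebesgue)"
    using S by (subst integral_restrict_space) auto
  also have "\<dots> = (\<integral>x. h x *\<^sub>R (if x \<in> S then f x else 0) \<partial>lebesgue)"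
    by (rule Bochner_Integration.integral_cong) (auto simp: indicator_def)
  also have "\<dots> = (\<integral>x. h x *\<^sub>R f' x \<partial>lebesgue)"
  proof (rule integral_cong_AE)
    show "AE x in lebesgue. h x *\<^sub>R (if x \<in> S then f x else 0) = h x *\<^sub>R f' x"
      using AE_completion[OF f'(2)] by eventually_elim (use h(2) in auto)
    have f'm: "f' \<in> borel_measurable lebesgue" using f'(1) by (simp add: measurable_completion)
    show "(\<lambda>x. h x *\<^sub>R (if x \<in> S then f x else 0)) \<in> borel_measurable lebesgue" by (rule borel_measurable_scaleR[OF hm fm])
    show "(\<lambda>x. h x *\<^sub>R f' x) \<in> borel_measurable lebesgue" by (rule borel_measurable_scaleR[OF hm f'm])
  qed
  also have "\<dots> = (LBINT x. h x *\<^sub>R f' x)"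
    using f' h by (intro integral_completion) auto
  finally show ?thesis .
qed

text \<open>Tensor products with a box inside \<open>U\<close> are test functions, and their
  integrals do not distinguish a function from its representative.\<close>

lemma rep_wpart:
  assumes U: "open U" and wp: "has_weak_partial U i f g"
    and f: "f \<in> borel_measurable (lebesgue_on U)" "is_rep U f f'"
    and g: "g \<in> borel_measurable (lebesgue_on U)" "is_rep U g g'"
  shows "wpart U i f' g'"
  unfolding wpart_def
proof (intro conjI allI impI)
  show "integrable lborel f'" "integrable lborel g'" using f g unfolding is_rep_def by auto
  fix a b h assume ab: "cbox a b \<subseteq> U" and h: "tbump a b h"
  have S: "U \<in> sets lebesgue" using U by auto
  have z: "tens h x = 0" "tens (dt i h) x = 0" if "x \<notin> U" for x
    using ab tens_zero[OF h] tens_zero[OF tbump_dt[OF h]] that by blast+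
  have "(LBINT y. tens (dt i h) y *\<^sub>R f' y) = (\<integral>y. tens (dt i h) y *\<^sub>R f y \<partial>lebesgue_on U)"
    by (rule rep_integral[OF S f tens_measurable[OF tbump_dt[OF h]] z(2), symmetric])
  also have "\<dots> = (\<integral>y. frechet_derivative (tens h) (at y) (axis i 1) *\<^sub>R f y \<partial>lebesgue_on U)"
    by (simp add: tens_frechet_derivative[OF h])
  also have "\<dots> = - (\<integral>y. tens h y *\<^sub>R g y \<partial>lebesgue_on U)"
    using wp tens_test_function[OF h ab] unfolding has_weak_partial_def by blast
  also have "(\<integral>y. tens h y *\<^sub>R g y \<partial>lebesgue_on U) = (LBINT y. tens h y *\<^sub>R g' y)"
    by (rule rep_integral[OF S g tens_measurable[OF h] z(1)])
  finally show "(LBINT y. tens (dt i h) y *\<^sub>R f' y) = - (LBINT y. tens h y *\<^sub>R g' y)" .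
qed

lemma weak_partial_works: "weakly_differentiable U i f \<Longrightarrow> has_weak_partial U i f (weak_partial U i f)"
  unfolding weak_partial_def using someI_ex[of "has_weak_partial U i f"] by (simp add: weakly_differentiable_def)

text \<open>Local integrability gives measurability on compact subsets, and an exhaustion transfers
  it to \<open>U\<close>. It is needed for the second derivatives, whose bound is a nonnegative
  integral and says nothing about measurability.\<close>

lemma has_weak_partial_measurable:
  fixes f :: "real^'n::finite \<Rightarrow> 'b::euclidean_space"
  assumes U: "open U" and wp: "has_weak_partial U i f g"
  shows "g \<in> borel_measurable (lebesgue_on U)"
proof -
  obtain C where C: "\<And>n. compact (C n)" "\<And>n. C n \<subseteq> U" "\<And>n. C n \<subseteq> interior (C (Suc n))" "\<Union>(range C) = U"
    using open_Union_compact_subsets[OF U] by metis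
  have g: "integrable (lebesgue_on (C n)) g" for n
    using wp C(1,2)[of n] unfolding has_weak_partial_def locally_integrable_on_def by blast
  have Cs: "C n \<in> sets lebesgue" for n using C(1)[of n] by (simp add: compact_imp_closed)
  have m: "(\<lambda>x. if x \<in> C n then g x else 0) \<in> borel_measurable lebesgue" for n
    using borel_measurable_if_I[OF borel_measurable_integrable[OF g] Cs] .
  have mono: "C n \<subseteq> C m" if "n \<le> m" for n m
    using that by (rule lift_Suc_mono_le[rotated]) (use C(3) interior_subset in blast)
  have lim: "(\<lambda>n. if x \<in> C n then g x else 0) \<longlonglongrightarrow> (if x \<in> U then g x else 0)" for x
  proof (cases "x \<in> U")
    case True
    then obtain N where "x \<in> C N" using C(4) by blast
    then have "\<forall>n\<ge>N. x \<in> C n" using mono by blast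
    then show ?thesis using True by (intro tendsto_eventually) (auto simp: eventually_sequentially)
  next
    case False
    then have "x \<notin> C n" for n using C(2) by blast
    then show ?thesis using False by simp
  qed
  have "(\<lambda>x. if x \<in> U then g x else 0) \<in> borel_measurable lebesgue"
    by (rule borel_measurable_LIMSEQ_metric[OF m lim])
  then show ?thesis using borel_measurable_if[of U g] U by auto
qed

subsection \<open>Integrability on bounded domains\<close>

text \<open>Replaces Hoelder's inequality: on sets of finite measure it bounds L^1 norms by L^p
  norms, which is the only way the exponent enters the estimates.\<close>

lemma le_one_plus_powr: "0 \<le> t \<Longrightarrow> 1 \<le> p \<Longrightarrow> t \<le> 1 + t powr p" for t p :: real
proof (cases "t \<le> 1")
  case True
  then show ?thesis using powr_ge_zero[of t p] by linarith
next
  case False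
  assume "1 \<le> p"
  then have "t powr 1 \<le> t powr p" using False by (intro powr_mono) auto
  then show ?thesis using False by simp
qed

lemma in_Lp_integrable:
  assumes U: "U \<in> lmeasurable" and p: "1 \<le> p" and f: "in_Lp p U f"
  shows "integrable (lebesgue_on U) f"
    and "(\<integral>x. norm (f x) \<partial>lebesgue_on U) \<le> measure lebesgue U + (\<integral>x. norm (f x) powr p \<partial>lebesgue_on U)"
proof -
  interpret finite_measure "lebesgue_on U" by (rule finite_measure_lebesgue_on[OF U])
  have fm: "f \<in> borel_measurable (lebesgue_on U)" and fp: "integrable (lebesgue_on U) (\<lambda>x. norm (f x) powr p)"
    using f unfolding in_Lp_def by auto
  have i: "integrable (lebesgue_on U) (\<lambda>x. 1 + norm (f x) powr p)" using fp by auto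
  show fi: "integrable (lebesgue_on U) f"
    by (rule Bochner_Integration.integrable_bound[OF i fm]) (use le_one_plus_powr[OF _ p] in auto)
  have "(\<integral>x. norm (f x) \<partial>lebesgue_on U) \<le> (\<integral>x. 1 + norm (f x) powr p \<partial>lebesgue_on U)"
    using le_one_plus_powr[OF _ p] by (intro integral_mono integrable_norm fi i) auto
  also have "\<dots> = measure (lebesgue_on U) U + (\<integral>x. norm (f x) powr p \<partial>lebesgue_on U)"
    using fp by simp
  also have "measure (lebesgue_on U) U = measure lebesgue U"
    using U by (simp add: measure_restrict_space fmeasurableD)
  finally show "(\<integral>x. norm (f x) \<partial>lebesgue_on U) \<le> measure lebesgue U + (\<integral>x. norm (f x) powr p \<partial>lebesgue_on U)" .
qed

lemma Lp_norm_pow_eq: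
  assumes "in_Lp p U f" shows "enn2real (Lp_norm_pow p U f) = (\<integral>x. norm (f x) powr p \<partial>lebesgue_on U)"
  using assms unfolding Lp_norm_pow_def in_Lp_def
  by (subst nn_integral_eq_integral) (auto intro!: Bochner_Integration.integral_nonneg)

lemma in_Lp_if_Lp_norm_pow_finite:
  assumes "f \<in> borel_measurable (lebesgue_on U)" "Lp_norm_pow p U f < \<infinity>"
  shows "in_Lp p U f"
  using assms unfolding in_Lp_def Lp_norm_pow_def by (auto intro!: integrableI_bounded)

text \<open>Dividing \<open>f\<close> by its Sobolev norm N before using t <= 1 + t^p makes the
  bound homogeneous, as boundedness of a functional requires. If N = 0, then \<open>f\<close>
  vanishes almost everywhere.\<close>

lemma L1_le_sobolev_norm:
  assumes U: "U \<in> lmeasurable" and p: "1 \<le> p" and f: "f \<in> sobolev_W1 p U"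
  shows "(\<integral>x. norm (f x) \<partial>lebesgue_on U) \<le> (measure lebesgue U + 1) * sobolev_norm p U f"
proof -
  have fl: "in_Lp p U f" using f unfolding sobolev_W1_def by blast
  define I where "I = (\<integral>x. norm (f x) powr p \<partial>lebesgue_on U)"
  define J where "J = (\<Sum>i\<in>UNIV. enn2real (Lp_norm_pow p U (weak_partial U i f)))"
  define N where "N = sobolev_norm p U f"
  have I0: "I \<ge> 0" and J0: "J \<ge> 0" unfolding I_def J_def by (auto intro!: sum_nonneg Bochner_Integration.integral_nonneg)
  have N: "N = (I + J) powr (1 / p)" unfolding N_def sobolev_norm_def I_def J_def Lp_norm_pow_eq[OF fl] by simp
  have fp: "integrable (lebesgue_on U) (\<lambda>x. norm (f x) powr p)" using fl unfolding in_Lp_def by auto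
  note fi = in_Lp_integrable(1)[OF U p fl]
  interpret finite_measure "lebesgue_on U" by (rule finite_measure_lebesgue_on[OF U])
  have mU: "measure (lebesgue_on U) U = measure lebesgue U"
    using U by (simp add: measure_restrict_space fmeasurableD)
  show ?thesis
  proof (cases "I + J = 0")
    case True
    then have "I = 0" using I0 J0 by linarith
    then have "AE x in lebesgue_on U. norm (f x) powr p = 0"
      unfolding I_def by (subst (asm) integral_nonneg_eq_0_iff_AE[OF fp]) auto
    then have "AE x in lebesgue_on U. norm (f x) = 0" by eventually_elim auto
    then have "(\<integral>x. norm (f x) \<partial>lebesgue_on U) = (\<integral>x. 0 \<partial>lebesgue_on U)"
      using fi by (intro integral_cong_AE) auto
    then show ?thesis by (simp add: N_def[symmetric] N)
  next
    case False
    then have IJ: "I + J > 0" using I0 J0 by linarith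
    then have N0: "N > 0" unfolding N by simp
    have Np: "N powr p = I + J" unfolding N using p IJ by (simp add: powr_powr)
    have le: "norm (f x) \<le> N + N / (I + J) * norm (f x) powr p" for x
    proof -
      have "norm (f x) / N \<le> 1 + (norm (f x) / N) powr p" using N0 p by (intro le_one_plus_powr) auto
      also have "(norm (f x) / N) powr p = norm (f x) powr p / (I + J)" using N0 by (simp add: powr_divide Np)
      finally show ?thesis using N0 by (simp add: field_simps)
    qed
    have "(\<integral>x. norm (f x) \<partial>lebesgue_on U) \<le> (\<integral>x. N + N / (I + J) * norm (f x) powr p \<partial>lebesgue_on U)"
      using le fp by (intro integral_mono integrable_norm fi) auto
    also have "\<dots> = N * measure lebesgue U + N / (I + J) * I"
      using fp mU by (simp add: I_def)
    also have "\<dots> \<le> N * measure lebesgue U + N"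
    proof -
      have "I / (I + J) \<le> 1" using IJ J0 by simp
      then have "N * (I / (I + J)) \<le> N * 1" using N0 by (intro mult_left_mono) auto
      then show ?thesis by simp
    qed
    finally show ?thesis unfolding N_def[symmetric] by (simp add: algebra_simps)
  qed
qed

text \<open>These functionals do not involve \<open>weak_partial\<close>, so that their linearity does not require the
  uniqueness of weak derivatives.\<close>

lemma tens_functional_dual:
  fixes U :: "(real^'n::finite) set"
  assumes U: "U \<in> lmeasurable" and p: "1 \<le> p" and g: "tbump a b g"
  shows "(\<lambda>v :: real^'n \<Rightarrow> real^'m. \<integral>y. tens g y * v y $ m \<partial>lebesgue_on U) \<in> sobolev_dual p U"
proof -
  obtain B where B: "B > 0" "\<And>x. \<bar>tens g x\<bar> \<le> B" using tens_bounded[OF g] by blast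
  have gm: "tens g \<in> borel_measurable (lebesgue_on U)"
    using tens_measurable[OF g] by (intro measurable_restrict_space1 measurable_completion) auto
  have iv: "integrable (lebesgue_on U) v" if "v \<in> sobolev_W1 p U" for v :: "real^'n \<Rightarrow> real^'m"
    using in_Lp_integrable(1)[OF U p] that unfolding sobolev_W1_def by blast
  have le: "\<bar>tens g y * v $ m\<bar> \<le> B * norm v" for y and v :: "real^'m"
    unfolding abs_mult using B component_le_norm_cart[of v m] by (intro mult_mono) auto
  have ig: "integrable (lebesgue_on U) (\<lambda>y. tens g y * v y $ m)" if v: "v \<in> sobolev_W1 p U" for v :: "real^'n \<Rightarrow> real^'m"
  proof (rule Bochner_Integration.integrable_bound)
    show "integrable (lebesgue_on U) (\<lambda>y. B * norm (v y))" using iv[OF v] by auto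
    have "(\<lambda>y. v y $ m) \<in> borel_measurable (lebesgue_on U)"
      using measurable_compose[OF borel_measurable_integrable[OF iv[OF v]], of "\<lambda>v. v $ m" borel]
      by (auto intro!: borel_measurable_continuous_onI continuous_intros)
    then show "(\<lambda>y. tens g y * v y $ m) \<in> borel_measurable (lebesgue_on U)" using gm by (rule borel_measurable_times[rotated])
    show "AE y in lebesgue_on U. norm (tens g y * v y $ m) \<le> norm (B * norm (v y))"
      using le B by (auto simp: order_trans[OF _ abs_ge_self])
  qed
  have bd: "\<bar>\<integral>y. tens g y * v y $ m \<partial>lebesgue_on U\<bar> \<le> (B * (measure lebesgue U + 1)) * sobolev_norm p U v"
    if v: "v \<in> sobolev_W1 p U" for v :: "real^'n \<Rightarrow> real^'m"
  proof -
    have "\<bar>\<integral>y. tens g y * v y $ m \<partial>lebesgue_on U\<bar> \<le> (\<integral>y. \<bar>tens g y * v y $ m\<bar> \<partial>lebesgue_on U)"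
      by (rule integral_abs_bound)
    also have "\<dots> \<le> (\<integral>y. B * norm (v y) \<partial>lebesgue_on U)"
      using le ig[OF v] iv[OF v] by (intro integral_mono integrable_abs) auto
    also have "\<dots> \<le> B * ((measure lebesgue U + 1) * sobolev_norm p U v)"
      using L1_le_sobolev_norm[OF U p v] B by simp
    finally show ?thesis by (simp add: mult_ac)
  qed
  show ?thesis
    unfolding sobolev_dual_def
  proof (intro CollectI conjI ballI allI)
    fix v w :: "real^'n \<Rightarrow> real^'m" assume vw: "v \<in> sobolev_W1 p U" "w \<in> sobolev_W1 p U"
    show "(\<integral>y. tens g y * (v y + w y) $ m \<partial>lebesgue_on U) =
      (\<integral>y. tens g y * v y $ m \<partial>lebesgue_on U) + (\<integral>y. tens g y * w y $ m \<partial>lebesgue_on U)"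
      using ig[OF vw(1)] ig[OF vw(2)] by (simp add: distrib_left)
  next
    fix c and v :: "real^'n \<Rightarrow> real^'m"
    have "(\<lambda>y. tens g y * (c *\<^sub>R v y) $ m) = (\<lambda>y. c * (tens g y * v y $ m))" by (simp add: fun_eq_iff)
    then show "(\<integral>y. tens g y * (c *\<^sub>R v y) $ m \<partial>lebesgue_on U) = c * (\<integral>y. tens g y * v y $ m \<partial>lebesgue_on U)"
      by simp
  next
    show "\<exists>C. \<forall>v\<in>sobolev_W1 p U. \<bar>\<integral>y. tens g y * (v :: real^'n \<Rightarrow> real^'m) y $ m \<partial>lebesgue_on U\<bar> \<le> C * sobolev_norm p U v"
      using bd by blast
  qed
qed

text \<open>Weak convergence is stated for real functionals, so that the vector-valued integral is
  treated by components.\<close>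

lemma weak_convergence_tens:
  fixes U :: "(real^'n::finite) set" and us :: "nat \<Rightarrow> real^'n \<Rightarrow> real^'m::finite"
  assumes U: "open U" "U \<in> lmeasurable" and p: "1 \<le> p" and g: "tbump a b g" "cbox a b \<subseteq> U"
    and wc: "sobolev_weakly_converges p U us u"
    and r: "\<And>n. is_rep U (us n) (un n)" "is_rep U u u'"
  shows "(\<lambda>n. LBINT y. tens g y *\<^sub>R un n y) \<longlonglongrightarrow> (LBINT y. tens g y *\<^sub>R u' y)"
proof (rule vec_tendstoI)
  fix m
  have S: "U \<in> sets lebesgue" using U by auto
  have z: "tens g x = 0" if "x \<notin> U" for x using tens_zero[OF g(1)] g(2) that by blast
  have eq: "(LBINT y. tens g y *\<^sub>R v' y) $ m = (\<integral>y. tens g y * v y $ m \<partial>lebesgue_on U)"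
    if v: "v \<in> sobolev_W1 p U" and v': "is_rep U v v'" for v v' :: "real^'n \<Rightarrow> real^'m"
  proof -
    have iv: "integrable (lebesgue_on U) v"
      using in_Lp_integrable(1)[OF U(2) p] v unfolding sobolev_W1_def by blast
    obtain B where B: "\<And>x. \<bar>tens g x\<bar> \<le> B" using tens_bounded[OF g(1)] by blast
    have gm: "tens g \<in> borel_measurable (lebesgue_on U)"
      using tens_measurable[OF g(1)] by (intro measurable_restrict_space1 measurable_completion) auto
    have ig: "integrable (lebesgue_on U) (\<lambda>y. tens g y *\<^sub>R v y)"
    proof (rule Bochner_Integration.integrable_bound)
      show "integrable (lebesgue_on U) (\<lambda>y. B * norm (v y))" using iv by auto
      show "(\<lambda>y. tens g y *\<^sub>R v y) \<in> borel_measurable (lebesgue_on U)" using gm iv by auto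
      have "norm (tens g y *\<^sub>R v y) \<le> norm (B * norm (v y))" for y
        using B[of y] by (auto simp: abs_mult intro!: mult_right_mono)
      then show "AE y in lebesgue_on U. norm (tens g y *\<^sub>R v y) \<le> norm (B * norm (v y))" by simp
    qed
    have "(LBINT y. tens g y *\<^sub>R v' y) = (\<integral>y. tens g y *\<^sub>R v y \<partial>lebesgue_on U)"
      by (rule rep_integral[OF S borel_measurable_integrable[OF iv] v' tens_measurable[OF g(1)] z, symmetric])
    also have "\<dots> $ m = (\<integral>y. (tens g y *\<^sub>R v y) $ m \<partial>lebesgue_on U)"
      by (rule integral_bounded_linear[OF bounded_linear_vec_nth ig, symmetric])
    finally show ?thesis by simp
  qed
  let ?F = "\<lambda>v :: real^'n \<Rightarrow> real^'m. \<integral>y. tens g y * v y $ m \<partial>lebesgue_on U"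
  have "?F \<in> sobolev_dual p U" by (rule tens_functional_dual[OF U(2) p g(1)])
  then have "(\<lambda>n. ?F (us n)) \<longlonglongrightarrow> ?F u"
    using bspec[of "sobolev_dual p U" "\<lambda>F. (\<lambda>n. F (us n)) \<longlonglongrightarrow> F u" ?F] wc
    unfolding sobolev_weakly_converges_def by simp
  moreover have "u \<in> sobolev_W1 p U" "us n \<in> sobolev_W1 p U" for n
    using wc unfolding sobolev_weakly_converges_def by auto
  ultimately show "(\<lambda>n. (LBINT y. tens g y *\<^sub>R un n y) $ m) \<longlonglongrightarrow> (LBINT y. tens g y *\<^sub>R u' y) $ m"
    by (simp only: eq[OF _ r(1)] eq[OF _ r(2)])
qed

subsection \<open>Locally rigid maps on connected domains\<close>

text \<open>The subset of \<open>U\<close> where the two maps differ is open and null, hence empty.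
  Increments along the axes then determine the matrices.\<close>

lemma affine_eq_of_AE:
  fixes R R' :: "real^'n::finite^'m::finite"
  assumes U: "open U" "U \<noteq> {}" and ae: "AE x in lborel. x \<in> U \<longrightarrow> R *v x + c = R' *v x + c'"
  shows "R = R'" "c = c'"
proof -
  let ?C = "{x. R *v x + c = R' *v x + c'}"
  have cont: "continuous_on UNIV (\<lambda>x. A *v x)" for A :: "real^'n^'m"
    by (intro linear_continuous_on matrix_vector_mul_bounded_linear)
  have "closed ?C" by (intro closed_Collect_eq continuous_intros cont)
  then have op: "open (U - ?C)" using U by auto
  have "AE x in lborel. x \<notin> U - ?C" using ae by eventually_elim auto
  then have "U - ?C \<in> null_sets lborel" using op by (subst AE_iff_null_sets) auto
  then have "negligible (U - ?C)" by (simp add: negligible_iff_null_sets null_sets_completionI)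
  then have "U - ?C = {}" using open_not_negligible[OF op] by blast
  then have eq: "R *v x + c = R' *v x + c'" if "x \<in> U" for x using that by blast
  obtain x e where x: "e > 0" "ball x e \<subseteq> U" using U open_contains_ball by blast
  have "R *v axis i 1 = R' *v axis i 1" for i
  proof -
    let ?y = "x + (e / 2) *\<^sub>R axis i 1"
    have "?y \<in> U" "x \<in> U" using x by (auto simp: dist_norm subset_iff)
    note e = eq[OF this(1)] eq[OF this(2)]
    have d: "A *v ?y - A *v x = (e / 2) *\<^sub>R (A *v axis i 1)" for A :: "real^'n^'m"
      by (simp add: matrix_vector_right_distrib matrix_vector_mult_scaleR)
    have "R *v ?y - R *v x = (R *v ?y + c) - (R *v x + c)" by simp
    also have "\<dots> = (R' *v ?y + c') - (R' *v x + c')" by (simp only: e)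
    also have "\<dots> = R' *v ?y - R' *v x" by simp
    finally have "(e / 2) *\<^sub>R (R *v axis i 1) = (e / 2) *\<^sub>R (R' *v axis i 1)" unfolding d .
    then show ?thesis using x by simp
  qed
  then show R: "R = R'" unfolding matrix_vector_mult_basis by (simp add: column_def vec_eq_iff)
  have "x \<in> U" using x by auto
  from eq[OF this] show "c = c'" using R by simp
qed

text \<open>Local motions with overlapping domains coincide by \<open>affine_eq_of_AE\<close>, so
  that the pair of rotation and translation is locally constant on a connected set.\<close>

lemma rigid_of_locally_rigid:
  fixes u :: "real^3 \<Rightarrow> real^3"
  assumes U: "open U" "connected U" "U \<noteq> {}"
    and loc: "\<And>x. x \<in> U \<Longrightarrow> \<exists>T R c. open T \<and> x \<in> T \<and> rotation_matrix R \<and> (AE y in lborel. y \<in> T \<longrightarrow> u y = R *v y + c)"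
  shows "\<exists>R c. rotation_matrix R \<and> (AE y in lborel. y \<in> U \<longrightarrow> u y = R *v y + c)"
proof -
  have "\<forall>x\<in>U. \<exists>q. open (fst q) \<and> x \<in> fst q \<and> rotation_matrix (fst (snd q)) \<and>
      (AE y in lborel. y \<in> fst q \<longrightarrow> u y = fst (snd q) *v y + snd (snd q))"
  proof
    fix x assume "x \<in> U"
    from loc[OF this] obtain T R c where "open T" "x \<in> T" "rotation_matrix R" "AE y in lborel. y \<in> T \<longrightarrow> u y = R *v y + c"
      by blast
    then show "\<exists>q. open (fst q) \<and> x \<in> fst q \<and> rotation_matrix (fst (snd q)) \<and>
      (AE y in lborel. y \<in> fst q \<longrightarrow> u y = fst (snd q) *v y + snd (snd q))"
      by (intro exI[of _ "(T, R, c)"]) simp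
  qed
  from bchoice[OF this] obtain q where q: "\<forall>x\<in>U. open (fst (q x)) \<and> x \<in> fst (q x) \<and> rotation_matrix (fst (snd (q x))) \<and>
      (AE y in lborel. y \<in> fst (q x) \<longrightarrow> u y = fst (snd (q x)) *v y + snd (snd (q x)))" by blast
  define T R c where "T x = fst (q x)" and "R x = fst (snd (q x))" and "c x = snd (snd (q x))" for x
  have T: "\<And>x. x \<in> U \<Longrightarrow> open (T x)" "\<And>x. x \<in> U \<Longrightarrow> x \<in> T x" "\<And>x. x \<in> U \<Longrightarrow> rotation_matrix (R x)"
    "\<And>x. x \<in> U \<Longrightarrow> (AE y in lborel. y \<in> T x \<longrightarrow> u y = R x *v y + c x)"
    using q unfolding T_def R_def c_def by auto
  have same: "R x = R y \<and> c x = c y" if "x \<in> U" "y \<in> U" "y \<in> T x" for x y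
  proof -
    have ae: "AE z in lborel. z \<in> T x \<inter> T y \<longrightarrow> R x *v z + c x = R y *v z + c y"
      using T(4)[OF that(1)] T(4)[OF that(2)] by eventually_elim auto
    have "open (T x \<inter> T y)" "T x \<inter> T y \<noteq> {}" using T(1,2) that by blast+
    from affine_eq_of_AE[OF this ae] show ?thesis by (rule conjI)
  qed
  have "(\<lambda>x. (R x, c x)) constant_on U"
  proof (rule locally_constant_imp_constant[OF U(2)])
    fix a assume a: "a \<in> U"
    show "\<exists>V. openin (top_of_set U) V \<and> a \<in> V \<and> (\<forall>x\<in>V. (R x, c x) = (R a, c a))"
    proof (intro exI[of _ "U \<inter> T a"] conjI ballI)
      show "openin (top_of_set U) (U \<inter> T a)" by (rule openin_open_Int[OF T(1)[OF a]])
      show "a \<in> U \<inter> T a" using a T(2) by blast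
      fix x assume "x \<in> U \<inter> T a"
      then have "R a = R x \<and> c a = c x" by (intro same[OF a]) auto
      then show "(R x, c x) = (R a, c a)" by (simp only:)
    qed
  qed
  then obtain R0 c0 where RC: "\<And>x. x \<in> U \<Longrightarrow> R x = R0 \<and> c x = c0" unfolding constant_on_def by auto
  \<comment> \<open>A countable subcover, so that the exceptional sets unite to a null set.\<close>
  obtain F where F: "F \<subseteq> T ` U" "countable F" "\<Union>F = \<Union>(T ` U)" using Lindelof[of "T ` U"] T(1) by blast
  have "AE y in lborel. \<forall>V\<in>F. y \<in> V \<longrightarrow> u y = R0 *v y + c0"
  proof (rule AE_ball_countable'[OF _ F(2)])
    fix V assume "V \<in> F"
    then obtain x where x: "x \<in> U" "V = T x" using F(1) by blast
    show "AE y in lborel. y \<in> V \<longrightarrow> u y = R0 *v y + c0" using T(4)[OF x(1)] RC[OF x(1)] x(2) by simp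
  qed
  then have "AE y in lborel. y \<in> U \<longrightarrow> u y = R0 *v y + c0"
  proof eventually_elim
    case (elim y)
    show ?case
    proof
      assume "y \<in> U"
      then have "y \<in> \<Union>F" using F(3) T(2) by blast
      then show "u y = R0 *v y + c0" using elim by blast
    qed
  qed
  moreover have "rotation_matrix R0" using U(3) T(3) RC by blast
  ultimately show ?thesis by blast
qed

subsection \<open>Geometry of the cylinder and the fibers\<close>

lemma cross_proj_nth [simp]: "cross_proj x $ 1 = x $ 1" "cross_proj x $ 2 = x $ 2"
  by (simp_all add: cross_proj_def)

lemma continuous_cross_proj: "continuous_on S cross_proj"
proof -
  have eq: "cross_proj = (\<lambda>x. \<chi> i. if i = 1 then x $ 1 else x $ 2)"
    by (simp add: fun_eq_iff vec_eq_iff forall_2)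
  show ?thesis unfolding eq
  proof (rule continuous_on_vec_lambda)
    show "continuous_on S (\<lambda>x. if i = 1 then x $ 1 else x $ 2)" for i :: 2
      by (cases "i = 1") (auto intro!: continuous_intros)
  qed
qed

lemma open_cylinder: assumes "open w" shows "open (cylinder w L)"
proof -
  have "cylinder w L = cross_proj -` w \<inter> {x. 0 < x $ 3} \<inter> {x. x $ 3 < L}"
    by (auto simp: cylinder_def)
  moreover have "open (cross_proj -` w)" by (rule open_vimage[OF assms continuous_cross_proj])
  moreover have "open {x::real^3. 0 < x $ 3}" "open {x::real^3. x $ 3 < L}"
    by (intro open_Collect_less continuous_intros)+
  ultimately show ?thesis by auto
qed

lemma bounded_cylinder: assumes "bounded w" shows "bounded (cylinder w L)"
proof -
  obtain B where B: "\<And>y. y \<in> w \<Longrightarrow> norm y \<le> B" using assms unfolding bounded_iff by blast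
  have "norm x \<le> B + B + L" if x: "x \<in> cylinder w L" for x
  proof -
    have "norm x \<le> (\<Sum>i\<in>UNIV. \<bar>x $ i\<bar>)" by (rule norm_le_l1_cart)
    also have "\<dots> = \<bar>cross_proj x $ 1\<bar> + \<bar>cross_proj x $ 2\<bar> + \<bar>x $ 3\<bar>" by (simp add: sum_3)
    also have "\<dots> \<le> B + B + L"
      using x B[of "cross_proj x"] component_le_norm_cart[of "cross_proj x" 1] component_le_norm_cart[of "cross_proj x" 2]
      by (auto simp: cylinder_def)
    finally show ?thesis .
  qed
  then show ?thesis unfolding bounded_iff by blast
qed

lemma connected_cylinder: assumes "connected w" shows "connected (cylinder w L)"
proof -
  define F :: "(real^2) \<times> real \<Rightarrow> real^3" where
    "F z = (\<chi> i. if i = 1 then fst z $ 1 else if i = 2 then fst z $ 2 else snd z)" for z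
  have F: "F z $ 1 = fst z $ 1" "F z $ 2 = fst z $ 2" "F z $ 3 = snd z" for z by (simp_all add: F_def)
  have "continuous_on UNIV F"
    unfolding F_def
  proof (rule continuous_on_vec_lambda)
    show "continuous_on UNIV (\<lambda>z::(real^2) \<times> real. if i = 1 then fst z $ 1 else if i = 2 then fst z $ 2 else snd z)" for i :: 3
      by (cases "i = 1"; cases "i = 2") (auto intro!: continuous_intros)
  qed
  then have "connected (F ` (w \<times> {0<..<L}))"
    using assms by (intro connected_continuous_image connected_Times) (auto intro: continuous_on_subset)
  moreover have "F ` (w \<times> {0<..<L}) = cylinder w L"
  proof (intro equalityI subsetI)
    fix x assume "x \<in> F ` (w \<times> {0<..<L})"
    then obtain y t where x: "y \<in> w" "0 < t" "t < L" "x = F (y, t)" by auto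
    have "cross_proj x = y" by (simp add: vec_eq_iff forall_2 x F)
    then show "x \<in> cylinder w L" using x by (simp add: cylinder_def F)
  next
    fix x assume x: "x \<in> cylinder w L"
    have "x = F (cross_proj x, x $ 3)" by (simp add: vec_eq_iff forall_3 F)
    moreover have "(cross_proj x, x $ 3) \<in> w \<times> {0<..<L}" using x by (auto simp: cylinder_def)
    ultimately show "x \<in> F ` (w \<times> {0<..<L})" by (rule image_eqI)
  qed
  ultimately show ?thesis by simp
qed

lemma cylinder_ne: assumes "w \<noteq> {}" "0 < L" shows "cylinder w L \<noteq> {}"
proof -
  obtain y where "y \<in> w" using assms by blast
  moreover have "cross_proj (vector [y $ 1, y $ 2, L / 2]) = y" by (simp add: vec_eq_iff forall_2)
  ultimately have "vector [y $ 1, y $ 2, L / 2] \<in> cylinder w L" using assms by (simp add: cylinder_def)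
  then show ?thesis by blast
qed

lemma open_Y_rig: assumes "fiber_family \<alpha> \<delta> W" "0 < e" shows "open (Y_rig W e)"
proof -
  have "open (W e k)" for k using assms unfolding fiber_family_def domain_set_def by blast
  then have "open (cross_proj -` W e k)" for k by (intro open_vimage continuous_cross_proj)
  moreover have "Y_rig W e = (\<Union>k. cross_proj -` W e k)" by (auto simp: Y_rig_def)
  ultimately show ?thesis by auto
qed

text \<open>The floor picks the cell of side e that contains the projection of x. The center of the
  fiber square lies in the same cell, hence within e in each coordinate.\<close>

lemma nearby_fiber:
  fixes x :: "real^3"
  assumes W: "fiber_family \<alpha> \<delta> W" and e: "0 < e"
  shows "\<exists>c::real^3. \<bar>c $ 1 - x $ 1\<bar> \<le> e \<and> \<bar>c $ 2 - x $ 2\<bar> \<le> e \<and>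
     {y. \<bar>y $ 1 - c $ 1\<bar> < \<delta> * e / 2 \<and> \<bar>y $ 2 - c $ 2\<bar> < \<delta> * e / 2} \<subseteq> Y_rig W e"
proof -
  define k :: "int^2" where "k = (\<chi> i. \<lfloor>cross_proj x $ i / e\<rfloor>)"
  obtain a where a: "a \<in> cell e k {y. \<forall>i. y $ i \<in> {0..<1}}"
    and sub: "(\<lambda>y. a + e *\<^sub>R y) ` {y. \<forall>i. y $ i \<in> {- \<delta> / 2<..<\<delta> / 2}} \<subseteq> W e k"
    using W e unfolding fiber_family_def by blast
  obtain z where z: "\<And>i. 0 \<le> z $ i \<and> z $ i < 1" "a = e *\<^sub>R ((\<chi> i. of_int (k $ i)) + z)"
    using a unfolding cell_def by auto
  have near: "\<bar>a $ i - cross_proj x $ i\<bar> \<le> e" for i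
  proof -
    let ?t = "cross_proj x $ i"
    have k: "of_int (k $ i) \<le> ?t / e" "?t / e < of_int (k $ i) + 1" unfolding k_def by auto
    have "a $ i / e = of_int (k $ i) + z $ i" using e by (simp add: z(2))
    then have "\<bar>a $ i / e - ?t / e\<bar> \<le> 1" using k z(1)[of i] by linarith
    then have "\<bar>(a $ i - ?t) / e\<bar> \<le> 1" by (simp add: diff_divide_distrib)
    then show ?thesis using e by (simp add: abs_divide)
  qed
  define c :: "real^3" where "c = vector [a $ 1, a $ 2, 0]"
  have "y \<in> Y_rig W e" if y: "\<bar>y $ 1 - c $ 1\<bar> < \<delta> * e / 2" "\<bar>y $ 2 - c $ 2\<bar> < \<delta> * e / 2" for y
  proof -
    let ?v = "(cross_proj y - a) /\<^sub>R e"
    have v: "?v $ 1 = (y $ 1 - c $ 1) / e" "?v $ 2 = (y $ 2 - c $ 2) / e"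
      by (simp_all add: c_def divide_inverse mult.commute)
    have b: "\<bar>t / e\<bar> < \<delta> / 2" if "\<bar>t\<bar> < \<delta> * e / 2" for t
      using that e by (simp add: abs_divide pos_divide_less_eq)
    have "\<forall>i. \<bar>?v $ i\<bar> < \<delta> / 2" unfolding forall_2 v using b y by blast
    then have "?v $ i \<in> {- \<delta> / 2<..<\<delta> / 2}" for i
      unfolding greaterThanLessThan_iff abs_less_iff by (metis minus_divide_left minus_less_iff)
    then have "?v \<in> {y. \<forall>i. y $ i \<in> {- \<delta> / 2<..<\<delta> / 2}}" by blast
    then have "a + e *\<^sub>R ?v \<in> W e k" using sub by blast
    then have "cross_proj y \<in> W e k" using e by simp
    then show ?thesis by (auto simp: Y_rig_def)
  qed
  moreover have "\<bar>c $ 1 - x $ 1\<bar> \<le> e" "\<bar>c $ 2 - x $ 2\<bar> \<le> e"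
    using near[of 1] near[of 2] by (simp_all add: c_def)
  ultimately show ?thesis by blast
qed

lemma second_partials_bounded:
  fixes U :: "(real^3) set"
  assumes "(SUP n. MAX (i, j) \<in> {1, 2} \<times> {1, 2}.
           Lp_norm_pow p U (weak_partial U i (weak_partial U j (us n)))) < (\<infinity> :: ennreal)"
  obtains M where "M \<ge> 0" "\<And>n i j. i \<in> {1, 2} \<Longrightarrow> j \<in> {1, 2} \<Longrightarrow>
           Lp_norm_pow p U (weak_partial U i (weak_partial U j (us n))) \<le> ennreal M"
proof -
  let ?f = "\<lambda>n (i, j). Lp_norm_pow p U (weak_partial U i (weak_partial U j (us n)))"
  let ?S = "SUP n. Max (?f n ` ({1, 2} \<times> {1, 2}))"
  have S: "?S < \<infinity>" using assms .
  define M where "M = enn2real ?S"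
  have M: "?S = ennreal M" using S by (simp add: M_def)
  have "Lp_norm_pow p U (weak_partial U i (weak_partial U j (us n))) \<le> ennreal M" if ij: "i \<in> {1, 2}" "j \<in> {1, 2}" for n i j
  proof -
    have "?f n (i, j) \<le> Max (?f n ` ({1, 2} \<times> {1, 2}))"
      using ij by (intro Max_ge finite_imageI finite_cartesian_product imageI) auto
    also have "\<dots> \<le> ?S" by (rule SUP_upper) simp
    finally show ?thesis unfolding M by simp
  qed
  then show thesis using that[of M] by (simp add: M_def)
qed

theorem theorem1p2:
  fixes \<omega> :: "(real^2) set" and L p \<alpha> \<delta> :: real
    and W :: "real \<Rightarrow> int^2 \<Rightarrow> (real^2) set"
    and \<epsilon> :: "nat \<Rightarrow> real"
    and \<Omega> :: "(real^3) set"
    and u :: "real^3 \<Rightarrow> real^3"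
    and us :: "nat \<Rightarrow> real^3 \<Rightarrow> real^3"
  assumes "0 < \<alpha>" "\<alpha> < 1 / 2" "0 < \<delta>" "\<delta> + 2 * \<alpha> < 1"
    and "fiber_family \<alpha> \<delta> W"
    and "bounded_lipschitz_domain \<omega>" "0 < L" "\<Omega> = cylinder \<omega> L"
    and "1 < p"
    and "u \<in> sobolev_W1 p \<Omega>"
    and "\<And>n. 0 < \<epsilon> n" "\<epsilon> \<longlonglongrightarrow> 0"
    and "\<And>n. us n \<in> sobolev_W1 p \<Omega>"
    and "\<And>n. AE x in lebesgue_on (Y_rig W (\<epsilon> n) \<inter> \<Omega>). rotation_matrix (weak_grad \<Omega> (us n) x)"
    and "\<And>n i j. i \<in> {1, 2} \<Longrightarrow> j \<in> {1, 2} \<Longrightarrow>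
           weakly_differentiable \<Omega> i (weak_partial \<Omega> j (us n))"
    and "(SUP n. MAX (i, j) \<in> {1, 2} \<times> {1, 2}.
           Lp_norm_pow p \<Omega> (weak_partial \<Omega> i (weak_partial \<Omega> j (us n)))) < \<infinity>"
    and "sobolev_weakly_converges p \<Omega> us u"
  shows "\<exists>(R :: real^3^3) (b :: real^3).
           rotation_matrix R \<and> (AE x in lebesgue_on \<Omega>. u x = R *v x + b)"
proof -
  have dom: "open \<omega>" "connected \<omega>" "\<omega> \<noteq> {}" "bounded \<omega>"
    using assms(6) unfolding bounded_lipschitz_domain_def domain_set_def by auto
  have U: "open \<Omega>" "bounded \<Omega>" "connected \<Omega>" "\<Omega> \<noteq> {}"
    unfolding \<open>\<Omega> = cylinder \<omega> L\<close>
    using open_cylinder[OF dom(1)] bounded_cylinder[OF dom(4)] connected_cylinder[OF dom(2)] cylinder_ne[OF dom(3) \<open>0 < L\<close>] by auto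
  have Um: "\<Omega> \<in> lmeasurable" "\<Omega> \<in> sets lebesgue" using lmeasurable_open[OF U(2,1)] U(1) by auto
  have p: "1 \<le> p" using assms(9) by simp
  obtain M where M: "M \<ge> 0" "\<And>n i j. i \<in> {1, 2} \<Longrightarrow> j \<in> {1, 2} \<Longrightarrow>
           Lp_norm_pow p \<Omega> (weak_partial \<Omega> i (weak_partial \<Omega> j (us n))) \<le> ennreal M"
    using second_partials_bounded[OF assms(16)] by blast
  have rep: "\<exists>f'. is_rep \<Omega> f f'" "f \<in> borel_measurable (lebesgue_on \<Omega>)" if "in_Lp p \<Omega> f" for f :: "real^3 \<Rightarrow> real^3"
    using integrable_representative[OF Um(2) in_Lp_integrable(1)[OF Um(1) p that]] that unfolding in_Lp_def by auto
  have W1: "in_Lp p \<Omega> v" "weakly_differentiable \<Omega> j v" "in_Lp p \<Omega> (weak_partial \<Omega> j v)" if "v \<in> sobolev_W1 p \<Omega>" for v :: "real^3 \<Rightarrow> real^3" and j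
    using that unfolding sobolev_W1_def by auto
  have sLp: "in_Lp p \<Omega> (weak_partial \<Omega> i (weak_partial \<Omega> j (us n)))" if ij: "i \<in> {1,2}" "j \<in> {1,2}" for n i j
  proof (rule in_Lp_if_Lp_norm_pow_finite)
    show "weak_partial \<Omega> i (weak_partial \<Omega> j (us n)) \<in> borel_measurable (lebesgue_on \<Omega>)"
      by (rule has_weak_partial_measurable[OF U(1) weak_partial_works[OF assms(15)[OF ij]]])
    show "Lp_norm_pow p \<Omega> (weak_partial \<Omega> i (weak_partial \<Omega> j (us n))) < \<infinity>"
      using M(2)[OF ij, of n] by (rule order_le_less_trans) simp
  qed
  \<comment> \<open>One fixed representative for each function, so that a gradient column is the
    same function when it appears as a derivative and when it is differentiated again.\<close>
  define rp :: "(real^3 \<Rightarrow> real^3) \<Rightarrow> real^3 \<Rightarrow> real^3" where "rp f = (SOME f'. is_rep \<Omega> f f')" for f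
  have rp: "is_rep \<Omega> f (rp f)" if "in_Lp p \<Omega> f" for f
    unfolding rp_def using rep(1)[OF that] by (rule someI_ex)
  have rp_ae: "AE x in lborel. x \<in> \<Omega> \<longrightarrow> rp f x = f x" if "in_Lp p \<Omega> f" for f
    using rp[OF that] unfolding is_rep_def by blast
  have wp1: "wpart \<Omega> j (rp v) (rp (weak_partial \<Omega> j v))" if v: "v \<in> sobolev_W1 p \<Omega>" for v j
    by (rule rep_wpart[OF U(1) weak_partial_works[OF W1(2)[OF v]] rep(2)[OF W1(1)[OF v]] rp[OF W1(1)[OF v]]
          rep(2)[OF W1(3)[OF v]] rp[OF W1(3)[OF v]]])
  define rn where "rn n j = rp (weak_partial \<Omega> j (us n))" for n j
  define hn where "hn n i j = rp (weak_partial \<Omega> i (weak_partial \<Omega> j (us n)))" for n i j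
  define m where "m = measure lebesgue \<Omega>"
  \<comment> \<open>The L^p bound becomes an L^1 bound through t <= 1 + t^p; the four horizontal
    second derivatives together give \<open>4 * (m + M)\<close>.\<close>
  have hle: "(LBINT y. norm (hn n i j y)) \<le> m + M" if ij: "i \<in> {1,2}" "j \<in> {1,2}" for n i j
  proof -
    note f = sLp[OF ij, of n]
    have "(LBINT y. norm (hn n i j y)) = (\<integral>y. norm (weak_partial \<Omega> i (weak_partial \<Omega> j (us n)) y) \<partial>lebesgue_on \<Omega>)"
      using rp[OF f] unfolding is_rep_def hn_def by blast
    also have "\<dots> \<le> m + enn2real (Lp_norm_pow p \<Omega> (weak_partial \<Omega> i (weak_partial \<Omega> j (us n))))"
      unfolding m_def Lp_norm_pow_eq[OF f] by (rule in_Lp_integrable(2)[OF Um(1) p f])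
    also have "\<dots> \<le> m + M" using M(2)[OF ij, of n] M(1) by (simp add: enn2real_leI)
    finally show ?thesis .
  qed
  have hint: "integrable lborel (hn n i j)" if ij: "i \<in> {1,2}" "j \<in> {1,2}" for n i j
    using rp[OF sLp[OF ij, of n]] unfolding is_rep_def hn_def by blast
  interpret fiber_sequence \<Omega> "\<lambda>n. rp (us n)" rn hn "rp u" "\<lambda>j. rp (weak_partial \<Omega> j u)" \<epsilon> \<delta> "4 * (m + M)"
  proof
    show "wpart \<Omega> j (rp (us n)) (rn n j)" for n j unfolding rn_def by (rule wp1[OF assms(13)])
    show "wpart \<Omega> i (rn n j) (hn n i j)" if ij: "i \<in> {1,2}" "j \<in> {1,2}" for n i j
      unfolding rn_def hn_def
      by (rule rep_wpart[OF U(1) weak_partial_works[OF assms(15)[OF ij]] rep(2)[OF W1(3)[OF assms(13)]] rp[OF W1(3)[OF assms(13)]]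
          rep(2)[OF sLp[OF ij]] rp[OF sLp[OF ij]]])
    show "wpart \<Omega> j (rp u) (rp (weak_partial \<Omega> j u))" for j by (rule wp1[OF assms(10)])
    show "(LBINT y. (\<Sum>i\<in>{1,2}. \<Sum>j\<in>{1,2}. norm (hn n i j y))) \<le> 4 * (m + M)" for n
    proof -
      have "(LBINT y. (\<Sum>i\<in>{1,2}. \<Sum>j\<in>{1,2}. norm (hn n i j y))) = (\<Sum>i\<in>{1,2}. \<Sum>j\<in>{1,2}. LBINT y. norm (hn n i j y))"
        using hint[of 1 1 n] hint[of 1 2 n] hint[of 2 1 n] hint[of 2 2 n] by simp
      also have "\<dots> \<le> (\<Sum>i\<in>{1,2::3}. \<Sum>j\<in>{1,2::3}. m + M)"
        by (intro sum_mono hle)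
      finally show ?thesis by simp
    qed
    show "(\<lambda>n. LBINT y. tens g y *\<^sub>R rp (us n) y) \<longlonglongrightarrow> (LBINT y. tens g y *\<^sub>R rp u y)"
      if "cbox a b \<subseteq> \<Omega>" "tbump a b g" for a b g
      by (rule weak_convergence_tens[OF U(1) Um(1) p that(2,1) assms(17)])
         (rule rp[OF W1(1)[OF assms(13)]] rp[OF W1(1)[OF assms(10)]])+
    show "0 < \<epsilon> n" for n by (rule assms(11))
    show "\<epsilon> \<longlonglongrightarrow> 0" by (rule assms(12))
    show "0 < \<delta>" "\<delta> < 1" using assms(1,3,4) by auto
    show "\<exists>c::real^3. \<bar>c $ 1 - x $ 1\<bar> \<le> \<epsilon> n \<and> \<bar>c $ 2 - x $ 2\<bar> \<le> \<epsilon> n \<and>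
       (AE y in lborel. y \<in> \<Omega> \<longrightarrow> \<bar>y $ 1 - c $ 1\<bar> < \<delta> * \<epsilon> n / 2 \<longrightarrow> \<bar>y $ 2 - c $ 2\<bar> < \<delta> * \<epsilon> n / 2 \<longrightarrow>
          rotation_matrix (mat_of (\<lambda>j. rn n j y)))" for n and x :: "real^3"
    proof -
      obtain c :: "real^3" where c: "\<bar>c $ 1 - x $ 1\<bar> \<le> \<epsilon> n" "\<bar>c $ 2 - x $ 2\<bar> \<le> \<epsilon> n"
         "{y. \<bar>y $ 1 - c $ 1\<bar> < \<delta> * \<epsilon> n / 2 \<and> \<bar>y $ 2 - c $ 2\<bar> < \<delta> * \<epsilon> n / 2} \<subseteq> Y_rig W (\<epsilon> n)"
        using nearby_fiber[OF assms(5) assms(11)] by blast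
      have "open (Y_rig W (\<epsilon> n) \<inter> \<Omega>)" using open_Y_rig[OF assms(5) assms(11)] U(1) by auto
      then have Ym: "Y_rig W (\<epsilon> n) \<inter> \<Omega> \<in> sets lebesgue" by auto
      have "AE y in lebesgue. y \<in> Y_rig W (\<epsilon> n) \<inter> \<Omega> \<longrightarrow> rotation_matrix (weak_grad \<Omega> (us n) y)"
        using assms(14)[of n] by (subst (asm) AE_restrict_space_iff) (use Ym in auto)
      then have rot: "AE y in lborel. y \<in> Y_rig W (\<epsilon> n) \<inter> \<Omega> \<longrightarrow> rotation_matrix (weak_grad \<Omega> (us n) y)"
        by (simp only: AE_completion_iff)
      have "AE y in lborel. \<forall>j. y \<in> \<Omega> \<longrightarrow> rn n j y = weak_partial \<Omega> j (us n) y"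
        unfolding AE_all_countable rn_def using rp_ae[OF W1(3)[OF assms(13)]] by blast
      with rot have "AE y in lborel. y \<in> \<Omega> \<longrightarrow> \<bar>y $ 1 - c $ 1\<bar> < \<delta> * \<epsilon> n / 2 \<longrightarrow> \<bar>y $ 2 - c $ 2\<bar> < \<delta> * \<epsilon> n / 2 \<longrightarrow>
          rotation_matrix (mat_of (\<lambda>j. rn n j y))"
      proof eventually_elim
        case (elim y)
        show ?case
        proof (intro impI)
          assume y: "y \<in> \<Omega>" "\<bar>y $ 1 - c $ 1\<bar> < \<delta> * \<epsilon> n / 2" "\<bar>y $ 2 - c $ 2\<bar> < \<delta> * \<epsilon> n / 2"
          then have "y \<in> Y_rig W (\<epsilon> n) \<inter> \<Omega>" using c(3) by blast
          then have "rotation_matrix (weak_grad \<Omega> (us n) y)" using elim(1) by blast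
          moreover have "mat_of (\<lambda>j. rn n j y) = weak_grad \<Omega> (us n) y"
            using elim(2) y(1) by (simp add: weak_grad_def)
          ultimately show "rotation_matrix (mat_of (\<lambda>j. rn n j y))" by simp
        qed
      qed
      then show ?thesis using c(1,2) by blast
    qed
  qed
  have "\<exists>R c. rotation_matrix R \<and> (AE y in lborel. y \<in> \<Omega> \<longrightarrow> rp u y = R *v y + c)"
  proof (rule rigid_of_locally_rigid[OF U(1,3,4)])
    fix x0 assume "x0 \<in> \<Omega>"
    then obtain e where e: "e > 0" "ball x0 e \<subseteq> \<Omega>" using U(1) open_contains_ball by blast
    \<comment> \<open>In the sum norm a cube of half-side 3 s has radius 9 s, which is less than e =
      12 s.\<close>
    define s where "s = e / 12"
    have s: "s > 0" using e by (simp add: s_def)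
    have "cbox (x0 - vec (3 * s)) (x0 + vec (3 * s)) \<subseteq> ball x0 e"
    proof
      fix y assume "y \<in> cbox (x0 - vec (3 * s)) (x0 + vec (3 * s))"
      then have y: "x0 $ i - 3 * s \<le> y $ i" "y $ i \<le> x0 $ i + 3 * s" for i by (auto simp: mem_box_cart)
      have "norm (x0 - y) \<le> (\<Sum>i\<in>UNIV. \<bar>(x0 - y) $ i\<bar>)" by (rule norm_le_l1_cart)
      also have "\<dots> \<le> (\<Sum>i\<in>(UNIV::3 set). 3 * s)"
      proof (rule sum_mono)
        fix i show "\<bar>(x0 - y) $ i\<bar> \<le> 3 * s" using y[of i] by (simp add: abs_le_iff)
      qed
      also have "\<dots> = 9 * s" by simp
      also have "\<dots> < e" using e by (simp add: s_def)
      finally show "y \<in> ball x0 e" by (simp add: dist_norm)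
    qed
    then have "cbox (x0 - vec (3 * s)) (x0 + vec (3 * s)) \<subseteq> \<Omega>" using e by blast
    from locally_rigid[OF s this] obtain R c where R: "rotation_matrix R"
      "AE x in lborel. x \<in> cbox (x0 - vec (s / 2)) (x0 + vec (s / 2)) \<longrightarrow> rp u x = R *v x + c" by blast
    let ?T = "box (x0 - vec (s / 2)) (x0 + vec (s / 2))"
    have "AE x in lborel. x \<in> ?T \<longrightarrow> rp u x = R *v x + c"
      using R(2) by eventually_elim (use box_subset_cbox in blast)
    moreover have "open ?T" "x0 \<in> ?T" using s by (auto simp: mem_box_cart)
    ultimately show "\<exists>T R c. open T \<and> x0 \<in> T \<and> rotation_matrix R \<and> (AE y in lborel. y \<in> T \<longrightarrow> rp u y = R *v y + c)"
      using R(1) by blast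
  qed
  then obtain R c where R: "rotation_matrix R" "AE y in lborel. y \<in> \<Omega> \<longrightarrow> rp u y = R *v y + c" by blast
  have "AE y in lborel. y \<in> \<Omega> \<longrightarrow> u y = R *v y + c"
    using R(2) rp_ae[OF W1(1)[OF assms(10)]] by eventually_elim auto
  then have "AE y in lebesgue. y \<in> \<Omega> \<longrightarrow> u y = R *v y + c" by (rule AE_completion)
  then have "AE y in lebesgue_on \<Omega>. u y = R *v y + c"
    using Um(2) by (subst AE_restrict_space_iff) auto
  then show ?thesis using R(1) by blast
qed

end
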